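(* Let $g_1,g_2\in\mathcal{S}([0,\infty))$ and $h_1\in C^\infty([0,\infty))$, and let $\psi_1(x,t),\psi_2(x,t)$ be the functions defined in the context for $x>0$, $t>0$, $x\neq t$. Then the following hold. (1) For nonnegative integers $n$ and $l$, the limits $$\lim_{t\to0^+}\frac{\partial^{n+l}\psi_1(x,t)}{\partial x^n\partial t^l}\quad\text{and}\quad\lim_{t\to0^+}\frac{\partial^{n+l}\psi_2(x,t)}{\partial x^n\partial t^l}$$ exist, uniformly for $x$ in compact subsets of $\mathbb{R}^+$, and define $C^\infty$ functions of $x\in\mathbb{R}^+$. (2) For nonnegative integers $n$ and $l$, the limits $$\lim_{x\to0^+}\frac{\partial^{n+l}\psi_1(x,t)}{\partial x^n\partial t^l}\quad\text{and}\quad\lim_{x\to0^+}\frac{\partial^{n+l}\psi_2(x,t)}{\partial x^n\partial t^l}$$ exist, uniformly for $t$ in compact subsets of $\mathbb{R}^+$, and define $C^\infty$ functions of $t\in\mathbb{R}^+$. (3) The functions $\psi_1$ and $\psi_2$ extend to $C^\infty$ functions in open neighborhoods of the open half-lines $\{(x,0):x>0\}$ and $\{(0,t):t>0\}$. (4) For every nonnegative integer $n$, $\lim_{t\to0^+}\dfrac{\partial^n\psi_1(x,t)}{\partial x^n}=\dfrac{d^ng_1(x)}{dx^n}$ and $\lim_{t\to0^+}\dfrac{\partial^n\psi_2(x,t)}{\partial x^n}=\dfrac{d^ng_2(x)}{dx^n}$, for $x\in\mathbb{R}^+$. (5) For every nonnegative integer $l$, $\lim_{x\to0^+}\dfrac{\partial^l\psi_1(x,t)}{\partial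 t^l}=\dfrac{d^lh_1(t)}{dt^l}$, for $t\in\mathbb{R}^+$.
   Context: Fix a real number $m\ge 0$. $\mathbb{R}^+=(0,\infty)$. $\mathcal{S}([0,\infty))$ is the space of (complex-valued) $C^\infty$ functions $g$ on $[0,\infty)$ with $\sup_{x\ge0}x^a|g^{(b)}(x)|<\infty$ for all nonnegative integers $a,b$. For $\lambda\in\mathbb{R}$: $\rho(\lambda)=\sqrt{\lambda^2+m^2}$ (nonnegative root), $\omega_1(\lambda)=i\rho(\lambda)$, $\omega_2(\lambda)=-i\rho(\lambda)$, and $\hat g_j(\lambda)=\int_0^\infty e^{-i\lambda y}g_j(y)\,dy$ ($j=1,2$). For $x>0$, $t>0$, $x\ne t$ set $$\mathcal{G}_{1,1}=\int_{-\infty}^{\infty}e^{i\lambda x-\omega_1(\lambda)t}\{\lambda\hat g_2(\lambda)+[i\omega_2(\lambda)+m]\hat g_1(\lambda)\}\tfrac{d\lambda}{2\rho(\lambda)},\quad \mathcal{G}_{1,2}=\int_{-\infty}^{\infty}e^{i\lambda x-\omega_1(\lambda)t}\{\lambda\hat g_2(-\lambda)-[i\omega_2(\lambda)+m]\hat g_1(-\lambda)\}\tfrac{d\lambda}{2\rho(\lambda)},$$ $$\mathcal{G}_{1,3}=\int_{-\infty}^{\infty}e^{i\lambda x-\omega_2(\lambda)t}\{\lambda\hat g_2(\lambda)+[i\omega_1(\lambda)+m]\hat g_1(\lambda)\}\tfrac{d\lambda}{2\rho(\lambda)},\quad \mathcal{G}_{1,4}=\int_{-\infty}^{\infty}e^{i\lambda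 x-\omega_2(\lambda)t}\{\lambda\hat g_2(-\lambda)-[i\omega_1(\lambda)+m]\hat g_1(-\lambda)\}\tfrac{d\lambda}{2\rho(\lambda)},$$ $$\mathcal{G}_{2,1}=\int_{-\infty}^{\infty}e^{i\lambda x-\omega_1(\lambda)t}\{\lambda\hat g_1(\lambda)-[i\omega_1(\lambda)+m]\hat g_2(\lambda)\}\tfrac{d\lambda}{2\rho(\lambda)},\quad \mathcal{G}_{2,2}=\int_{-\infty}^{\infty}e^{i\lambda x-\omega_1(\lambda)t}\{\lambda\hat g_1(-\lambda)+[i\omega_1(\lambda)+m]\hat g_2(-\lambda)\}\tfrac{d\lambda}{2\rho(\lambda)},$$ $$\mathcal{G}_{2,3}=\int_{-\infty}^{\infty}e^{i\lambda x-\omega_2(\lambda)t}\{\lambda\hat g_1(\lambda)-[i\omega_2(\lambda)+m]\hat g_2(\lambda)\}\tfrac{d\lambda}{2\rho(\lambda)},\quad \mathcal{G}_{2,4}=\int_{-\infty}^{\infty}e^{i\lambda x-\omega_2(\lambda)t}\{\lambda\hat g_1(-\lambda)+[i\omega_2(\lambda)+m]\hat g_2(-\lambda)\}\tfrac{d\lambda}{2\rho(\lambda)},$$ and, for $s=1,2$, $$\mathcal{H}_{1,s}=\int_{-\infty}^{\infty}e^{i\lambda x-\omega_s(\lambda)t}\Big[\int_0^t h_1(\tau)e^{\omega_s(\lambda)\tau}d\tau\Big]\tfrac{\lambda\,d\lambda}{\rho(\lambda)},\quad \mathcal{H}_{2,s}=\int_{-\infty}^{\infty}e^{i\lambda x-\omega_s(\lambda)t}\Big[\int_0^t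 h_1(\tau)e^{\omega_s(\lambda)\tau}d\tau\Big]\tfrac{[i\omega_s(\lambda)+m]\,d\lambda}{\rho(\lambda)}.$$ All integrals $\int_{-\infty}^\infty$ are understood in the generalized sense $\lim_{A\to\infty}\int_0^A+\lim_{A\to\infty}\int_{-A}^0$. The functions $\psi_1,\psi_2$ are defined by $$2\pi\psi_1=\mathcal{G}_{1,1}+\mathcal{G}_{1,2}-\mathcal{G}_{1,3}-\mathcal{G}_{1,4}+\mathcal{H}_{1,1}-\mathcal{H}_{1,2},\qquad 2\pi\psi_2=\mathcal{G}_{2,1}-\mathcal{G}_{2,2}-\mathcal{G}_{2,3}+\mathcal{G}_{2,4}-\mathcal{H}_{2,1}+\mathcal{H}_{2,2}.$$ *)

theory Defs
  imports "HOL-Analysis.Analysis"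
begin

text \<open>Smoothness on a set \<open>S\<close>, by iterated (Frechet) derivatives relative to \<open>S\<close>. It is used for open
  \<open>S\<close>, where the relative derivative is the ordinary one, and for the closed half-line
  \<open>{0..}\<close>, where it is one-sided at the endpoint.\<close>

primrec Ck_on :: "nat \<Rightarrow> 'a::euclidean_space set \<Rightarrow> ('a \<Rightarrow> complex) \<Rightarrow> bool" where
  "Ck_on 0 S f \<longleftrightarrow> continuous_on S f"
| "Ck_on (Suc k) S f \<longleftrightarrow>
     (\<exists>D. (\<forall>p\<in>S. (f has_derivative D p) (at p within S)) \<and> (\<forall>v. Ck_on k S (\<lambda>p. D p v)))"

definition smooth_on :: "'a::euclidean_space set \<Rightarrow> ('a \<Rightarrow> complex) \<Rightarrow> bool" where
  "smooth_on S f \<longleftrightarrow> (\<forall>k. Ck_on k S f)"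

definition half_line_deriv :: "nat \<Rightarrow> (real \<Rightarrow> complex) \<Rightarrow> real \<Rightarrow> complex" where
  "half_line_deriv b = (\<lambda>f x. vector_derivative f (at x within {0..})) ^^ b"

definition schwartz_half_line :: "(real \<Rightarrow> complex) set" where
  "schwartz_half_line =
     {g. smooth_on {0..} g \<and>
         (\<forall>a b. bdd_above ((\<lambda>x. x ^ a * norm (half_line_deriv b g x)) ` {0..}))}"

definition partial_x :: "(real \<Rightarrow> real \<Rightarrow> complex) \<Rightarrow> real \<Rightarrow> real \<Rightarrow> complex" where
  "partial_x f x t = vector_derivative (\<lambda>y. f y t) (at x)"

definition partial_t :: "(real \<Rightarrow> real \<Rightarrow> complex) \<Rightarrow> real \<Rightarrow> real \<Rightarrow> complex" where
  "partial_t f x t = vector_derivative (\<lambda>s. f x s) (at t)"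

definition mixed_partial :: "nat \<Rightarrow> nat \<Rightarrow> (real \<Rightarrow> real \<Rightarrow> complex) \<Rightarrow> real \<Rightarrow> real \<Rightarrow> complex" where
  "mixed_partial n l f = (partial_x ^^ n) ((partial_t ^^ l) f)"

text \<open>Since \<^const>\<open>vector_derivative\<close> is total, the existence of the derivatives entering
  \<^const>\<open>mixed_partial\<close> is recorded separately.\<close>

definition mixed_partial_exists ::
    "nat \<Rightarrow> nat \<Rightarrow> (real \<Rightarrow> real \<Rightarrow> complex) \<Rightarrow> real \<Rightarrow> real \<Rightarrow> bool" where
  "mixed_partial_exists n l f x t \<longleftrightarrow>
     (\<exists>V. open V \<and> (x, t) \<in> V \<and>
        (\<forall>(y, s)\<in>V.
           (\<forall>j<l. (\<lambda>s'. mixed_partial 0 j f y s') differentiable at s) \<and>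
           (\<forall>i<n. (\<lambda>y'. mixed_partial i l f y' s) differentiable at y)))"

definition generalized_integral :: "(real \<Rightarrow> complex) \<Rightarrow> complex" where
  "generalized_integral f =
     Lim at_top (\<lambda>A. integral {0..A} f) + Lim at_top (\<lambda>A. integral {-A..0} f)"

definition half_line_fourier :: "(real \<Rightarrow> complex) \<Rightarrow> real \<Rightarrow> complex" where
  "half_line_fourier g k = integral {0..} (\<lambda>y. exp (- \<i> * of_real k * of_real y) * g y)"

definition rho :: "real \<Rightarrow> real \<Rightarrow> complex" where
  "rho m k = of_real (sqrt (k\<^sup>2 + m\<^sup>2))"

definition omega1 :: "real \<Rightarrow> real \<Rightarrow> complex" where
  "omega1 m k = \<i> * rho m k"

definition omega2 :: "real \<Rightarrow> real \<Rightarrow> complex" where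
  "omega2 m k = - \<i> * rho m k"

text \<open>The spectral variable \<open>\<lambda>\<close> is written \<open>k\<close>. In case \<open>m = 0\<close> the integrands below divide
  by zero at the single point \<open>k = 0\<close>, which is irrelevant for the integrals.\<close>

definition G11 :: "real \<Rightarrow> (real \<Rightarrow> complex) \<Rightarrow> (real \<Rightarrow> complex) \<Rightarrow> real \<Rightarrow> real \<Rightarrow> complex" where
  "G11 m g1 g2 x t = generalized_integral (\<lambda>k.
     exp (\<i> * of_real k * of_real x - omega1 m k * of_real t) *
     (of_real k * half_line_fourier g2 k +
      (\<i> * omega2 m k + of_real m) * half_line_fourier g1 k) / (2 * rho m k))"

definition G12 :: "real \<Rightarrow> (real \<Rightarrow> complex) \<Rightarrow> (real \<Rightarrow> complex) \<Rightarrow> real \<Rightarrow> real \<Rightarrow> complex" where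
  "G12 m g1 g2 x t = generalized_integral (\<lambda>k.
     exp (\<i> * of_real k * of_real x - omega1 m k * of_real t) *
     (of_real k * half_line_fourier g2 (- k) -
      (\<i> * omega2 m k + of_real m) * half_line_fourier g1 (- k)) / (2 * rho m k))"

definition G13 :: "real \<Rightarrow> (real \<Rightarrow> complex) \<Rightarrow> (real \<Rightarrow> complex) \<Rightarrow> real \<Rightarrow> real \<Rightarrow> complex" where
  "G13 m g1 g2 x t = generalized_integral (\<lambda>k.
     exp (\<i> * of_real k * of_real x - omega2 m k * of_real t) *
     (of_real k * half_line_fourier g2 k +
      (\<i> * omega1 m k + of_real m) * half_line_fourier g1 k) / (2 * rho m k))"

definition G14 :: "real \<Rightarrow> (real \<Rightarrow> complex) \<Rightarrow> (real \<Rightarrow> complex) \<Rightarrow> real \<Rightarrow> real \<Rightarrow> complex" where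
  "G14 m g1 g2 x t = generalized_integral (\<lambda>k.
     exp (\<i> * of_real k * of_real x - omega2 m k * of_real t) *
     (of_real k * half_line_fourier g2 (- k) -
      (\<i> * omega1 m k + of_real m) * half_line_fourier g1 (- k)) / (2 * rho m k))"

definition G21 :: "real \<Rightarrow> (real \<Rightarrow> complex) \<Rightarrow> (real \<Rightarrow> complex) \<Rightarrow> real \<Rightarrow> real \<Rightarrow> complex" where
  "G21 m g1 g2 x t = generalized_integral (\<lambda>k.
     exp (\<i> * of_real k * of_real x - omega1 m k * of_real t) *
     (of_real k * half_line_fourier g1 k -
      (\<i> * omega1 m k + of_real m) * half_line_fourier g2 k) / (2 * rho m k))"

definition G22 :: "real \<Rightarrow> (real \<Rightarrow> complex) \<Rightarrow> (real \<Rightarrow> complex) \<Rightarrow> real \<Rightarrow> real \<Rightarrow> complex" where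
  "G22 m g1 g2 x t = generalized_integral (\<lambda>k.
     exp (\<i> * of_real k * of_real x - omega1 m k * of_real t) *
     (of_real k * half_line_fourier g1 (- k) +
      (\<i> * omega1 m k + of_real m) * half_line_fourier g2 (- k)) / (2 * rho m k))"

definition G23 :: "real \<Rightarrow> (real \<Rightarrow> complex) \<Rightarrow> (real \<Rightarrow> complex) \<Rightarrow> real \<Rightarrow> real \<Rightarrow> complex" where
  "G23 m g1 g2 x t = generalized_integral (\<lambda>k.
     exp (\<i> * of_real k * of_real x - omega2 m k * of_real t) *
     (of_real k * half_line_fourier g1 k -
      (\<i> * omega2 m k + of_real m) * half_line_fourier g2 k) / (2 * rho m k))"

definition G24 :: "real \<Rightarrow> (real \<Rightarrow> complex) \<Rightarrow> (real \<Rightarrow> complex) \<Rightarrow> real \<Rightarrow> real \<Rightarrow> complex" where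
  "G24 m g1 g2 x t = generalized_integral (\<lambda>k.
     exp (\<i> * of_real k * of_real x - omega2 m k * of_real t) *
     (of_real k * half_line_fourier g1 (- k) +
      (\<i> * omega2 m k + of_real m) * half_line_fourier g2 (- k)) / (2 * rho m k))"

definition H11 :: "real \<Rightarrow> (real \<Rightarrow> complex) \<Rightarrow> real \<Rightarrow> real \<Rightarrow> complex" where
  "H11 m h1 x t = generalized_integral (\<lambda>k.
     exp (\<i> * of_real k * of_real x - omega1 m k * of_real t) *
     integral {0..t} (\<lambda>\<tau>. h1 \<tau> * exp (omega1 m k * of_real \<tau>)) *
     of_real k / rho m k)"

definition H12 :: "real \<Rightarrow> (real \<Rightarrow> complex) \<Rightarrow> real \<Rightarrow> real \<Rightarrow> complex" where
  "H12 m h1 x t = generalized_integral (\<lambda>k.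
     exp (\<i> * of_real k * of_real x - omega2 m k * of_real t) *
     integral {0..t} (\<lambda>\<tau>. h1 \<tau> * exp (omega2 m k * of_real \<tau>)) *
     of_real k / rho m k)"

definition H21 :: "real \<Rightarrow> (real \<Rightarrow> complex) \<Rightarrow> real \<Rightarrow> real \<Rightarrow> complex" where
  "H21 m h1 x t = generalized_integral (\<lambda>k.
     exp (\<i> * of_real k * of_real x - omega1 m k * of_real t) *
     integral {0..t} (\<lambda>\<tau>. h1 \<tau> * exp (omega1 m k * of_real \<tau>)) *
     (\<i> * omega1 m k + of_real m) / rho m k)"

definition H22 :: "real \<Rightarrow> (real \<Rightarrow> complex) \<Rightarrow> real \<Rightarrow> real \<Rightarrow> complex" where
  "H22 m h1 x t = generalized_integral (\<lambda>k.
     exp (\<i> * of_real k * of_real x - omega2 m k * of_real t) *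
     integral {0..t} (\<lambda>\<tau>. h1 \<tau> * exp (omega2 m k * of_real \<tau>)) *
     (\<i> * omega2 m k + of_real m) / rho m k)"

definition psi1 ::
    "real \<Rightarrow> (real \<Rightarrow> complex) \<Rightarrow> (real \<Rightarrow> complex) \<Rightarrow> (real \<Rightarrow> complex) \<Rightarrow> real \<Rightarrow> real \<Rightarrow> complex" where
  "psi1 m g1 g2 h1 x t =
     (G11 m g1 g2 x t + G12 m g1 g2 x t - G13 m g1 g2 x t - G14 m g1 g2 x t
      + H11 m h1 x t - H12 m h1 x t) / (2 * of_real pi)"

definition psi2 ::
    "real \<Rightarrow> (real \<Rightarrow> complex) \<Rightarrow> (real \<Rightarrow> complex) \<Rightarrow> (real \<Rightarrow> complex) \<Rightarrow> real \<Rightarrow> real \<Rightarrow> complex" where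
  "psi2 m g1 g2 h1 x t =
     (G21 m g1 g2 x t - G22 m g1 g2 x t - G23 m g1 g2 x t + G24 m g1 g2 x t
      - H21 m h1 x t + H22 m h1 x t) / (2 * of_real pi)"

text \<open>The values of \<open>psi1\<close> and \<open>psi2\<close> are meaningful on the following open set only, because
  the defining integrals need not converge elsewhere.\<close>

definition psi_domain :: "(real \<times> real) set" where
  "psi_domain = {(x, t). x > 0 \<and> t > 0 \<and> x \<noteq> t}"

definition extends_smoothly_near :: "(real \<times> real) set \<Rightarrow> (real \<Rightarrow> real \<Rightarrow> complex) \<Rightarrow> bool" where
  "extends_smoothly_near L \<psi> \<longleftrightarrow>
     (\<exists>U F. open U \<and> L \<subseteq> U \<and> smooth_on U F \<and> (\<forall>(x, t) \<in> U \<inter> psi_domain. F (x, t) = \<psi> x t))"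

definition partial_limit_at_t0 :: "nat \<Rightarrow> nat \<Rightarrow> (real \<Rightarrow> real \<Rightarrow> complex) \<Rightarrow> bool" where
  "partial_limit_at_t0 n l \<psi> \<longleftrightarrow>
     (\<exists>L. smooth_on {0<..} L \<and>
        (\<forall>K. compact K \<and> K \<subseteq> {0<..} \<longrightarrow>
           (\<forall>\<^sub>F t in at_right 0. \<forall>x\<in>K. mixed_partial_exists n l \<psi> x t) \<and>
           uniform_limit K (\<lambda>t x. mixed_partial n l \<psi> x t) L (at_right 0)))"

definition partial_limit_at_x0 :: "nat \<Rightarrow> nat \<Rightarrow> (real \<Rightarrow> real \<Rightarrow> complex) \<Rightarrow> bool" where
  "partial_limit_at_x0 n l \<psi> \<longleftrightarrow>
     (\<exists>L. smooth_on {0<..} L \<and>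
        (\<forall>K. compact K \<and> K \<subseteq> {0<..} \<longrightarrow>
           (\<forall>\<^sub>F x in at_right 0. \<forall>t\<in>K. mixed_partial_exists n l \<psi> x t) \<and>
           uniform_limit K (\<lambda>x t. mixed_partial n l \<psi> x t) L (at_right 0)))"

end

theory Submission
  imports Defs "HOL-Probability.Sinc_Integral"
begin

text \<open>
  Write \<open>\<rho>\<close> for \<open>freq m k = sqrt (k\<^sup>2 + m\<^sup>2)\<close>. When the integrals that define \<^const>\<open>psi1\<close> and
  \<^const>\<open>psi2\<close> are added up, the exponentials \<open>exp (\<plusminus> \<i> \<rho> t)\<close> only survive in the combinations
  \<open>cos (\<rho> t)\<close>, \<open>sin (\<rho> t) / \<rho>\<close> and \<open>\<i> k sin (\<rho> t) / \<rho>\<close>. These are the multipliers of the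
  Klein--Gordon equation, and by finite speed of propagation each of them is the Fourier
  transform of two point masses at \<open>\<plusminus> t\<close> and a density on \<open>[- t, t]\<close>. The density is built
  from the entire function \<open>J\<^sub>0 (\<surd>w)\<close> of \<open>w = m\<^sup>2 (t\<^sup>2 - u\<^sup>2)\<close>, so it is smooth in both variables
  (\<open>symbol_sin_cos\<close>, \<open>symbol_dsin\<close>).

  Consequently the two functions are sums of translates of the data and of integrals of
  smooth kernels against the data (\<open>psi1_closed_form\<close>, \<open>psi2_closed_form\<close>), with the data on the
  half-line continued by zero and then reflected. The only singularities come from the jump of
  that continuation, and they sit on the diagonal \<open>x = t\<close>. Below the diagonal the reflected data and
  the boundary datum are out of reach, and the formula makes sense and is smooth for
  \<open>\<bar>t\<bar> < x\<close>; above the diagonal the domains of integration can be rescaled to \<open>[0, 1]\<close>, and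
  the formula is smooth for \<open>\<bar>x\<bar> < t\<close>. All limits in the theorem are values of these
  smooth extensions on the two half-lines (\<open>boundary_values_t0\<close>, \<open>boundary_values_x0\<close>). At \<open>t = 0\<close> the kernel
  integrals vanish and the point masses reproduce the initial data; at \<open>x = 0\<close> the direct
  and the reflected initial data cancel in the first component, and only the boundary datum is left.

  Two analytic points need care. The defining integrals converge only conditionally, and each of
  them has to be shown to converge separately on both half-lines before they may be combined: the
  integrands behave like \<open>exp (\<i> k u) / k\<close> with phases \<open>u\<close> among \<open>\<plusminus> x\<close> and \<open>\<plusminus> x \<plusminus> t\<close>, none of which is
  zero when \<open>x\<close> and \<open>t\<close> are positive and distinct
  (\<open>data_integral_line_convergent\<close>, \<open>boundary_integral_line_convergent\<close>). And Fourier inversion has to be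
  carried out under the kernel integral. One integration by parts writes a truncated inversion
  integral in terms of the sine integral \<^const>\<open>Si\<close>; since \<^const>\<open>Si\<close> is bounded, the truncations are bounded
  uniformly in the cut-off and in the base point, and dominated convergence applies
  (\<open>symbol_inversion_half_line\<close>, \<open>symbol_inversion_interval\<close>).
\<close>

section \<open>Calculus of differentiable functions of several variables\<close>

lemma Ck_on_imp_continuous_on:
  assumes "Ck_on k S f"
  shows "continuous_on S f"
proof (cases k)
  case 0
  then show ?thesis using assms by simp
next
  case (Suc j)
  then show ?thesis using assms has_derivative_continuous_on by auto
qed

lemma Ck_on_SucD: "Ck_on (Suc k) S f \<Longrightarrow> Ck_on k S f"
proof (induction k arbitrary: f)
  case 0
  then show ?case using Ck_on_imp_continuous_on Ck_on.simps(1) by blast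
next
  case (Suc k)
  then show ?case by (metis Ck_on.simps(2))
qed

lemma Ck_on_cong:
  assumes "\<And>p. p \<in> S \<Longrightarrow> f p = g p" "Ck_on k S f"
  shows "Ck_on k S g"
proof (cases k)
  case 0
  then show ?thesis using assms continuous_on_cong by fastforce
next
  case (Suc j)
  then obtain D where D: "\<And>p. p \<in> S \<Longrightarrow> (f has_derivative D p) (at p within S)"
    "\<And>v. Ck_on j S (\<lambda>p. D p v)" using assms by auto
  have "(g has_derivative D p) (at p within S)" if "p \<in> S" for p
    using has_derivative_transform[OF that _ D(1)[OF that]] assms by simp
  then show ?thesis using D(2) Suc by auto
qed

lemma Ck_on_subset: "Ck_on k S f \<Longrightarrow> T \<subseteq> S \<Longrightarrow> Ck_on k T f"
proof (induction k arbitrary: f)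
  case 0
  then show ?case using continuous_on_subset by auto
next
  case (Suc k)
  then obtain D where D: "\<forall>p\<in>S. (f has_derivative D p) (at p within S)"
    "\<forall>v. Ck_on k S (\<lambda>p. D p v)" by auto
  have "\<forall>p\<in>T. (f has_derivative D p) (at p within T)"
    using D(1) Suc.prems(2) has_derivative_subset by blast
  then show ?case using D Suc by auto
qed

lemma Ck_on_const: "Ck_on k S (\<lambda>p. c)"
proof (induction k arbitrary: c)
  case (Suc k)
  have "\<forall>p\<in>S. ((\<lambda>p. c) has_derivative (\<lambda>v. 0)) (at p within S)" by simp
  then show ?case using Suc by (auto intro!: exI[of _ "\<lambda>p v. 0"])
qed simp

lemma Ck_on_add: "Ck_on k S f \<Longrightarrow> Ck_on k S g \<Longrightarrow> Ck_on k S (\<lambda>p. f p + g p)"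
proof (induction k arbitrary: f g)
  case 0
  then show ?case by (simp add: continuous_on_add)
next
  case (Suc k)
  from Suc.prems obtain D E where
    D: "\<forall>p\<in>S. (f has_derivative D p) (at p within S)" "\<forall>v. Ck_on k S (\<lambda>p. D p v)" and
    E: "\<forall>p\<in>S. (g has_derivative E p) (at p within S)" "\<forall>v. Ck_on k S (\<lambda>p. E p v)" by auto
  have "\<forall>p\<in>S. ((\<lambda>p. f p + g p) has_derivative (\<lambda>v. D p v + E p v)) (at p within S)"
    using D E by (auto intro!: has_derivative_add)
  then show ?case using D E Suc.IH by (auto intro!: exI[of _ "\<lambda>p v. D p v + E p v"])
qed

lemma Ck_on_mult: "Ck_on k S f \<Longrightarrow> Ck_on k S g \<Longrightarrow> Ck_on k S (\<lambda>p. f p * g p)"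
proof (induction k arbitrary: f g)
  case 0
  then show ?case by (simp add: continuous_on_mult)
next
  case (Suc k)
  from Suc.prems obtain D E where
    D: "\<forall>p\<in>S. (f has_derivative D p) (at p within S)" "\<forall>v. Ck_on k S (\<lambda>p. D p v)" and
    E: "\<forall>p\<in>S. (g has_derivative E p) (at p within S)" "\<forall>v. Ck_on k S (\<lambda>p. E p v)" by auto
  have "\<forall>p\<in>S. ((\<lambda>p. f p * g p) has_derivative (\<lambda>v. f p * E p v + D p v * g p)) (at p within S)"
    using D E by (auto intro!: has_derivative_mult)
  moreover have "\<forall>v. Ck_on k S (\<lambda>p. f p * E p v + D p v * g p)"
    using D(2) E(2) Suc.prems[THEN Ck_on_SucD] by (intro allI Ck_on_add Suc.IH) blast+
  ultimately show ?case by (auto intro!: exI[of _ "\<lambda>p v. f p * E p v + D p v * g p"])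
qed

lemma Ck_on_sum: "(\<And>i. i \<in> I \<Longrightarrow> Ck_on k S (f i)) \<Longrightarrow> Ck_on k S (\<lambda>p. \<Sum>i\<in>I. f i p)"
  by (induction I rule: infinite_finite_induct) (auto intro!: Ck_on_const Ck_on_add)

lemma Ck_on_uminus: "Ck_on k S f \<Longrightarrow> Ck_on k S (\<lambda>p. - f p)"
  using Ck_on_mult[OF Ck_on_const[of k S "-1"]] by auto

lemma Ck_on_diff: "Ck_on k S f \<Longrightarrow> Ck_on k S g \<Longrightarrow> Ck_on k S (\<lambda>p. f p - g p)"
  unfolding diff_conv_add_uminus by (intro Ck_on_add Ck_on_uminus)

lemma Ck_on_linear:
  assumes "bounded_linear L"
  shows "Ck_on k S (\<lambda>p. complex_of_real (L p))"
proof (cases k)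
  case 0
  then show ?thesis using linear_continuous_on[OF assms] by (auto intro!: continuous_intros)
next
  case (Suc j)
  have "\<forall>p\<in>S. ((\<lambda>p. complex_of_real (L p)) has_derivative (\<lambda>v. complex_of_real (L v))) (at p within S)"
    using bounded_linear_imp_has_derivative[OF bounded_linear_compose[OF bounded_linear_of_real assms]] by auto
  then show ?thesis using Suc Ck_on_const by (auto intro!: exI[of _ "\<lambda>p v. complex_of_real (L v)"])
qed

lemma Ck_on_Re: "Ck_on k S f \<Longrightarrow> Ck_on k S (\<lambda>p. complex_of_real (Re (f p)))"
proof (induction k arbitrary: f)
  case 0
  then show ?case by (auto intro!: continuous_intros)
next
  case (Suc k)
  from Suc.prems obtain D where
    D: "\<forall>p\<in>S. (f has_derivative D p) (at p within S)" "\<forall>v. Ck_on k S (\<lambda>p. D p v)" by auto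
  have "\<forall>p\<in>S. ((\<lambda>p. complex_of_real (Re (f p))) has_derivative (\<lambda>v. complex_of_real (Re (D p v)))) (at p within S)"
    using D(1) by (intro ballI bounded_linear.has_derivative[OF bounded_linear_of_real]
        bounded_linear.has_derivative[OF bounded_linear_Re]) blast
  then show ?case using D Suc.IH by (auto intro!: exI[of _ "\<lambda>p v. complex_of_real (Re (D p v))"])
qed

text \<open>By the chain rule a directional derivative of the composition is a sum of products of
  derivatives of the outer function, composed with \<open>\<phi>\<close>, and derivatives of the coordinates of \<open>\<phi>\<close>. The coordinates
  are read as complex-valued functions, the only ones that \<^const>\<open>Ck_on\<close> speaks of.\<close>

lemma Ck_on_compose:
  fixes \<phi> :: "'a::euclidean_space \<Rightarrow> 'b::euclidean_space"
  assumes "\<And>i. i \<in> Basis \<Longrightarrow> Ck_on k S (\<lambda>p. complex_of_real (\<phi> p \<bullet> i))"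
    and "\<phi> ` S \<subseteq> T" and "Ck_on k T f"
  shows "Ck_on k S (\<lambda>p. f (\<phi> p))"
  using assms
proof (induction k arbitrary: f)
  case 0
  have "continuous_on S (\<lambda>p. \<phi> p \<bullet> i)" if "i \<in> Basis" for i
    using 0(1)[OF that] by simp
  then have "continuous_on S \<phi>" using continuous_on_componentwise by blast
  then show ?case using continuous_on_compose2[of T f] 0 by auto
next
  case (Suc k)
  from Suc.prems(3) obtain D where
    D: "\<forall>p\<in>T. (f has_derivative D p) (at p within T)" "\<forall>v. Ck_on k T (\<lambda>p. D p v)" by auto
  have "\<forall>i. \<exists>E. i \<in> Basis \<longrightarrow> (\<forall>p\<in>S. ((\<lambda>p. complex_of_real (\<phi> p \<bullet> i)) has_derivative E p) (at p within S))
     \<and> (\<forall>v. Ck_on k S (\<lambda>p. E p v))" using Suc.prems(1) by auto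
  then obtain E where E: "\<And>i p. i \<in> Basis \<Longrightarrow> p \<in> S \<Longrightarrow>
      ((\<lambda>p. complex_of_real (\<phi> p \<bullet> i)) has_derivative E i p) (at p within S)"
    "\<And>i v. i \<in> Basis \<Longrightarrow> Ck_on k S (\<lambda>p. E i p v)" by metis
  define \<phi>' where "\<phi>' p v = (\<Sum>i\<in>Basis. Re (E i p v) *\<^sub>R i)" for p v
  have comp: "\<phi>' p v \<bullet> i = Re (E i p v)" if "i \<in> Basis" for p v i
    using that unfolding \<phi>'_def by (simp add: inner_sum_left inner_Basis if_distrib sum.delta cong: if_cong)
  have \<phi>': "(\<phi> has_derivative \<phi>' p) (at p within S)" if "p \<in> S" for p
    unfolding has_derivative_componentwise_within[of \<phi>]
  proof
    fix i :: 'b assume i: "i \<in> Basis"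
    have "((\<lambda>p. Re (complex_of_real (\<phi> p \<bullet> i))) has_derivative (\<lambda>v. Re (E i p v))) (at p within S)"
      using bounded_linear.has_derivative[OF bounded_linear_Re E(1)[OF i that]] .
    then show "((\<lambda>x. \<phi> x \<bullet> i) has_derivative (\<lambda>x. \<phi>' p x \<bullet> i)) (at p within S)"
      using comp[OF i] by simp
  qed
  let ?D = "\<lambda>p v. D (\<phi> p) (\<phi>' p v)"
  have 1: "((\<lambda>p. f (\<phi> p)) has_derivative ?D p) (at p within S)" if "p \<in> S" for p
    using has_derivative_in_compose2[OF _ Suc.prems(2) that \<phi>'[OF that], of f D] D(1) by blast
  have 2: "Ck_on k S (\<lambda>p. ?D p v)" for v
  proof -
    have "Ck_on k S (\<lambda>p. \<Sum>i\<in>Basis. complex_of_real (Re (E i p v)) * D (\<phi> p) i)"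
    proof (intro Ck_on_sum Ck_on_mult Ck_on_Re)
      fix i :: 'b assume i: "i \<in> Basis"
      show "Ck_on k S (\<lambda>p. E i p v)" using E(2)[OF i] .
      show "Ck_on k S (\<lambda>p. D (\<phi> p) i)"
        using Suc.IH[of "\<lambda>q. D q i"] Suc.prems D(2) Ck_on_SucD by blast
    qed
    moreover have "(\<Sum>i\<in>Basis. complex_of_real (Re (E i p v)) * D (\<phi> p) i) = ?D p v" if "p \<in> S" for p
    proof -
      have "linear (D (\<phi> p))" using D(1) that Suc.prems(2) has_derivative_linear by blast
      then show ?thesis unfolding \<phi>'_def by (simp add: linear_sum linear_scale scaleR_conv_of_real)
    qed
    ultimately show ?thesis by (rule Ck_on_cong[rotated])
  qed
  show ?case using 1 2 by (auto intro!: exI[of _ ?D])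
qed

lemma Ck_on_compose_real:
  fixes \<phi> :: "'a::euclidean_space \<Rightarrow> real"
  assumes "Ck_on k S (\<lambda>p. complex_of_real (\<phi> p))" "\<phi> ` S \<subseteq> T" "Ck_on k T f"
  shows "Ck_on k S (\<lambda>p. f (\<phi> p))"
  using assms by (intro Ck_on_compose[of k S \<phi> T f]) auto

lemma Ck_on_compose_Pair:
  fixes \<phi> \<zeta> :: "'a::euclidean_space \<Rightarrow> real" and f :: "real \<times> real \<Rightarrow> complex"
  assumes "Ck_on k S (\<lambda>p. complex_of_real (\<phi> p))" "Ck_on k S (\<lambda>p. complex_of_real (\<zeta> p))"
    and "\<And>p. p \<in> S \<Longrightarrow> (\<phi> p, \<zeta> p) \<in> T" "Ck_on k T f"
  shows "Ck_on k S (\<lambda>p. f (\<phi> p, \<zeta> p))"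
  using assms by (intro Ck_on_compose[of k S "\<lambda>p. (\<phi> p, \<zeta> p)" T f]) (auto simp: Basis_prod_def)

text \<open>Leibniz's rule keeps a parameter integral in the class: the directional derivatives of the
  integral are parameter integrals of derivatives of the integrand.\<close>

lemma Ck_on_integral:
  fixes f :: "'a::euclidean_space \<times> real \<Rightarrow> complex"
  assumes "Ck_on k (U \<times> {a..b}) f" "convex U"
  shows "Ck_on k U (\<lambda>p. integral {a..b} (\<lambda>r. f (p, r)))"
  using assms
proof (induction k arbitrary: f)
  case 0
  then show ?case
    using integral_continuous_on_param[of U a b "\<lambda>p r. f (p, r)"] by simp
next
  case (Suc k)
  let ?S = "U \<times> {a..b}"
  from Suc.prems(1) obtain D where
    D: "\<And>p. p \<in> ?S \<Longrightarrow> (f has_derivative D p) (at p within ?S)" "\<And>v. Ck_on k ?S (\<lambda>p. D p v)" by auto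
  define B where "B p r = Blinfun (\<lambda>v. D (p, r) (v, 0))" for p r
  have bl: "bounded_linear (\<lambda>v. D (p, r) (v, 0))" if "(p, r) \<in> ?S" for p r
    using bounded_linear_compose[OF has_derivative_bounded_linear[OF D(1)[OF that]], of "\<lambda>v. (v, 0)"]
    by (simp add: bounded_linear_Pair)
  have B: "blinfun_apply (B p r) v = D (p, r) (v, 0)" if "(p, r) \<in> ?S" for p r v
    unfolding B_def using bounded_linear_Blinfun_apply[OF bl[OF that]] by simp
  have cB: "continuous_on ?S (\<lambda>(p, r). B p r)"
  proof (rule continuous_on_blinfun_componentwise)
    fix i :: 'a assume "i \<in> Basis"
    show "continuous_on ?S (\<lambda>x. blinfun_apply (case x of (p, r) \<Rightarrow> B p r) i)"
      by (rule continuous_on_eq[OF Ck_on_imp_continuous_on[OF D(2)[of "(i, 0)"]]]) (auto simp: B)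
  qed
  have cBr: "continuous_on {a..b} (B p)" if "p \<in> U" for p
  proof -
    have "continuous_on {a..b} (\<lambda>r. case (p, r) of (p, r) \<Rightarrow> B p r)"
      by (rule continuous_on_compose2[OF cB]) (use that in \<open>auto intro!: continuous_intros\<close>)
    then show ?thesis by simp
  qed
  have cf: "continuous_on {a..b} (\<lambda>r. f (p, r))" if "p \<in> U" for p
    by (rule continuous_on_compose2[OF Ck_on_imp_continuous_on[OF Suc.prems(1)]])
      (use that in \<open>auto intro!: continuous_intros\<close>)
  have 1: "((\<lambda>p. integral {a..b} (\<lambda>r. f (p, r))) has_derivative
      (\<lambda>v. integral {a..b} (\<lambda>r. D (p, r) (v, 0)))) (at p within U)" if p: "p \<in> U" for p
  proof -
    have "((\<lambda>p. integral (cbox a b) (\<lambda>r. f (p, r))) has_derivative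
        blinfun_apply (integral (cbox a b) (B p))) (at p within U)"
    proof (rule leibniz_rule)
      fix q r assume qr: "q \<in> U" "r \<in> cbox a b"
      have "((\<lambda>x. f (x, r)) has_derivative (\<lambda>v. D (q, r) (v, 0))) (at q within U)"
        by (rule has_derivative_in_compose2[of ?S f D "\<lambda>x. (x, r)"])
          (use D(1) qr in \<open>auto intro!: derivative_eq_intros\<close>)
      moreover have "(\<lambda>v. D (q, r) (v, 0)) = blinfun_apply (B q r)" using B qr by auto
      ultimately show "((\<lambda>x. f (x, r)) has_derivative blinfun_apply (B q r)) (at q within U)" by simp
    next
      show "(\<lambda>r. f (q, r)) integrable_on cbox a b" if "q \<in> U" for q
        using integrable_continuous_real[OF cf[OF that]] by simp
    qed (use cB p Suc.prems in auto)
    moreover have "blinfun_apply (integral (cbox a b) (B p)) = (\<lambda>v. integral {a..b} (\<lambda>r. D (p, r) (v, 0)))"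
    proof
      fix v
      have "blinfun_apply (integral (cbox a b) (B p)) v = integral {a..b} (\<lambda>r. B p r v)"
        using blinfun_apply_integral[OF integrable_continuous_real[OF cBr[OF p]]] by simp
      also have "\<dots> = integral {a..b} (\<lambda>r. D (p, r) (v, 0))"
        using B p by (intro integral_cong) auto
      finally show "blinfun_apply (integral (cbox a b) (B p)) v = integral {a..b} (\<lambda>r. D (p, r) (v, 0))" .
    qed
    ultimately show ?thesis by simp
  qed
  have 2: "Ck_on k U (\<lambda>p. integral {a..b} (\<lambda>r. D (p, r) (v, 0)))" for v
    using Suc.IH[OF D(2)[of "(v, 0)"] Suc.prems(2)] .
  show ?case using 1 2
    by (auto intro!: exI[of _ "\<lambda>p v. integral {a..b} (\<lambda>r. D (p, r) (v, 0))"])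
qed

lemma smooth_on_linear: "bounded_linear L \<Longrightarrow> smooth_on S (\<lambda>p. complex_of_real (L p))"
  by (simp add: smooth_on_def Ck_on_linear)

lemma smooth_on_const: "smooth_on S (\<lambda>p. c)"
  by (simp add: smooth_on_def Ck_on_const)

lemma smooth_on_add: "smooth_on S f \<Longrightarrow> smooth_on S g \<Longrightarrow> smooth_on S (\<lambda>p. f p + g p)"
  by (simp add: smooth_on_def Ck_on_add)

lemma smooth_on_mult: "smooth_on S f \<Longrightarrow> smooth_on S g \<Longrightarrow> smooth_on S (\<lambda>p. f p * g p)"
  by (simp add: smooth_on_def Ck_on_mult)

lemma smooth_on_diff: "smooth_on S f \<Longrightarrow> smooth_on S g \<Longrightarrow> smooth_on S (\<lambda>p. f p - g p)"
  by (simp add: smooth_on_def Ck_on_diff)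

lemma smooth_on_uminus: "smooth_on S f \<Longrightarrow> smooth_on S (\<lambda>p. - f p)"
  by (simp add: smooth_on_def Ck_on_uminus)

lemma smooth_on_cong: "(\<And>p. p \<in> S \<Longrightarrow> f p = g p) \<Longrightarrow> smooth_on S f \<Longrightarrow> smooth_on S g"
  unfolding smooth_on_def by (intro allI Ck_on_cong[of S f g]) auto

lemma smooth_on_subset: "smooth_on S f \<Longrightarrow> T \<subseteq> S \<Longrightarrow> smooth_on T f"
  unfolding smooth_on_def using Ck_on_subset[of _ S f T] by simp

lemma smooth_on_imp_continuous_on: "smooth_on S f \<Longrightarrow> continuous_on S f"
  unfolding smooth_on_def by (rule Ck_on_imp_continuous_on[of 0]) simp

lemma smooth_on_compose_real:
  fixes \<phi> :: "'a::euclidean_space \<Rightarrow> real"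
  assumes "smooth_on T f" "smooth_on S (\<lambda>p. complex_of_real (\<phi> p))" "\<And>p. p \<in> S \<Longrightarrow> \<phi> p \<in> T"
  shows "smooth_on S (\<lambda>p. f (\<phi> p))"
  using assms unfolding smooth_on_def by (auto intro!: Ck_on_compose_real[of _ S \<phi> T f])

lemma smooth_on_compose_Pair:
  fixes \<phi> \<zeta> :: "'a::euclidean_space \<Rightarrow> real" and f :: "real \<times> real \<Rightarrow> complex"
  assumes "smooth_on T f" "smooth_on S (\<lambda>p. complex_of_real (\<phi> p))"
    "smooth_on S (\<lambda>p. complex_of_real (\<zeta> p))" "\<And>p. p \<in> S \<Longrightarrow> (\<phi> p, \<zeta> p) \<in> T"
  shows "smooth_on S (\<lambda>p. f (\<phi> p, \<zeta> p))"
  using assms unfolding smooth_on_def by (auto intro!: Ck_on_compose_Pair[of _ S \<phi> \<zeta> T f])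

lemma smooth_on_integral:
  fixes f :: "'a::euclidean_space \<times> real \<Rightarrow> complex"
  assumes "smooth_on (U \<times> {a..b}) f" "convex U"
  shows "smooth_on U (\<lambda>p. integral {a..b} (\<lambda>r. f (p, r)))"
  using assms unfolding smooth_on_def by (intro allI Ck_on_integral) auto

text \<open>Termwise differentiation does not leave the class of everywhere convergent power series.\<close>

lemma smooth_on_power_series:
  fixes c :: "nat \<Rightarrow> complex"
  assumes "\<And>z. summable (\<lambda>n. c n * z ^ n)"
  shows "smooth_on S (\<lambda>x. \<Sum>n. c n * complex_of_real x ^ n)"
proof -
  have "Ck_on k S (\<lambda>x. \<Sum>n. c n * complex_of_real x ^ n)" for k
    using assms
  proof (induction k arbitrary: c)
    case 0
    have "continuous_on UNIV (\<lambda>z. \<Sum>n. c n * z ^ n)"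
      using DERIV_isCont[OF termdiffs_strong_converges_everywhere[OF 0]]
      by (simp add: continuous_at_imp_continuous_on)
    then have "continuous_on S (\<lambda>x. \<Sum>n. c n * complex_of_real x ^ n)"
      by (rule continuous_on_compose2) (auto intro!: continuous_intros)
    then show ?case by simp
  next
    case (Suc k)
    have dd: "((\<lambda>x. \<Sum>n. c n * complex_of_real x ^ n) has_vector_derivative
        (\<Sum>n. diffs c n * complex_of_real x ^ n)) (at x within S)" for x
      by (rule has_vector_derivative_real_field[OF termdiffs_strong_converges_everywhere[OF Suc.prems]])
    have "summable (\<lambda>n. diffs c n * z ^ n)" for z
      using termdiff_converges_all[OF Suc.prems] by simp
    from Suc.IH[OF this] have "Ck_on k S (\<lambda>x. \<Sum>n. diffs c n * complex_of_real x ^ n)" .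
    then have "\<forall>v. Ck_on k S (\<lambda>x. complex_of_real v * (\<Sum>n. diffs c n * complex_of_real x ^ n))"
      by (intro allI Ck_on_mult Ck_on_const)
    then show ?case using dd
      by (auto simp: has_vector_derivative_def scaleR_conv_of_real
          intro!: exI[of _ "\<lambda>x v. complex_of_real v * (\<Sum>n. diffs c n * complex_of_real x ^ n)"])
  qed
  then show ?thesis by (simp add: smooth_on_def)
qed

section \<open>Iterated partial derivatives and boundary values\<close>

lemma smooth_on_open_has_derivative:
  assumes "open U" "smooth_on U F" "p \<in> U"
  shows "(F has_derivative frechet_derivative F (at p)) (at p)"
proof -
  have "Ck_on (Suc 0) U F" using assms smooth_on_def by blast
  then obtain D where "\<forall>p\<in>U. (F has_derivative D p) (at p within U)" by auto
  then have "(F has_derivative D p) (at p)" using assms at_within_open by metis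
  then show ?thesis using frechet_derivative_at by metis
qed

text \<open>The derivative that witnesses \<open>Ck_on (Suc k)\<close> may depend on \<open>k\<close>. On an open set all these witnesses
  are the Frechet derivative, so that one function serves for all orders.\<close>

lemma smooth_on_open_directional_derivative:
  assumes "open U" "smooth_on U F"
  shows "smooth_on U (\<lambda>p. frechet_derivative F (at p) v)"
  unfolding smooth_on_def
proof
  fix k
  have "Ck_on (Suc k) U F" using assms smooth_on_def by blast
  then obtain D where D: "\<forall>p\<in>U. (F has_derivative D p) (at p within U)" "\<forall>v. Ck_on k U (\<lambda>p. D p v)"
    by auto
  have "D p = frechet_derivative F (at p)" if "p \<in> U" for p
    using D(1) that assms(1) at_within_open frechet_derivative_at by metis
  then show "Ck_on k U (\<lambda>p. frechet_derivative F (at p) v)"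
    using Ck_on_cong[OF _ D(2)[rule_format, of v]] by simp
qed

lemma smooth_on_open_slices:
  assumes U: "open U" "smooth_on U (\<lambda>p. f (fst p) (snd p))"
  shows "(x, t) \<in> U \<Longrightarrow> ((\<lambda>y. f y t) has_vector_derivative partial_x f x t) (at x)"
    and "(x, t) \<in> U \<Longrightarrow> ((\<lambda>s. f x s) has_vector_derivative partial_t f x t) (at t)"
    and "smooth_on U (\<lambda>p. partial_x f (fst p) (snd p))"
    and "smooth_on U (\<lambda>p. partial_t f (fst p) (snd p))"
proof -
  let ?F = "\<lambda>p. f (fst p) (snd p)"
  define D where "D p = frechet_derivative ?F (at p)" for p
  have D: "(?F has_derivative D p) (at p)" if "p \<in> U" for p
    using smooth_on_open_has_derivative[OF U that] D_def by simp
  have lin: "linear (D p)" if "p \<in> U" for p using D[OF that] has_derivative_linear by blast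
  have x: "((\<lambda>y. f y t) has_vector_derivative D (x, t) (1, 0)) (at x)" if "(x, t) \<in> U" for x t
  proof -
    have "((\<lambda>y. (y, t)) has_derivative (\<lambda>h. (h, 0))) (at x)" by (auto intro!: derivative_eq_intros)
    from has_derivative_compose[OF this, of ?F "D (x, t)"] D[OF that]
    have "((\<lambda>y. f y t) has_derivative (\<lambda>h. D (x, t) (h, 0))) (at x)" by simp
    moreover have "(\<lambda>h. D (x, t) (h, 0)) = (\<lambda>h. h *\<^sub>R D (x, t) (1, 0))"
    proof
      fix h
      show "D (x, t) (h, 0) = h *\<^sub>R D (x, t) (1, 0)"
        using linear_scale[OF lin[OF that], of h "(1, 0)"] by (simp only: scaleR_Pair real_scaleR_def mult_1_right mult_zero_right)
    qed
    ultimately show ?thesis unfolding has_vector_derivative_def by (rule has_derivative_eq_rhs)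
  qed
  have t: "((\<lambda>s. f x s) has_vector_derivative D (x, t) (0, 1)) (at t)" if "(x, t) \<in> U" for x t
  proof -
    have "((\<lambda>s. (x, s)) has_derivative (\<lambda>h. (0, h))) (at t)" by (auto intro!: derivative_eq_intros)
    from has_derivative_compose[OF this, of ?F "D (x, t)"] D[OF that]
    have "((\<lambda>s. f x s) has_derivative (\<lambda>h. D (x, t) (0, h))) (at t)" by simp
    moreover have "(\<lambda>h. D (x, t) (0, h)) = (\<lambda>h. h *\<^sub>R D (x, t) (0, 1))"
    proof
      fix h
      show "D (x, t) (0, h) = h *\<^sub>R D (x, t) (0, 1)"
        using linear_scale[OF lin[OF that], of h "(0, 1)"] by (simp only: scaleR_Pair real_scaleR_def mult_1_right mult_zero_right)
    qed
    ultimately show ?thesis unfolding has_vector_derivative_def by (rule has_derivative_eq_rhs)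
  qed
  have x': "partial_x f x t = D (x, t) (1, 0)" if "(x, t) \<in> U" for x t
    unfolding partial_x_def using vector_derivative_at[OF x[OF that]] .
  have t': "partial_t f x t = D (x, t) (0, 1)" if "(x, t) \<in> U" for x t
    unfolding partial_t_def using vector_derivative_at[OF t[OF that]] .
  show "((\<lambda>y. f y t) has_vector_derivative partial_x f x t) (at x)" if "(x, t) \<in> U"
    unfolding x'[OF that] using x[OF that] .
  show "((\<lambda>s. f x s) has_vector_derivative partial_t f x t) (at t)" if "(x, t) \<in> U"
    unfolding t'[OF that] using t[OF that] .
  show "smooth_on U (\<lambda>p. partial_x f (fst p) (snd p))"
    by (rule smooth_on_cong[OF _ smooth_on_open_directional_derivative[OF U, of "(1, 0)"]])
      (simp add: x'[unfolded D_def])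
  show "smooth_on U (\<lambda>p. partial_t f (fst p) (snd p))"
    by (rule smooth_on_cong[OF _ smooth_on_open_directional_derivative[OF U, of "(0, 1)"]])
      (simp add: t'[unfolded D_def])
qed

lemma mixed_partial_0_0 [simp]: "mixed_partial 0 0 f = f"
  by (simp add: mixed_partial_def)

lemma mixed_partial_Suc_left: "mixed_partial (Suc n) l f = partial_x (mixed_partial n l f)"
  by (simp add: mixed_partial_def)

lemma mixed_partial_Suc_right: "mixed_partial 0 (Suc l) f = partial_t (mixed_partial 0 l f)"
  by (simp add: mixed_partial_def)

lemma smooth_on_mixed_partial:
  assumes "open U" "smooth_on U (\<lambda>p. f (fst p) (snd p))"
  shows "smooth_on U (\<lambda>p. mixed_partial n l f (fst p) (snd p))"
proof (induction n)
  case 0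
  show ?case
    by (induction l) (use assms smooth_on_open_slices(4)[OF assms(1)] in
        \<open>simp_all add: mixed_partial_Suc_right\<close>)
next
  case (Suc n)
  then show ?case using smooth_on_open_slices(3)[OF assms(1)] by (simp add: mixed_partial_Suc_left)
qed

lemma smooth_on_imp_mixed_partial_exists:
  assumes "open U" "smooth_on U (\<lambda>p. f (fst p) (snd p))" "(x, t) \<in> U"
  shows "mixed_partial_exists n l f x t"
proof -
  note s = smooth_on_mixed_partial[OF assms(1,2)]
  show ?thesis
    unfolding mixed_partial_exists_def
    using smooth_on_open_slices(1)[OF assms(1) s] smooth_on_open_slices(2)[OF assms(1) s] assms
    by (intro exI[of _ U]) (auto intro!: differentiableI_vector)
qed

lemma mixed_partial_cong_open:
  assumes "open R" "\<And>x t. (x, t) \<in> R \<Longrightarrow> f x t = g x t" "(x, t) \<in> R"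
  shows "mixed_partial n l f x t = mixed_partial n l g x t"
proof -
  have x: "partial_x f x t = partial_x g x t"
    if fg: "\<And>x t. (x, t) \<in> R \<Longrightarrow> f x t = g x t" and "(x, t) \<in> R" for f g x t
  proof -
    have "open ((\<lambda>y. (y, t)) -` R)"
      by (rule open_vimage[OF assms(1)]) (intro continuous_intros)
    then have "eventually (\<lambda>y. y \<in> (\<lambda>y. (y, t)) -` R) (nhds x)"
      using that eventually_nhds by blast
    then have "eventually (\<lambda>y. f y t = g y t) (nhds x)" by eventually_elim (simp add: fg)
    then show ?thesis unfolding partial_x_def by (intro vector_derivative_cong_eq) auto
  qed
  have t: "partial_t f x t = partial_t g x t"
    if fg: "\<And>x t. (x, t) \<in> R \<Longrightarrow> f x t = g x t" and "(x, t) \<in> R" for f g x t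
  proof -
    have "open ((\<lambda>s. (x, s)) -` R)"
      by (rule open_vimage[OF assms(1)]) (intro continuous_intros)
    then have "eventually (\<lambda>s. s \<in> (\<lambda>s. (x, s)) -` R) (nhds t)"
      using that eventually_nhds by blast
    then have "eventually (\<lambda>s. f x s = g x s) (nhds t)" by eventually_elim (simp add: fg)
    then show ?thesis unfolding partial_t_def by (intro vector_derivative_cong_eq) auto
  qed
  have base: "mixed_partial 0 l f x t = mixed_partial 0 l g x t" if "(x, t) \<in> R" for x t
    using that
  proof (induction l arbitrary: x t)
    case 0
    then show ?case by (simp add: assms(2))
  next
    case (Suc l)
    show ?case unfolding mixed_partial_Suc_right by (rule t) (fact Suc.IH, fact Suc.prems)
  qed
  show ?thesis
    using assms(3)
  proof (induction n arbitrary: x t)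
    case 0
    then show ?case by (rule base)
  next
    case (Suc n)
    show ?case unfolding mixed_partial_Suc_left by (rule x) (fact Suc.IH, fact Suc.prems)
  qed
qed

lemma uniform_limit_at_right_of_continuous:
  fixes G :: "real \<Rightarrow> real \<Rightarrow> complex"
  assumes "continuous_on (K \<times> {0..d}) (\<lambda>p. G (fst p) (snd p))" "compact K" "d > 0"
  shows "uniform_limit K (\<lambda>t x. G x t) (\<lambda>x. G x 0) (at_right 0)"
proof (rule uniform_limitI)
  fix e :: real assume "e > 0"
  have "uniformly_continuous_on (K \<times> {0..d}) (\<lambda>p. G (fst p) (snd p))"
    using assms by (intro compact_uniformly_continuous compact_Times) auto
  then obtain \<delta> where \<delta>: "\<delta> > 0" "\<And>p q. p \<in> K \<times> {0..d} \<Longrightarrow> q \<in> K \<times> {0..d} \<Longrightarrow> dist q p < \<delta> \<Longrightarrow>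
      dist (G (fst q) (snd q)) (G (fst p) (snd p)) < e"
    using \<open>e > 0\<close> unfolding uniformly_continuous_on_def by metis
  have "eventually (\<lambda>t. t \<in> {0<..<min d \<delta>}) (at_right 0)"
    using assms \<delta>(1) by (intro eventually_at_right_real) auto
  then show "\<forall>\<^sub>F t in at_right 0. \<forall>x\<in>K. dist (G x t) (G x 0) < e"
  proof eventually_elim
    case (elim t)
    show ?case
    proof
      fix x assume "x \<in> K"
      then show "dist (G x t) (G x 0) < e"
        using \<delta>(2)[of "(x, 0)" "(x, t)"] elim assms by (simp add: dist_Pair_Pair)
    qed
  qed
qed

text \<open>At a positive point the derivative relative to \<open>{0..}\<close> is the ordinary one. Hence iterated derivatives of
  a trace on the boundary are one-sided iterated derivatives of the datum that it equals.\<close>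

lemma half_line_deriv_eqI:
  assumes "\<And>n x. x > 0 \<Longrightarrow> u (Suc n) x = vector_derivative (u n) (at x)"
    and "\<And>x. x > 0 \<Longrightarrow> u 0 x = g x" and "x > 0"
  shows "u n x = half_line_deriv n g x"
  using assms(3)
proof (induction n arbitrary: x)
  case 0
  then show ?case using assms(2) by (simp add: half_line_deriv_def)
next
  case (Suc n)
  have "eventually (\<lambda>y. y \<in> {0<..}) (nhds x)" using Suc.prems by (intro eventually_nhds_in_open) auto
  then have "eventually (\<lambda>y. u n y = half_line_deriv n g y) (nhds x)"
    by eventually_elim (simp add: Suc.IH)
  then have "u (Suc n) x = vector_derivative (half_line_deriv n g) (at x)"
    using assms(1) Suc.prems by (simp add: vector_derivative_cong_eq)
  moreover have "at x within {0..} = at x"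
    using Suc.prems by (intro at_within_interior) auto
  ultimately show ?case by (simp add: half_line_deriv_def)
qed

lemma open_abs_snd_less: "open {p::real \<times> real. \<bar>snd p\<bar> < fst p}"
  and open_abs_fst_less: "open {p::real \<times> real. \<bar>fst p\<bar> < snd p}"
  by (auto intro!: open_Collect_less continuous_intros)

lemma open_below_diagonal: "open {p::real \<times> real. 0 < snd p \<and> snd p < fst p}"
  and open_above_diagonal: "open {p::real \<times> real. 0 < fst p \<and> fst p < snd p}"
  by (auto intro!: open_Collect_conj open_Collect_less continuous_intros)

text \<open>A function that agrees, in the sector next to a half-line, with one that is smooth in an open
  neighbourhood of that half-line has all the boundary behaviour that is asked for.\<close>

lemma boundary_values_t0:
  assumes F: "smooth_on {p. \<bar>snd p\<bar> < fst p} (\<lambda>p. F (fst p) (snd p))"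
    and \<psi>: "\<And>x t. 0 < t \<Longrightarrow> t < x \<Longrightarrow> \<psi> x t = F x t"
  shows "partial_limit_at_t0 n l \<psi>"
    and "extends_smoothly_near {(x, 0) | x. x > 0} \<psi>"
    and "(\<And>x. x > 0 \<Longrightarrow> F x 0 = g x) \<Longrightarrow> x > 0 \<Longrightarrow>
      ((\<lambda>t. mixed_partial n 0 \<psi> x t) \<longlongrightarrow> half_line_deriv n g x) (at_right 0)"
proof -
  let ?U = "{p::real \<times> real. \<bar>snd p\<bar> < fst p}" and ?R = "{p::real \<times> real. 0 < snd p \<and> snd p < fst p}"
  note sm = smooth_on_mixed_partial[OF open_abs_snd_less F]
  have \<psi>s: "smooth_on ?R (\<lambda>p. \<psi> (fst p) (snd p))"
    by (rule smooth_on_cong[OF _ smooth_on_subset[OF F]]) (auto simp: \<psi>)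
  have eq: "mixed_partial n l \<psi> x t = mixed_partial n l F x t" if "0 < t" "t < x" for n l x t
    by (rule mixed_partial_cong_open[OF open_below_diagonal]) (use that \<psi> in auto)
  have lim: "(\<forall>\<^sub>F t in at_right 0. \<forall>x\<in>K. mixed_partial_exists n l \<psi> x t) \<and>
       uniform_limit K (\<lambda>t x. mixed_partial n l \<psi> x t) (\<lambda>x. mixed_partial n l F x 0) (at_right 0)"
    if K: "compact K" "K \<subseteq> {0<..}" for K n l
  proof -
    obtain d where d: "d > 0" "\<And>x. x \<in> K \<Longrightarrow> d < x"
    proof (cases "K = {}")
      case False
      then obtain y where "y \<in> K" "\<forall>x\<in>K. y \<le> x" using compact_attains_inf[OF K(1)] by blast
      then show ?thesis using K(2) that[of "y / 2"] by force
    qed (use that[of 1] in auto)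
    have ev: "eventually (\<lambda>t. t \<in> {0<..<d}) (at_right 0)"
      using d by (intro eventually_at_right_real) auto
    have "\<forall>\<^sub>F t in at_right 0. \<forall>x\<in>K. mixed_partial_exists n l \<psi> x t"
      using ev
    proof eventually_elim
      case (elim t)
      show ?case
        using elim d by (intro ballI smooth_on_imp_mixed_partial_exists[OF open_below_diagonal \<psi>s]) force
    qed
    moreover have "uniform_limit K (\<lambda>t x. mixed_partial n l F x t) (\<lambda>x. mixed_partial n l F x 0) (at_right 0)"
    proof (rule uniform_limit_at_right_of_continuous[OF _ K(1) d(1)])
      show "continuous_on (K \<times> {0..d}) (\<lambda>p. mixed_partial n l F (fst p) (snd p))"
        by (rule continuous_on_subset[OF smooth_on_imp_continuous_on[OF sm]]) (use d(2) in force)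
    qed
    moreover have "\<forall>\<^sub>F t in at_right 0. \<forall>x\<in>K. mixed_partial n l \<psi> x t = mixed_partial n l F x t"
      using ev by eventually_elim (use d eq in force)
    ultimately show ?thesis
      by (subst uniform_limit_cong[where g = "\<lambda>t x. mixed_partial n l F x t"]) auto
  qed
  have "smooth_on {0<..} (\<lambda>x. mixed_partial n l F x 0)"
  proof -
    have "smooth_on {0<..} (\<lambda>x::real. mixed_partial n l F (fst (x, 0::real)) (snd (x, 0::real)))"
      using smooth_on_linear[of "\<lambda>x. x"] smooth_on_const[of _ "complex_of_real 0"]
      by (intro smooth_on_compose_Pair[OF sm]) auto
    then show ?thesis by simp
  qed
  then show "partial_limit_at_t0 n l \<psi>" unfolding partial_limit_at_t0_def using lim by blast
  show "extends_smoothly_near {(x, 0) | x. x > 0} \<psi>"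
    unfolding extends_smoothly_near_def
    by (intro exI[of _ ?U] exI[of _ "\<lambda>p. F (fst p) (snd p)"])
      (use F open_abs_snd_less \<psi> in \<open>auto simp: psi_domain_def\<close>)
  show "((\<lambda>t. mixed_partial n 0 \<psi> x t) \<longlongrightarrow> half_line_deriv n g x) (at_right 0)"
    if g: "\<And>x. x > 0 \<Longrightarrow> F x 0 = g x" and "x > 0"
  proof -
    have "((\<lambda>t. mixed_partial n 0 \<psi> x t) \<longlongrightarrow> mixed_partial n 0 F x 0) (at_right 0)"
      by (rule tendsto_uniform_limitI[OF conjunct2[OF lim[of "{x}" n 0]], of x]) (use \<open>x > 0\<close> in auto)
    moreover have "mixed_partial n 0 F x 0 = half_line_deriv n g x"
      by (rule half_line_deriv_eqI[of "\<lambda>n x. mixed_partial n 0 F x 0"])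
        (use g \<open>x > 0\<close> in \<open>auto simp: mixed_partial_Suc_left partial_x_def\<close>)
    ultimately show ?thesis by simp
  qed
qed

lemma boundary_values_x0:
  assumes F: "smooth_on {p. \<bar>fst p\<bar> < snd p} (\<lambda>p. F (fst p) (snd p))"
    and \<psi>: "\<And>x t. 0 < x \<Longrightarrow> x < t \<Longrightarrow> \<psi> x t = F x t"
  shows "partial_limit_at_x0 n l \<psi>"
    and "extends_smoothly_near {(0, t) | t. t > 0} \<psi>"
    and "(\<And>t. t > 0 \<Longrightarrow> F 0 t = h t) \<Longrightarrow> t > 0 \<Longrightarrow>
      ((\<lambda>x. mixed_partial 0 l \<psi> x t) \<longlongrightarrow> half_line_deriv l h t) (at_right 0)"
proof -
  let ?U = "{p::real \<times> real. \<bar>fst p\<bar> < snd p}" and ?R = "{p::real \<times> real. 0 < fst p \<and> fst p < snd p}"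
  note sm = smooth_on_mixed_partial[OF open_abs_fst_less F]
  have \<psi>s: "smooth_on ?R (\<lambda>p. \<psi> (fst p) (snd p))"
    by (rule smooth_on_cong[OF _ smooth_on_subset[OF F]]) (auto simp: \<psi>)
  have eq: "mixed_partial n l \<psi> x t = mixed_partial n l F x t" if "0 < x" "x < t" for n l x t
    by (rule mixed_partial_cong_open[OF open_above_diagonal]) (use that \<psi> in auto)
  have lim: "(\<forall>\<^sub>F x in at_right 0. \<forall>t\<in>K. mixed_partial_exists n l \<psi> x t) \<and>
       uniform_limit K (\<lambda>x t. mixed_partial n l \<psi> x t) (\<lambda>t. mixed_partial n l F 0 t) (at_right 0)"
    if K: "compact K" "K \<subseteq> {0<..}" for K n l
  proof -
    obtain d where d: "d > 0" "\<And>x. x \<in> K \<Longrightarrow> d < x"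
    proof (cases "K = {}")
      case False
      then obtain y where "y \<in> K" "\<forall>x\<in>K. y \<le> x" using compact_attains_inf[OF K(1)] by blast
      then show ?thesis using K(2) that[of "y / 2"] by force
    qed (use that[of 1] in auto)
    have ev: "eventually (\<lambda>t. t \<in> {0<..<d}) (at_right 0)"
      using d by (intro eventually_at_right_real) auto
    have "\<forall>\<^sub>F x in at_right 0. \<forall>t\<in>K. mixed_partial_exists n l \<psi> x t"
      using ev
    proof eventually_elim
      case (elim t)
      show ?case
        using elim d by (intro ballI smooth_on_imp_mixed_partial_exists[OF open_above_diagonal \<psi>s]) force
    qed
    moreover have "uniform_limit K (\<lambda>x t. mixed_partial n l F x t) (\<lambda>t. mixed_partial n l F 0 t) (at_right 0)"
    proof (rule uniform_limit_at_right_of_continuous[OF _ K(1) d(1)])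
      have "continuous_on (K \<times> {0..d}) (\<lambda>p. mixed_partial n l F (fst (snd p, fst p)) (snd (snd p, fst p)))"
        by (rule continuous_on_compose2[OF smooth_on_imp_continuous_on[OF sm]])
          (use d(2) in \<open>force intro!: continuous_intros\<close>)+
      then show "continuous_on (K \<times> {0..d}) (\<lambda>p. mixed_partial n l F (snd p) (fst p))" by simp
    qed
    moreover have "\<forall>\<^sub>F x in at_right 0. \<forall>t\<in>K. mixed_partial n l \<psi> x t = mixed_partial n l F x t"
      using ev by eventually_elim (use d eq in force)
    ultimately show ?thesis
      by (subst uniform_limit_cong[where g = "\<lambda>x t. mixed_partial n l F x t"]) auto
  qed
  have "smooth_on {0<..} (\<lambda>t. mixed_partial n l F 0 t)"
  proof -
    have "smooth_on {0<..} (\<lambda>t::real. mixed_partial n l F (fst (0::real, t)) (snd (0::real, t)))"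
      using smooth_on_linear[of "\<lambda>x. x"] smooth_on_const[of _ "complex_of_real 0"]
      by (intro smooth_on_compose_Pair[OF sm]) auto
    then show ?thesis by simp
  qed
  then show "partial_limit_at_x0 n l \<psi>" unfolding partial_limit_at_x0_def using lim by blast
  show "extends_smoothly_near {(0, t) | t. t > 0} \<psi>"
    unfolding extends_smoothly_near_def
    by (intro exI[of _ ?U] exI[of _ "\<lambda>p. F (fst p) (snd p)"])
      (use F open_abs_fst_less \<psi> in \<open>auto simp: psi_domain_def\<close>)
  show "((\<lambda>x. mixed_partial 0 l \<psi> x t) \<longlongrightarrow> half_line_deriv l h t) (at_right 0)"
    if h: "\<And>t. t > 0 \<Longrightarrow> F 0 t = h t" and "t > 0"
  proof -
    have "((\<lambda>x. mixed_partial 0 l \<psi> x t) \<longlongrightarrow> mixed_partial 0 l F 0 t) (at_right 0)"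
      by (rule tendsto_uniform_limitI[OF conjunct2[OF lim[of "{t}" 0 l]], of t]) (use \<open>t > 0\<close> in auto)
    moreover have "mixed_partial 0 l F 0 t = half_line_deriv l h t"
      by (rule half_line_deriv_eqI[of "\<lambda>l t. mixed_partial 0 l F 0 t"])
        (use h \<open>t > 0\<close> in \<open>auto simp: mixed_partial_Suc_right partial_t_def\<close>)
    ultimately show ?thesis by simp
  qed
qed

section \<open>The Klein--Gordon multipliers\<close>

text \<open>The profile of the Klein--Gordon kernel: \<open>bessel_profile w = J\<^sub>0(\<surd>w)\<close>, an entire function
  of \<open>w\<close>.\<close>

definition bessel_coeff :: "nat \<Rightarrow> complex" where
  "bessel_coeff n = (- 1 / 4) ^ n / (fact n)\<^sup>2"

definition bessel_profile :: "real \<Rightarrow> complex" where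
  "bessel_profile w = (\<Sum>n. bessel_coeff n * complex_of_real w ^ n)"

definition bessel_profile' :: "real \<Rightarrow> complex" where
  "bessel_profile' w = (\<Sum>n. diffs bessel_coeff n * complex_of_real w ^ n)"

definition bessel_profile'' :: "real \<Rightarrow> complex" where
  "bessel_profile'' w = (\<Sum>n. diffs (diffs bessel_coeff) n * complex_of_real w ^ n)"

lemma summable_bessel_coeff: "summable (\<lambda>n. bessel_coeff n * z ^ n)"
proof (rule summable_comparison_test')
  show "summable (\<lambda>n. inverse (fact n) * norm z ^ n)"
    using summable_exp[of "norm z"] by simp
  fix n :: nat
  have "norm (bessel_coeff n) = (1 / 4) ^ n / (fact n)\<^sup>2"
    by (simp add: bessel_coeff_def norm_divide norm_power norm_mult)
  also have "\<dots> \<le> 1 / fact n"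
  proof -
    have "(1 / 4 :: real) ^ n \<le> 1" by (simp add: power_le_one)
    moreover have "(fact n :: real) \<le> (fact n)\<^sup>2" by (simp add: power2_eq_square)
    ultimately show ?thesis by (intro frac_le) auto
  qed
  finally show "norm (bessel_coeff n * z ^ n) \<le> inverse (fact n) * norm z ^ n"
    using mult_right_mono[of "norm (bessel_coeff n)" "1 / fact n" "norm z ^ n"]
    by (simp add: norm_mult norm_power inverse_eq_divide)
qed

lemma summable_bessel_coeff': "summable (\<lambda>n. diffs bessel_coeff n * z ^ n)"
  by (rule termdiff_converges_all[OF summable_bessel_coeff])

lemma summable_bessel_coeff'': "summable (\<lambda>n. diffs (diffs bessel_coeff) n * z ^ n)"
  by (rule termdiff_converges_all[OF summable_bessel_coeff'])

lemma has_vector_derivative_bessel_profile: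
  "(bessel_profile has_vector_derivative bessel_profile' w) (at w within S)"
  unfolding bessel_profile_def[abs_def] bessel_profile'_def
  by (rule has_vector_derivative_real_field[OF termdiffs_strong_converges_everywhere[OF summable_bessel_coeff]])

lemma has_vector_derivative_bessel_profile':
  "(bessel_profile' has_vector_derivative bessel_profile'' w) (at w within S)"
  unfolding bessel_profile'_def[abs_def] bessel_profile''_def
  by (rule has_vector_derivative_real_field[OF termdiffs_strong_converges_everywhere[OF summable_bessel_coeff']])

lemma smooth_on_bessel_profile: "smooth_on S bessel_profile"
  unfolding bessel_profile_def[abs_def] by (rule smooth_on_power_series[OF summable_bessel_coeff])

lemma smooth_on_bessel_profile': "smooth_on S bessel_profile'"
  unfolding bessel_profile'_def[abs_def] by (rule smooth_on_power_series[OF summable_bessel_coeff'])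

lemma smooth_on_bessel_profile'': "smooth_on S bessel_profile''"
  unfolding bessel_profile''_def[abs_def] by (rule smooth_on_power_series[OF summable_bessel_coeff''])

lemma bessel_profile_0: "bessel_profile 0 = 1"
  using powser_zero[of bessel_coeff] by (simp add: bessel_profile_def bessel_coeff_def)

text \<open>Bessel's equation in the variable \<open>w\<close>; for the coefficients it says \<open>(n + 1)\<^sup>2 c\<^sub>n\<^sub>+\<^sub>1 = - c\<^sub>n / 4\<close>.\<close>

lemma bessel_profile_ode:
  "complex_of_real w * bessel_profile'' w + bessel_profile' w + bessel_profile w / 4 = 0"
proof -
  let ?z = "complex_of_real w" and ?c = bessel_coeff
  have "(\<lambda>n. ?z * (diffs (diffs ?c) n * ?z ^ n)) sums (?z * bessel_profile'' w)"
    unfolding bessel_profile''_def by (intro sums_mult summable_sums summable_bessel_coeff'')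
  then have "(\<lambda>n. (\<lambda>n. of_nat n * diffs ?c n * ?z ^ n) (Suc n)) sums (?z * bessel_profile'' w)"
    by (simp add: diffs_def mult_ac)
  then have 1: "(\<lambda>n. of_nat n * diffs ?c n * ?z ^ n) sums (?z * bessel_profile'' w)"
    by (subst (asm) sums_Suc_iff) simp
  have 2: "(\<lambda>n. diffs ?c n * ?z ^ n) sums bessel_profile' w"
    unfolding bessel_profile'_def by (intro summable_sums summable_bessel_coeff')
  have 3: "(\<lambda>n. (?c n * ?z ^ n) / 4) sums (bessel_profile w / 4)"
    unfolding bessel_profile_def by (intro sums_divide summable_sums summable_bessel_coeff)
  have "of_nat n * diffs ?c n + diffs ?c n + ?c n / 4 = 0" for n
  proof -
    have "of_nat n * diffs ?c n + diffs ?c n = (of_nat (Suc n))\<^sup>2 * ?c (Suc n)"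
      by (simp add: diffs_def power2_eq_square algebra_simps)
    also have "\<dots> = - ?c n / 4"
      unfolding bessel_coeff_def power_Suc fact_Suc by (simp add: power_mult_distrib field_simps del: of_nat_Suc)
    finally show ?thesis by simp
  qed
  then have "of_nat n * diffs ?c n * ?z ^ n + diffs ?c n * ?z ^ n + (?c n * ?z ^ n) / 4 = 0" for n
    by (metis (no_types, lifting) distrib_right mult_zero_left times_divide_eq_left)
  then have "(\<lambda>n. 0) sums (?z * bessel_profile'' w + bessel_profile' w + bessel_profile w / 4)"
    using sums_add[OF sums_add[OF 1 2] 3] by simp
  then show ?thesis using sums_unique2 sums_zero by blast
qed

lemma continuous_on_bessel_profile [continuous_intros]:
  "continuous_on S g \<Longrightarrow> continuous_on S (\<lambda>x. bessel_profile (g x))"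
  using continuous_on_compose2[OF smooth_on_imp_continuous_on[OF smooth_on_bessel_profile[of UNIV]]] by auto

lemma continuous_on_bessel_profile' [continuous_intros]:
  "continuous_on S g \<Longrightarrow> continuous_on S (\<lambda>x. bessel_profile' (g x))"
  using continuous_on_compose2[OF smooth_on_imp_continuous_on[OF smooth_on_bessel_profile'[of UNIV]]] by auto

lemma continuous_on_bessel_profile'' [continuous_intros]:
  "continuous_on S g \<Longrightarrow> continuous_on S (\<lambda>x. bessel_profile'' (g x))"
  using continuous_on_compose2[OF smooth_on_imp_continuous_on[OF smooth_on_bessel_profile''[of UNIV]]] by auto

text \<open>The Fourier transform of the masses \<open>\<alpha>\<close> at \<open>- s\<close> and \<open>\<beta>\<close> at \<open>s\<close> together with the density \<open>u \<mapsto> \<kappa> u s\<close> on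
  \<open>[- s, s]\<close>. The integral is scaled to the fixed interval \<open>[- 1, 1]\<close>, so that it can be differentiated in \<open>s\<close> without
  boundary terms.\<close>

definition symbol ::
    "complex \<Rightarrow> complex \<Rightarrow> (real \<Rightarrow> real \<Rightarrow> complex) \<Rightarrow> real \<Rightarrow> real \<Rightarrow> complex" where
  "symbol \<alpha> \<beta> \<kappa> k s = \<alpha> * exp (\<i> * of_real (k * s)) + \<beta> * exp (- (\<i> * of_real (k * s))) +
     of_real s * integral {-1..1} (\<lambda>r. \<kappa> (s * r) s * exp (- (\<i> * of_real (k * (s * r)))))"

text \<open>The densities of \<open>sin (\<rho> s) / \<rho>\<close>, \<open>cos (\<rho> s)\<close> and \<open>\<i> k sin (\<rho> s) / \<rho>\<close>: the Klein--Gordon kernel, its derivative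
  with respect to \<open>s\<close> and its derivative with respect to \<open>u\<close>.\<close>

definition kernel_sin :: "real \<Rightarrow> real \<Rightarrow> real \<Rightarrow> complex" where
  "kernel_sin m u s = bessel_profile (m\<^sup>2 * (s\<^sup>2 - u\<^sup>2)) / 2"

definition kernel_cos :: "real \<Rightarrow> real \<Rightarrow> real \<Rightarrow> complex" where
  "kernel_cos m u s = of_real (m\<^sup>2 * s) * bessel_profile' (m\<^sup>2 * (s\<^sup>2 - u\<^sup>2))"

definition kernel_dsin :: "real \<Rightarrow> real \<Rightarrow> real \<Rightarrow> complex" where
  "kernel_dsin m u s = - of_real (m\<^sup>2 * u) * bessel_profile' (m\<^sup>2 * (s\<^sup>2 - u\<^sup>2))"


lemma has_vector_derivative_exp_scaled:
  "((\<lambda>s. exp (c * complex_of_real s)) has_vector_derivative c * exp (c * complex_of_real s)) (at s within S)"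
proof -
  have "((\<lambda>z. exp (c * z)) has_field_derivative c * exp (c * complex_of_real s)) (at (complex_of_real s))"
    by (auto intro!: derivative_eq_intros)
  from has_vector_derivative_real_field[OF this] show ?thesis .
qed

context
  fixes m k :: real
begin

private definition "wave s r = exp (- (\<i> * complex_of_real (k * (s * r))))" for s r
private definition "X s r = m\<^sup>2 * (s\<^sup>2 - (s * r)\<^sup>2)" for s r

private lemma wave_s: "((\<lambda>s. wave s r) has_vector_derivative (- \<i> * complex_of_real k * complex_of_real r) * wave s r) (at s within S)"
proof -
  have "wave s r = exp ((- \<i> * complex_of_real k * complex_of_real r) * complex_of_real s)" for s
    unfolding wave_def by (simp add: mult_ac)
  then show ?thesis using has_vector_derivative_exp_scaled by presburger
qed

private lemma wave_r: "((\<lambda>r. wave s r) has_vector_derivative (- \<i> * complex_of_real k * complex_of_real s) * wave s r) (at r within S)"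
proof -
  have "wave s r = exp ((- \<i> * complex_of_real k * complex_of_real s) * complex_of_real r)" for r
    unfolding wave_def by (simp add: mult_ac)
  then show ?thesis using has_vector_derivative_exp_scaled by presburger
qed

private lemma X_s: "((\<lambda>s. g (X s r)) has_vector_derivative complex_of_real (2 * m\<^sup>2 * s * (1 - r\<^sup>2)) * g' (X s r)) (at s)"
  if "\<And>w. (g has_vector_derivative g' w) (at w)" for g g'
proof -
  have "((\<lambda>s. X s r) has_vector_derivative 2 * m\<^sup>2 * s * (1 - r\<^sup>2)) (at s)"
    unfolding X_def has_real_derivative_iff_has_vector_derivative[symmetric]
    by (auto intro!: derivative_eq_intros simp: power2_eq_square algebra_simps)
  from vector_diff_chain_at[OF this that] show ?thesis by (simp add: o_def scaleR_conv_of_real)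
qed

private lemma X_r: "((\<lambda>r. g (X s r)) has_vector_derivative complex_of_real (- 2 * m\<^sup>2 * s\<^sup>2 * r) * g' (X s r)) (at r)"
  if "\<And>w. (g has_vector_derivative g' w) (at w)" for g g'
proof -
  have "((\<lambda>r. X s r) has_vector_derivative - 2 * m\<^sup>2 * s\<^sup>2 * r) (at r)"
    unfolding X_def has_real_derivative_iff_has_vector_derivative[symmetric]
    by (auto intro!: derivative_eq_intros simp: power2_eq_square algebra_simps)
  from vector_diff_chain_at[OF this that] show ?thesis by (simp add: o_def scaleR_conv_of_real)
qed

private lemma continuous_on_wave [continuous_intros]:
  "continuous_on S f \<Longrightarrow> continuous_on S h \<Longrightarrow> continuous_on S (\<lambda>x. wave (f x) (h x))"
  unfolding wave_def by (intro continuous_intros)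

private lemma continuous_on_X [continuous_intros]:
  "continuous_on S f \<Longrightarrow> continuous_on S h \<Longrightarrow> continuous_on S (\<lambda>x. X (f x) (h x))"
  unfolding X_def by (intro continuous_intros)

private lemma integral_s:
  assumes g: "\<And>w. (g has_vector_derivative g' w) (at w)"
    and c: "continuous_on UNIV g" "continuous_on UNIV g'"
  shows "((\<lambda>s. integral {-1..1} (\<lambda>r. g (X s r) * wave s r)) has_vector_derivative
    integral {-1..1} (\<lambda>r. (complex_of_real (2 * m\<^sup>2 * s * (1 - r\<^sup>2)) * g' (X s r)
      - \<i> * complex_of_real k * complex_of_real r * g (X s r)) * wave s r)) (at s)"
proof -
  have c': "continuous_on S (\<lambda>x. g (f x))" "continuous_on S (\<lambda>x. g' (f x))" if "continuous_on S f"
    for S and f :: "'b::topological_space \<Rightarrow> real"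
    using that c continuous_on_compose2 by (metis subset_UNIV)+
  have "((\<lambda>s. integral (cbox (-1) 1) (\<lambda>r. g (X s r) * wave s r)) has_vector_derivative
    integral (cbox (-1) 1) (\<lambda>r. (complex_of_real (2 * m\<^sup>2 * s * (1 - r\<^sup>2)) * g' (X s r)
      - \<i> * complex_of_real k * complex_of_real r * g (X s r)) * wave s r)) (at s within UNIV)"
  proof (rule leibniz_rule_vector_derivative)
    fix s r
    have "((\<lambda>s. g (X s r) * wave s r) has_vector_derivative
        g (X s r) * ((- \<i> * complex_of_real k * complex_of_real r) * wave s r) +
        (complex_of_real (2 * m\<^sup>2 * s * (1 - r\<^sup>2)) * g' (X s r)) * wave s r) (at s)"
      using X_s[OF g] wave_s by (rule has_vector_derivative_mult)
    then show "((\<lambda>s. g (X s r) * wave s r) has_vector_derivative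
        (complex_of_real (2 * m\<^sup>2 * s * (1 - r\<^sup>2)) * g' (X s r)
      - \<i> * complex_of_real k * complex_of_real r * g (X s r)) * wave s r) (at s within UNIV)"
      by (simp add: algebra_simps)
  next
    show "(\<lambda>r. g (X s r) * wave s r) integrable_on cbox (- 1) 1" for s
      unfolding box_real by (intro integrable_continuous_real continuous_intros c')
  next
    show "continuous_on (UNIV \<times> cbox (- 1) 1) (\<lambda>(s, r). (complex_of_real (2 * m\<^sup>2 * s * (1 - r\<^sup>2)) * g' (X s r)
      - \<i> * complex_of_real k * complex_of_real r * g (X s r)) * wave s r)"
      unfolding case_prod_beta by (intro continuous_intros c')
  qed auto
  then show ?thesis by (simp only: box_real)
qed

private definition "I0 s = integral {-1..1} (\<lambda>r. bessel_profile (X s r) * wave s r)" for s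
private definition "I1 s = integral {-1..1} (\<lambda>r. bessel_profile' (X s r) * wave s r)" for s
private definition "Ir s = integral {-1..1} (\<lambda>r. complex_of_real r * bessel_profile' (X s r) * wave s r)" for s
private definition "J0 s = integral {-1..1} (\<lambda>r. (complex_of_real (2 * m\<^sup>2 * s * (1 - r\<^sup>2)) * bessel_profile' (X s r)
      - \<i> * complex_of_real k * complex_of_real r * bessel_profile (X s r)) * wave s r)" for s
private definition "J1 s = integral {-1..1} (\<lambda>r. (complex_of_real (2 * m\<^sup>2 * s * (1 - r\<^sup>2)) * bessel_profile'' (X s r)
      - \<i> * complex_of_real k * complex_of_real r * bessel_profile' (X s r)) * wave s r)" for s

private lemma integrals:
  "((\<lambda>r. bessel_profile (X s r) * wave s r) has_integral I0 s) {-1..1}"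
  "((\<lambda>r. bessel_profile' (X s r) * wave s r) has_integral I1 s) {-1..1}"
  "((\<lambda>r. complex_of_real r * bessel_profile' (X s r) * wave s r) has_integral Ir s) {-1..1}"
  "((\<lambda>r. (complex_of_real (2 * m\<^sup>2 * s * (1 - r\<^sup>2)) * bessel_profile' (X s r)
      - \<i> * complex_of_real k * complex_of_real r * bessel_profile (X s r)) * wave s r) has_integral J0 s) {-1..1}"
  "((\<lambda>r. (complex_of_real (2 * m\<^sup>2 * s * (1 - r\<^sup>2)) * bessel_profile'' (X s r)
      - \<i> * complex_of_real k * complex_of_real r * bessel_profile' (X s r)) * wave s r) has_integral J1 s) {-1..1}"
  unfolding I0_def I1_def Ir_def J0_def J1_def
  by (intro integrable_integral integrable_continuous_real continuous_intros)+

private lemma X_1: "X s 1 = 0" "X s (-1) = 0"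
  by (simp_all add: X_def)

private lemma wave_1: "wave s 1 = exp (- (\<i> * complex_of_real (k * s)))" "wave s (-1) = exp (\<i> * complex_of_real (k * s))"
  by (simp_all add: wave_def)

private lemma cos_wave: "wave s 1 + wave s (-1) = 2 * cos (complex_of_real (k * s))"
  and sin_wave: "wave s (-1) - wave s 1 = 2 * \<i> * sin (complex_of_real (k * s))"
  unfolding wave_1 cos_exp_eq sin_exp_eq by (simp_all add: field_simps)

text \<open>Each identity evaluates the integral of an \<open>r\<close>-derivative: of \<open>r \<Phi> e\<close>, of \<open>(\<i> k / 2) \<Phi> e\<close> and of \<open>\<Phi> e\<close>, where
  \<open>\<Phi>\<close> is the profile and \<open>e\<close> the plane wave. Bessel's equation enters in the second one.\<close>

private lemma r_derivatives:
  "I0 s + complex_of_real s * J0 s = 2 * cos (complex_of_real (k * s)) + 2 * complex_of_real (m\<^sup>2 * s) * complex_of_real s * I1 s"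
  "2 * complex_of_real (m\<^sup>2 * s) * I1 s + complex_of_real (m\<^sup>2 * s\<^sup>2) * J1 s
     + complex_of_real ((k\<^sup>2 + m\<^sup>2) * s / 2) * I0 s = complex_of_real k * sin (complex_of_real (k * s))"
  "- complex_of_real (2 * m\<^sup>2 * s\<^sup>2) * Ir s - \<i> * complex_of_real (k * s) * I0 s
     = - 2 * \<i> * sin (complex_of_real (k * s))"
proof -
  let ?e0 = "\<lambda>r. bessel_profile (X s r) * wave s r" and ?e1 = "\<lambda>r. bessel_profile' (X s r) * wave s r"
  let ?er = "\<lambda>r. complex_of_real r * bessel_profile' (X s r) * wave s r"
  let ?d0 = "\<lambda>r. (complex_of_real (2 * m\<^sup>2 * s * (1 - r\<^sup>2)) * bessel_profile' (X s r)
      - \<i> * complex_of_real k * complex_of_real r * bessel_profile (X s r)) * wave s r"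
  let ?d1 = "\<lambda>r. (complex_of_real (2 * m\<^sup>2 * s * (1 - r\<^sup>2)) * bessel_profile'' (X s r)
      - \<i> * complex_of_real k * complex_of_real r * bessel_profile' (X s r)) * wave s r"
  note ftc = fundamental_theorem_of_calculus[of "-1::real" 1, simplified]
  note dP = X_r[OF has_vector_derivative_bessel_profile]
  have d: "((\<lambda>r. ?e0 r) has_vector_derivative
      (- complex_of_real (2 * m\<^sup>2 * s\<^sup>2) * ?er r
       - \<i> * complex_of_real (k * s) * ?e0 r)) (at r within S)" for r S
    by (rule has_vector_derivative_at_within)
      (rule has_vector_derivative_eq_rhs[OF has_vector_derivative_mult[OF dP wave_r]], simp add: algebra_simps)
  have "((\<lambda>r. - complex_of_real (2 * m\<^sup>2 * s\<^sup>2) * ?er r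
       - \<i> * complex_of_real (k * s) * ?e0 r) has_integral
      (bessel_profile (X s 1) * wave s 1 - bessel_profile (X s (-1)) * wave s (-1))) {-1..1}"
    by (rule ftc[OF d])
  moreover have "((\<lambda>r. - complex_of_real (2 * m\<^sup>2 * s\<^sup>2) * ?er r
       - \<i> * complex_of_real (k * s) * ?e0 r) has_integral
     - complex_of_real (2 * m\<^sup>2 * s\<^sup>2) * Ir s - \<i> * complex_of_real (k * s) * I0 s) {-1..1}"
    by (intro has_integral_diff has_integral_mult_right integrals)
  ultimately have "- complex_of_real (2 * m\<^sup>2 * s\<^sup>2) * Ir s - \<i> * complex_of_real (k * s) * I0 s
     = bessel_profile (X s 1) * wave s 1 - bessel_profile (X s (-1)) * wave s (-1)"
    by (rule has_integral_unique[rotated])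
  also have "\<dots> = - (wave s (-1) - wave s 1)" by (simp add: X_1 bessel_profile_0)
  finally show "- complex_of_real (2 * m\<^sup>2 * s\<^sup>2) * Ir s - \<i> * complex_of_real (k * s) * I0 s
     = - 2 * \<i> * sin (complex_of_real (k * s))"
    by (simp add: sin_wave)
  have "((\<lambda>r. complex_of_real r * ?e0 r) has_vector_derivative
      (?e0 r + complex_of_real s * ?d0 r
      - 2 * complex_of_real (m\<^sup>2 * s) * complex_of_real s * ?e1 r)) (at r within S)" for r S
    by (rule has_vector_derivative_eq_rhs[OF has_vector_derivative_mult[OF has_vector_derivative_of_real[OF DERIV_ident] d]])
      (simp add: algebra_simps power2_eq_square)
  from ftc[OF this]
  have "((\<lambda>r. ?e0 r + complex_of_real s * ?d0 r
      - 2 * complex_of_real (m\<^sup>2 * s) * complex_of_real s * ?e1 r) has_integral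
      wave s 1 + wave s (-1)) {-1..1}" by (simp add: X_1 bessel_profile_0)
  moreover have "((\<lambda>r. ?e0 r + complex_of_real s * ?d0 r
      - 2 * complex_of_real (m\<^sup>2 * s) * complex_of_real s * ?e1 r) has_integral
      I0 s + complex_of_real s * J0 s - 2 * complex_of_real (m\<^sup>2 * s) * complex_of_real s * I1 s) {-1..1}"
    by (intro has_integral_diff has_integral_add has_integral_mult_right integrals)
  ultimately have "I0 s + complex_of_real s * J0 s - 2 * complex_of_real (m\<^sup>2 * s) * complex_of_real s * I1 s = wave s 1 + wave s (-1)"
    by (rule has_integral_unique[rotated])
  then show "I0 s + complex_of_real s * J0 s = 2 * cos (complex_of_real (k * s)) + 2 * complex_of_real (m\<^sup>2 * s) * complex_of_real s * I1 s"
    using cos_wave[of s] by (simp add: algebra_simps)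
  have "2 * complex_of_real (m\<^sup>2 * s) * ?e1 r
      + complex_of_real (m\<^sup>2 * s\<^sup>2) * ?d1 r
      + complex_of_real ((k\<^sup>2 + m\<^sup>2) * s / 2) * ?e0 r
     = (\<i> * complex_of_real k / 2) * (- complex_of_real (2 * m\<^sup>2 * s\<^sup>2) * ?er r
       - \<i> * complex_of_real (k * s) * ?e0 r)" (is "?L r = ?R r") for r
  proof -
    have "?L r - ?R r = 2 * complex_of_real (m\<^sup>2 * s) * wave s r *
        (complex_of_real (X s r) * bessel_profile'' (X s r) + bessel_profile' (X s r) + bessel_profile (X s r) / 4)"
      by (simp add: X_def field_simps power2_eq_square)
    then show ?thesis by (simp add: bessel_profile_ode)
  qed
  note LR = this
  have "((\<lambda>r. (\<i> * complex_of_real k / 2) * ?e0 r) has_vector_derivative ?L r) (at r within S)" for r S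
    unfolding LR by (rule has_vector_derivative_mult_right[OF d])
  from ftc[OF this] have "(?L has_integral (\<i> * complex_of_real k / 2) * (wave s 1 - wave s (-1))) {-1..1}"
    by (simp add: X_1 bessel_profile_0 algebra_simps)
  moreover have "(?L has_integral (2 * complex_of_real (m\<^sup>2 * s) * I1 s + complex_of_real (m\<^sup>2 * s\<^sup>2) * J1 s
     + complex_of_real ((k\<^sup>2 + m\<^sup>2) * s / 2) * I0 s)) {-1..1}"
    by (intro has_integral_diff has_integral_add has_integral_mult_right integrals)
  ultimately have "2 * complex_of_real (m\<^sup>2 * s) * I1 s + complex_of_real (m\<^sup>2 * s\<^sup>2) * J1 s
     + complex_of_real ((k\<^sup>2 + m\<^sup>2) * s / 2) * I0 s = (\<i> * complex_of_real k / 2) * (wave s 1 - wave s (-1))"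
    by (rule has_integral_unique[rotated])
  also have "\<dots> = complex_of_real k * sin (complex_of_real (k * s))"
  proof -
    have "wave s 1 - wave s (-1) = - (2 * \<i> * sin (complex_of_real (k * s)))"
      using sin_wave[of s] by (metis minus_diff_eq)
    then show ?thesis by (simp add: mult_ac)
  qed
  finally show "2 * complex_of_real (m\<^sup>2 * s) * I1 s + complex_of_real (m\<^sup>2 * s\<^sup>2) * J1 s
     + complex_of_real ((k\<^sup>2 + m\<^sup>2) * s / 2) * I0 s = complex_of_real k * sin (complex_of_real (k * s))" .
qed


private lemma kernel_integrals:
  "integral {-1..1} (\<lambda>r. kernel_sin m (s * r) s * exp (- (\<i> * complex_of_real (k * (s * r))))) = I0 s / 2"
  "integral {-1..1} (\<lambda>r. kernel_cos m (s * r) s * exp (- (\<i> * complex_of_real (k * (s * r))))) = complex_of_real (m\<^sup>2 * s) * I1 s"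
  "integral {-1..1} (\<lambda>r. kernel_dsin m (s * r) s * exp (- (\<i> * complex_of_real (k * (s * r))))) = - complex_of_real (m\<^sup>2 * s) * Ir s"
proof -
  have "((\<lambda>r. kernel_sin m (s * r) s * exp (- (\<i> * complex_of_real (k * (s * r))))) has_integral I0 s / 2) {-1..1}"
    by (rule has_integral_eq[OF _ has_integral_divide[OF integrals(1)]]) (simp add: kernel_sin_def X_def wave_def)
  then show "integral {-1..1} (\<lambda>r. kernel_sin m (s * r) s * exp (- (\<i> * complex_of_real (k * (s * r))))) = I0 s / 2"
    by (rule integral_unique)
  have "((\<lambda>r. kernel_cos m (s * r) s * exp (- (\<i> * complex_of_real (k * (s * r))))) has_integral complex_of_real (m\<^sup>2 * s) * I1 s) {-1..1}"
    by (rule has_integral_eq[OF _ has_integral_mult_right[OF integrals(2)]]) (simp add: kernel_cos_def X_def wave_def)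
  then show "integral {-1..1} (\<lambda>r. kernel_cos m (s * r) s * exp (- (\<i> * complex_of_real (k * (s * r))))) = complex_of_real (m\<^sup>2 * s) * I1 s"
    by (rule integral_unique)
  have "((\<lambda>r. kernel_dsin m (s * r) s * exp (- (\<i> * complex_of_real (k * (s * r))))) has_integral - complex_of_real (m\<^sup>2 * s) * Ir s) {-1..1}"
    by (rule has_integral_eq[OF _ has_integral_mult_right[OF integrals(3)]]) (simp add: kernel_dsin_def X_def wave_def)
  then show "integral {-1..1} (\<lambda>r. kernel_dsin m (s * r) s * exp (- (\<i> * complex_of_real (k * (s * r))))) = - complex_of_real (m\<^sup>2 * s) * Ir s"
    by (rule integral_unique)
qed

text \<open>As functions of \<open>s\<close>, the first two symbols form the system \<open>u' = v\<close>, \<open>v' = - \<rho>\<^sup>2 u\<close> with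
  \<open>u 0 = 0\<close>, \<open>v 0 = 1\<close>; rotating \<open>(\<rho> u, v)\<close> back by the angle \<open>\<rho> s\<close> gives a constant.\<close>

lemma symbol_sin_cos:
  assumes \<rho>: "\<rho>\<^sup>2 = k\<^sup>2 + m\<^sup>2"
  shows "complex_of_real \<rho> * symbol 0 0 (kernel_sin m) k s = complex_of_real (sin (\<rho> * s))"
    and "symbol (1/2) (1/2) (kernel_cos m) k s = complex_of_real (cos (\<rho> * s))"
proof -
  define u where "u s = complex_of_real (s / 2) * I0 s" for s
  define v where "v s = complex_of_real (cos (k * s)) + complex_of_real (m\<^sup>2 * s\<^sup>2) * I1 s" for s
  have I0': "(I0 has_vector_derivative J0 s) (at s)" for s
    unfolding I0_def[abs_def] J0_def
    by (rule integral_s[OF has_vector_derivative_bessel_profile]) (intro continuous_intros)+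
  have I1': "(I1 has_vector_derivative J1 s) (at s)" for s
    unfolding I1_def[abs_def] J1_def
    by (rule integral_s[OF has_vector_derivative_bessel_profile']) (intro continuous_intros)+
  have u': "(u has_vector_derivative v s) (at s)" for s
  proof -
    have "(u has_vector_derivative complex_of_real (s / 2) * J0 s + complex_of_real (1 / 2) * I0 s) (at s)"
      unfolding u_def[abs_def]
      by (intro has_vector_derivative_mult has_vector_derivative_of_real I0') (auto intro!: derivative_eq_intros)
    moreover have "complex_of_real (s / 2) * J0 s + complex_of_real (1 / 2) * I0 s = v s"
    proof (rule mult_left_cancel[THEN iffD1])
      show "2 * (complex_of_real (s / 2) * J0 s + complex_of_real (1 / 2) * I0 s) = 2 * v s"
      using r_derivatives(1)[of s] cos_of_real[where 'a = complex, of "k * s", symmetric]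
        by (simp add: v_def power2_eq_square algebra_simps)
    qed simp
    ultimately show ?thesis by simp
  qed
  have v': "(v has_vector_derivative - (complex_of_real \<rho>)\<^sup>2 * u s) (at s)" for s
  proof -
    have "(v has_vector_derivative complex_of_real (- sin (k * s) * k) +
        (complex_of_real (m\<^sup>2 * s\<^sup>2) * J1 s + complex_of_real (m\<^sup>2 * (2 * s)) * I1 s)) (at s)"
      unfolding v_def[abs_def]
      by (intro has_vector_derivative_add has_vector_derivative_mult has_vector_derivative_of_real I1')
        (auto intro!: derivative_eq_intros)
    moreover have "complex_of_real (- sin (k * s) * k) +
        (complex_of_real (m\<^sup>2 * s\<^sup>2) * J1 s + complex_of_real (m\<^sup>2 * (2 * s)) * I1 s) = - (complex_of_real \<rho>)\<^sup>2 * u s"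
      using r_derivatives(2)[of s, folded \<rho>] sin_of_real[where 'a = complex, of "k * s", symmetric]
      by (simp add: u_def power2_eq_square algebra_simps)
    ultimately show ?thesis by simp
  qed
  have c: "((\<lambda>s. complex_of_real (cos (\<rho> * s))) has_vector_derivative complex_of_real (- (\<rho> * sin (\<rho> * s)))) (at s)"
    and sn: "((\<lambda>s. complex_of_real (sin (\<rho> * s))) has_vector_derivative complex_of_real (\<rho> * cos (\<rho> * s))) (at s)" for s
    by (auto intro!: has_vector_derivative_of_real derivative_eq_intros)
  let ?p = "\<lambda>s. v s * complex_of_real (cos (\<rho> * s)) + complex_of_real \<rho> * (u s * complex_of_real (sin (\<rho> * s)))"
  let ?q = "\<lambda>s. v s * complex_of_real (sin (\<rho> * s)) - complex_of_real \<rho> * (u s * complex_of_real (cos (\<rho> * s)))"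
  have "(?p has_vector_derivative 0) (at s)" for s
    by (rule has_vector_derivative_eq_rhs[OF has_vector_derivative_add[OF has_vector_derivative_mult[OF v' c]
          has_vector_derivative_mult_right[OF has_vector_derivative_mult[OF u' sn]]]])
      (simp add: power2_eq_square, algebra)
  then have p0: "?p s = ?p 0" for s
    by (intro has_derivative_zero_unique[OF convex_UNIV]) (simp_all add: has_vector_derivative_def)
  have "(?q has_vector_derivative 0) (at s)" for s
    by (rule has_vector_derivative_eq_rhs[OF has_vector_derivative_diff[OF has_vector_derivative_mult[OF v' sn]
          has_vector_derivative_mult_right[OF has_vector_derivative_mult[OF u' c]]]])
      (simp add: power2_eq_square, algebra)
  then have q0: "?q s = ?q 0" for s
    by (intro has_derivative_zero_unique[OF convex_UNIV]) (simp_all add: has_vector_derivative_def)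
  have 1: "?p s = 1" "?q s = 0" for s
    unfolding p0[of s] q0[of s] by (simp_all add: u_def v_def)
  have cs: "(complex_of_real (cos (\<rho> * s)))\<^sup>2 + (complex_of_real (sin (\<rho> * s)))\<^sup>2 = 1" for s
    by (metis of_real_1 of_real_add of_real_power sin_cos_squared_add2)
  have v: "v s = complex_of_real (cos (\<rho> * s))"
  proof -
    have "v s * ((complex_of_real (cos (\<rho> * s)))\<^sup>2 + (complex_of_real (sin (\<rho> * s)))\<^sup>2)
        = ?p s * complex_of_real (cos (\<rho> * s)) + ?q s * complex_of_real (sin (\<rho> * s))"
      by (simp add: algebra_simps power2_eq_square)
    then show ?thesis using 1[of s] cs[of s] by simp
  qed
  have u: "complex_of_real \<rho> * u s = complex_of_real (sin (\<rho> * s))"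
  proof -
    have "complex_of_real \<rho> * u s * ((complex_of_real (cos (\<rho> * s)))\<^sup>2 + (complex_of_real (sin (\<rho> * s)))\<^sup>2)
        = ?p s * complex_of_real (sin (\<rho> * s)) - ?q s * complex_of_real (cos (\<rho> * s))"
      by (simp add: algebra_simps power2_eq_square)
    then show ?thesis using 1[of s] cs[of s] by simp
  qed
  show "complex_of_real \<rho> * symbol 0 0 (kernel_sin m) k s = complex_of_real (sin (\<rho> * s))"
    using u unfolding symbol_def kernel_integrals by (simp add: u_def mult_ac)
  show "symbol (1/2) (1/2) (kernel_cos m) k s = complex_of_real (cos (\<rho> * s))"
  proof -
    have "(1/2) * exp (\<i> * complex_of_real (k * s)) + (1/2) * exp (- (\<i> * complex_of_real (k * s))) = complex_of_real (cos (k * s))"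
      unfolding cos_of_real[symmetric] cos_exp_eq by (simp add: field_simps)
    then have "symbol (1/2) (1/2) (kernel_cos m) k s = v s"
      unfolding symbol_def kernel_integrals by (simp add: v_def power2_eq_square mult_ac)
    then show ?thesis using v by simp
  qed
qed

text \<open>An integration by parts in \<open>u\<close> trades the factor \<open>\<i> k\<close> for the derivative of the density of \<open>sin (\<rho> s) / \<rho>\<close>; the
  end points contribute the two masses.\<close>

lemma symbol_dsin:
  assumes "\<rho>\<^sup>2 = k\<^sup>2 + m\<^sup>2"
  shows "complex_of_real \<rho> * symbol (1/2) (- 1/2) (kernel_dsin m) k s = \<i> * complex_of_real k * complex_of_real (sin (\<rho> * s))"
proof -
  have e: "(1/2) * exp (\<i> * complex_of_real (k * s)) + (- 1/2) * exp (- (\<i> * complex_of_real (k * s))) = \<i> * sin (complex_of_real (k * s))"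
    unfolding sin_exp_eq by (simp add: field_simps)
  have "2 * symbol (1/2) (- 1/2) (kernel_dsin m) k s = 2 * (\<i> * complex_of_real k * symbol 0 0 (kernel_sin m) k s)"
    using r_derivatives(3)[of s] e unfolding symbol_def kernel_integrals
    by (simp add: algebra_simps power2_eq_square)
  then have "symbol (1/2) (- 1/2) (kernel_dsin m) k s = \<i> * complex_of_real k * symbol 0 0 (kernel_sin m) k s"
    by simp
  then show ?thesis using symbol_sin_cos(1)[OF assms, of s] by (simp add: mult_ac)
qed

end

section \<open>Integration on intervals and on the half-line\<close>

lemma swap_integrals:
  fixes f :: "real \<Rightarrow> real \<Rightarrow> complex"
  assumes "continuous_on ({a..b} \<times> {c..d}) (\<lambda>p. f (fst p) (snd p))"
  shows "integral {a..b} (\<lambda>x. integral {c..d} (f x)) = integral {c..d} (\<lambda>y. integral {a..b} (\<lambda>x. f x y))"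
  using integral_swap_continuous[of a c b d f] assms by (simp add: cbox_Pair_eq case_prod_beta)

lemma continuous_on_parameter_integral:
  fixes f :: "'a::topological_space \<Rightarrow> real \<Rightarrow> complex"
  assumes "continuous_on (U \<times> {a..b}) (\<lambda>p. f (fst p) (snd p))"
  shows "continuous_on U (\<lambda>x. integral {a..b} (f x))"
  using integral_continuous_on_param[of U a b f] assms by (simp add: case_prod_beta)

lemma integral_rescale:
  fixes f :: "real \<Rightarrow> complex"
  assumes "continuous_on {p + c * a..p + c * b} f" "a \<le> b" "c \<ge> 0"
  shows "complex_of_real c * integral {a..b} (\<lambda>r. f (p + c * r)) = integral {p + c * a..p + c * b} f"
proof -
  let ?I = "{p + c * a..p + c * b}"
  obtain g where g: "\<And>x. x \<in> ?I \<Longrightarrow> (g has_vector_derivative f x) (at x within ?I)"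
    using antiderivative_continuous[OF assms(1)] by blast
  have le: "p + c * a \<le> p + c * b" using assms by (simp add: mult_left_mono)
  have sub: "(\<lambda>r. p + c * r) ` {a..b} \<subseteq> ?I" using assms by (auto simp: mult_left_mono)
  have "((g \<circ> (\<lambda>r. p + c * r)) has_vector_derivative c *\<^sub>R f (p + c * r)) (at r within {a..b})"
    if "r \<in> {a..b}" for r
  proof (rule vector_diff_chain_within)
    show "((\<lambda>r. p + c * r) has_vector_derivative c) (at r within {a..b})"
      unfolding has_real_derivative_iff_has_vector_derivative[symmetric]
      by (auto intro!: derivative_eq_intros)
    show "(g has_vector_derivative f (p + c * r)) (at (p + c * r) within (\<lambda>r. p + c * r) ` {a..b})"
      using that sub g has_vector_derivative_within_subset by blast
  qed
  from fundamental_theorem_of_calculus[OF assms(2) this]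
  have "((\<lambda>r. c *\<^sub>R f (p + c * r)) has_integral g (p + c * b) - g (p + c * a)) {a..b}" by simp
  then have "integral {a..b} (\<lambda>r. c *\<^sub>R f (p + c * r)) = g (p + c * b) - g (p + c * a)"
    by (rule integral_unique)
  moreover have "integral ?I f = g (p + c * b) - g (p + c * a)"
    using fundamental_theorem_of_calculus[OF le g] by (rule integral_unique)
  ultimately show ?thesis by (simp add: scaleR_conv_of_real)
qed

lemma has_vector_derivative_cis:
  "((\<lambda>y. cis (c * y)) has_vector_derivative \<i> * of_real c * cis (c * y)) (at y within S)"
  using has_vector_derivative_exp_scaled[of "\<i> * of_real c" y S] by (simp add: cis_conv_exp mult_ac)

lemma continuous_on_cis_real [continuous_intros]:
  fixes f :: "'a::topological_space \<Rightarrow> real"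
  shows "continuous_on S f \<Longrightarrow> continuous_on S (\<lambda>x. cis (f x))"
  unfolding cis_conv_exp by (intro continuous_intros)

text \<open>The function \<open>1 / x\<^sup>2\<close>, cut off at height one, serves as integrable majorant on the half-line.\<close>

definition majorant :: "real \<Rightarrow> real" where
  "majorant x = (if x \<le> 1 then 1 else 1 / x ^ 2)"

lemma majorant_nonneg: "majorant x \<ge> 0"
  by (simp add: majorant_def)

lemma majorant_integrable: "majorant integrable_on {0..}"
proof -
  have "(\<lambda>x::real. 1) integrable_on {0..1}" by (rule integrable_const_ivl)
  then have 1: "majorant integrable_on {0..1}"
    by (rule integrable_eq) (simp add: majorant_def)
  have "(\<lambda>x::real. x powr (-2)) integrable_on {1..}"
    using has_integral_powr_to_inf[of "-2" 1] by (auto simp: integrable_on_def)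
  then have 2: "majorant integrable_on {1..}"
    by (rule integrable_eq) (auto simp: majorant_def powr_minus powr_realpow divide_inverse)
  have "majorant integrable_on {0..1} \<union> {1..}"
    by (rule integrable_Un'[OF 1 2]) (auto simp: negligible_sing intro: negligible_subset[of "{1}"])
  moreover have "{0..1} \<union> {1..} = {0::real..}" by auto
  ultimately show ?thesis by simp
qed

definition decaying :: "(real \<Rightarrow> complex) \<Rightarrow> bool" where
  "decaying f \<longleftrightarrow> continuous_on {0..} f \<and> (\<exists>C. \<forall>x\<ge>0. norm (f x) \<le> C * majorant x)"

lemma decayingE:
  assumes "decaying f"
  obtains C where "C \<ge> 0" "\<And>x. x \<ge> 0 \<Longrightarrow> norm (f x) \<le> C * majorant x"
proof -
  obtain C where C: "\<And>x. x \<ge> 0 \<Longrightarrow> norm (f x) \<le> C * majorant x"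
    using assms unfolding decaying_def by blast
  moreover have "C \<ge> 0" using order_trans[OF norm_ge_zero C[of 0]] by (simp add: majorant_def)
  ultimately show ?thesis using that by blast
qed

lemma decaying_mult_bounded:
  assumes "decaying f" "continuous_on {0..} \<phi>" "\<And>x. x \<ge> 0 \<Longrightarrow> norm (\<phi> x) \<le> B"
  shows "decaying (\<lambda>x. f x * \<phi> x)"
proof -
  obtain C where C: "C \<ge> 0" "\<And>x. x \<ge> 0 \<Longrightarrow> norm (f x) \<le> C * majorant x" using decayingE[OF assms(1)] by blast
  have "norm (f x * \<phi> x) \<le> (C * B) * majorant x" if "x \<ge> 0" for x
    using mult_mono[OF C(2)[OF that] assms(3)[OF that]] C(1) majorant_nonneg[of x]
    by (simp add: norm_mult mult_ac)
  then show ?thesis using assms unfolding decaying_def by (auto intro!: continuous_intros)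
qed

lemma decaying_integrable:
  assumes "decaying f"
  shows "f integrable_on {0..}" "(\<lambda>x. norm (f x)) integrable_on {0..}"
proof -
  obtain C where C: "C \<ge> 0" "\<And>x. x \<ge> 0 \<Longrightarrow> norm (f x) \<le> C * majorant x" using decayingE[OF assms] by blast
  have c: "continuous_on {0..} f" using assms decaying_def by blast
  have i: "(\<lambda>x. C * majorant x) integrable_on {0..}"
    using integrable_cmul[OF majorant_integrable, of C] by simp
  show "f integrable_on {0..}"
    by (rule measurable_bounded_by_integrable_imp_integrable[OF _ i])
      (use C in \<open>auto intro!: continuous_imp_measurable_on_sets_lebesgue c\<close>)
  show "(\<lambda>x. norm (f x)) integrable_on {0..}"
    by (rule measurable_bounded_by_integrable_imp_integrable[OF _ i])
      (use C in \<open>auto intro!: continuous_imp_measurable_on_sets_lebesgue continuous_on_norm c\<close>)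
qed

lemma decaying_integral_limit:
  assumes "decaying f"
  shows "(\<lambda>n. integral {0..real n} f) \<longlonglongrightarrow> integral {0..} f"
proof -
  obtain C where C: "C \<ge> 0" "\<And>x. x \<ge> 0 \<Longrightarrow> norm (f x) \<le> C * majorant x" using decayingE[OF assms] by blast
  have c: "continuous_on {0..} f" using assms decaying_def by blast
  let ?f = "\<lambda>n x. if x \<in> {0..real n} then f x else 0"
  have "(\<lambda>n. integral {0..} (?f n)) \<longlonglongrightarrow> integral {0..} f"
  proof (rule dominated_convergence(2))
    show "?f n integrable_on {0..}" for n
    proof -
      have "f integrable_on {0..real n}"
        using c by (intro integrable_continuous_real) (auto intro: continuous_on_subset)
      then show ?thesis by (subst integrable_restrict_Int) (simp add: inf.absorb1 Int_absorb2)
    qed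
    show "(\<lambda>x. C * majorant x) integrable_on {0..}"
      using integrable_cmul[OF majorant_integrable, of C] by simp
    show "norm (?f n x) \<le> C * majorant x" if "x \<in> {0..}" for n x
      using C that majorant_nonneg[of x] by auto
    show "(\<lambda>n. ?f n x) \<longlonglongrightarrow> f x" if "x \<in> {0..}" for x
    proof (rule tendsto_eventually)
      have "eventually (\<lambda>n. real n \<ge> x) sequentially"
        using eventually_ge_at_top[of "nat \<lceil>x\<rceil>"] by eventually_elim linarith
      then show "eventually (\<lambda>n. ?f n x = f x) sequentially"
        by eventually_elim (use that in auto)
    qed
  qed
  moreover have "integral {0..} (?f n) = integral {0..real n} f" for n
    by (subst integral_restrict_Int) (simp add: Int_absorb2)
  ultimately show ?thesis by simp
qed

lemma decaying_at_infinity: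
  assumes "decaying f"
  shows "(\<lambda>n. f (real n)) \<longlonglongrightarrow> 0"
proof -
  obtain C where C: "C \<ge> 0" "\<And>x. x \<ge> 0 \<Longrightarrow> norm (f x) \<le> C * majorant x" using decayingE[OF assms] by blast
  have "(\<lambda>n. C * (1 / real n ^ 2)) \<longlonglongrightarrow> 0" by real_asymp
  moreover have "eventually (\<lambda>n. norm (f (real n)) \<le> C * (1 / real n ^ 2)) sequentially"
    using eventually_gt_at_top[of 1] 
  proof eventually_elim
    case (elim n)
    then show ?case using C(2)[of "real n"] by (simp add: majorant_def)
  qed
  ultimately show ?thesis by (rule Lim_null_comparison[rotated])
qed

section \<open>The sine integral\<close>

lemma Si_bound: obtains B where "B \<ge> 0" "\<And>u. \<bar>Si u\<bar> \<le> B"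
  using bounded_Si by (metis abs_ge_zero order_trans)

lemma Si_limit: "(\<lambda>n. Si (real n * u)) \<longlonglongrightarrow> pi / 2 * sgn u"
proof -
  have pos: "(\<lambda>n. Si (real n * u)) \<longlonglongrightarrow> pi / 2" if "u > 0" for u
    by (rule filterlim_compose[OF Si_at_top])
      (rule filterlim_at_top_mult_tendsto_pos[OF tendsto_const that filterlim_real_sequentially])
  consider "u > 0" | "u = 0" | "u < 0" by linarith
  then show ?thesis
  proof cases
    case 3
    have "Si (real n * u) = - Si (real n * (- u))" for n
      using Si_neg[of "real n * (- u)"] 3 by (simp add: mult_le_0_iff)
    then show ?thesis using tendsto_minus[OF pos[of "- u"]] 3 by simp
  qed (use pos Si_neg[of 0] in auto)
qed

lemma Si_scaled_derivative:
  "((\<lambda>y. 2 * Si (A * (y - z))) has_real_derivative 2 * A * sinc (A * (y - z))) (at y within S)"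
proof -
  have "((\<lambda>y. Si (A * (y - z))) has_real_derivative sinc (A * (y - z)) * A) (at y within S)"
    by (rule DERIV_chain2[OF DERIV_Si]) (auto intro!: derivative_eq_intros)
  from DERIV_cmult[OF this, of 2] show ?thesis by (simp add: mult_ac)
qed

lemma dirichlet_kernel:
  assumes "A \<ge> 0"
  shows "integral {-A..A} (\<lambda>k. cis (k * w)) = complex_of_real (2 * A * sinc (A * w))"
proof (cases "w = 0")
  case True
  then show ?thesis using assms by (simp add: scaleR_conv_of_real)
next
  case False
  have "((\<lambda>k. cis (w * k) / (\<i> * of_real w)) has_vector_derivative cis (w * k)) (at k within S)" for k S
    using has_vector_derivative_divide[OF has_vector_derivative_cis[of w k S], of "\<i> * of_real w"] False by simp
  then have "((\<lambda>k. cis (w * k)) has_integral cis (w * A) / (\<i> * of_real w) - cis (w * (- A)) / (\<i> * of_real w)) {-A..A}"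
    using assms by (intro fundamental_theorem_of_calculus) auto
  then have "integral {-A..A} (\<lambda>k. cis (w * k)) = (cis (w * A) - cis (- (w * A))) / (\<i> * of_real w)"
    by (simp add: integral_unique diff_divide_distrib)
  also have "cis (w * A) - cis (- (w * A)) = \<i> * of_real (2 * sin (w * A))"
    by (simp add: complex_eq_iff)
  also have "\<i> * of_real (2 * sin (w * A)) / (\<i> * of_real w) = complex_of_real (2 * A * sinc (A * w))"
    using False by (auto simp: mult_ac)
  finally show ?thesis by (simp add: mult.commute)
qed

lemma continuous_on_Si [continuous_intros]:
  "continuous_on S f \<Longrightarrow> continuous_on S (\<lambda>x. Si (f x))"
  using continuous_on_compose2[OF continuous_at_imp_continuous_on[of UNIV Si]] isCont_Si by auto

section \<open>Inversion on a bounded interval\<close>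

text \<open>As a function of \<open>y\<close>, the Dirichlet kernel with cut-off \<open>A\<close> and centre \<open>z\<close> is the derivative of
  \<open>2 * Si (A * (y - z))\<close>. After an integration by parts the cut-off occurs only inside the bounded function \<^const>\<open>Si\<close>.\<close>

lemma truncated_inversion_interval:
  assumes "a \<le> b" "A \<ge> 0" and f: "\<And>y. y \<in> {a..b} \<Longrightarrow> (f has_vector_derivative f' y) (at y within {a..b})"
    and f': "continuous_on {a..b} f'"
  shows "integral {-A..A} (\<lambda>k. cis (k * z) * integral {a..b} (\<lambda>y. cis (- (k * y)) * f y)) =
    f b * of_real (2 * Si (A * (b - z))) - f a * of_real (2 * Si (A * (a - z)))
     - integral {a..b} (\<lambda>y. f' y * of_real (2 * Si (A * (y - z))))"
proof -
  have cf: "continuous_on {a..b} f" 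
    unfolding continuous_on_eq_continuous_within using f has_vector_derivative_continuous by blast
  have "integral {-A..A} (\<lambda>k. cis (k * z) * integral {a..b} (\<lambda>y. cis (- (k * y)) * f y))
      = integral {-A..A} (\<lambda>k. integral {a..b} (\<lambda>y. cis (k * (z - y)) * f y))"
  proof -
    have "cis (k * z) * (cis (- (k * y)) * f y) = cis (k * (z - y)) * f y" for k y
      by (simp add: mult.assoc[symmetric] cis_mult right_diff_distrib)
    then show ?thesis unfolding integral_mult_right[symmetric] by (simp only:)
  qed
  also have "\<dots> = integral {a..b} (\<lambda>y. integral {-A..A} (\<lambda>k. cis (k * (z - y)) * f y))"
    by (rule swap_integrals) (intro continuous_intros continuous_on_compose2[OF cf], auto)
  also have "\<dots> = integral {a..b} (\<lambda>y. f y * of_real (2 * A * sinc (A * (y - z))))"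
  proof (intro integral_cong)
    fix y
    have "sinc (A * (z - y)) = sinc (A * (y - z))"
      using sinc_neg[of "A * (y - z)"] by (simp only: right_diff_distrib minus_diff_eq)
    then show "integral {-A..A} (\<lambda>k. cis (k * (z - y)) * f y) = f y * of_real (2 * A * sinc (A * (y - z)))"
      unfolding integral_mult_left using dirichlet_kernel[OF assms(2), of "z - y"] by (simp only: mult.commute)
  qed
  also have "\<dots> = f b * of_real (2 * Si (A * (b - z))) - f a * of_real (2 * Si (A * (a - z)))
     - integral {a..b} (\<lambda>y. f' y * of_real (2 * Si (A * (y - z))))"
  proof -
    have "((\<lambda>y. f y * of_real (2 * Si (A * (y - z)))) has_vector_derivative
        f y * of_real (2 * A * sinc (A * (y - z))) + f' y * of_real (2 * Si (A * (y - z)))) (at y within {a..b})"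
      if "y \<in> {a..b}" for y
      by (rule has_vector_derivative_mult[OF f[OF that] has_vector_derivative_of_real[OF Si_scaled_derivative]])
    from fundamental_theorem_of_calculus[OF assms(1) this]
    have 1: "((\<lambda>y. f y * of_real (2 * A * sinc (A * (y - z))) + f' y * of_real (2 * Si (A * (y - z)))) has_integral
      f b * of_real (2 * Si (A * (b - z))) - f a * of_real (2 * Si (A * (a - z)))) {a..b}" .
    have 2: "((\<lambda>y. f' y * of_real (2 * Si (A * (y - z)))) has_integral
       integral {a..b} (\<lambda>y. f' y * of_real (2 * Si (A * (y - z))))) {a..b}"
      by (intro integrable_integral integrable_continuous_real continuous_intros f')
    have "((\<lambda>y. f y * of_real (2 * A * sinc (A * (y - z)))) has_integral
      f b * of_real (2 * Si (A * (b - z))) - f a * of_real (2 * Si (A * (a - z)))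
       - integral {a..b} (\<lambda>y. f' y * of_real (2 * Si (A * (y - z))))) {a..b}"
      using has_integral_diff[OF 1 2] by (simp only: add_diff_cancel_right')
    then show ?thesis by (rule integral_unique)
  qed
  finally show ?thesis .
qed

text \<open>The weight \<open>sgn (z - a) + sgn (b - z)\<close> is \<open>2\<close> inside the interval, \<open>1\<close> at its end points (if they differ) and
  \<open>0\<close> outside, so that only values of \<open>f\<close> on the interval enter.\<close>

lemma sgn_weighted_integral:
  fixes f f' :: "real \<Rightarrow> complex"
  assumes "a \<le> b" and f: "\<And>y. y \<in> {a..b} \<Longrightarrow> (f has_vector_derivative f' y) (at y within {a..b})"
  shows "((\<lambda>y. f' y * of_real (sgn (y - z))) has_integral
    f b * of_real (sgn (b - z)) - f a * of_real (sgn (a - z)) - f z * of_real (sgn (z - a) + sgn (b - z))) {a..b}"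
proof -
  have ftc: "(f' has_integral f d - f c) {c..d}" if "a \<le> c" "c \<le> d" "d \<le> b" for c d
  proof (rule fundamental_theorem_of_calculus[OF that(2)])
    fix y assume "y \<in> {c..d}"
    then show "(f has_vector_derivative f' y) (at y within {c..d})"
      using that by (intro has_vector_derivative_within_subset[OF f]) auto
  qed
  have up: "((\<lambda>y. f' y * of_real (sgn (y - z))) has_integral f d - f c) {c..d}" if "a \<le> c" "c \<le> d" "d \<le> b" "z \<le> c" for c d
    by (rule has_integral_spike_finite[OF _ _ ftc[OF that(1-3)], of "{z}"]) (use that in auto)
  have down: "((\<lambda>y. f' y * of_real (sgn (y - z))) has_integral - (f d - f c)) {c..d}" if "a \<le> c" "c \<le> d" "d \<le> b" "d \<le> z" for c d
    by (rule has_integral_spike_finite[OF _ _ has_integral_neg[OF ftc[OF that(1-3)]], of "{z}"]) (use that in auto)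
  consider "z < a" | "z = a" "a = b" | "z = a" "a < b" | "a < z" "z < b" | "z = b" "a < b" | "b < z"
    using assms(1) by linarith
  then show ?thesis
  proof cases
    case 4
    then show ?thesis
      using has_integral_combine[OF _ _ down[of a z] up[of z b]] by (simp add: algebra_simps)
  qed (use up[of a b] down[of a b] assms(1) in \<open>auto simp: algebra_simps\<close>)
qed

lemma inversion_interval:
  assumes "a \<le> b" and f: "\<And>y. y \<in> {a..b} \<Longrightarrow> (f has_vector_derivative f' y) (at y within {a..b})"
    and f': "continuous_on {a..b} f'"
  shows "(\<lambda>n. integral {-real n..real n} (\<lambda>k. cis (k * z) * integral {a..b} (\<lambda>y. cis (- (k * y)) * f y)))
    \<longlonglongrightarrow> of_real pi * of_real (sgn (z - a) + sgn (b - z)) * f z"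
proof -
  obtain B where B: "B \<ge> 0" "\<And>u. \<bar>Si u\<bar> \<le> B" using Si_bound by blast
  obtain M where M: "\<And>y. y \<in> {a..b} \<Longrightarrow> norm (f' y) \<le> M"
    using compact_continuous_image[OF f'] compact_imp_bounded bounded_iff by (metis compact_Icc image_eqI)
  have S: "(\<lambda>n. complex_of_real (2 * Si (real n * u))) \<longlonglongrightarrow> of_real pi * of_real (sgn u)" for u
    using tendsto_of_real[OF tendsto_mult[OF tendsto_const[of 2] Si_limit[of u]]] by simp
  have "(\<lambda>n. integral {a..b} (\<lambda>y. f' y * of_real (2 * Si (real n * (y - z))))) \<longlonglongrightarrow>
     integral {a..b} (\<lambda>y. f' y * (of_real pi * of_real (sgn (y - z))))"
  proof (rule dominated_convergence(2))
    show "(\<lambda>y. f' y * of_real (2 * Si (real n * (y - z)))) integrable_on {a..b}" for n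
      by (intro integrable_continuous_real continuous_intros f')
    show "(\<lambda>y. M * (2 * B)) integrable_on {a..b}" by (rule integrable_const_ivl)
    show "norm (f' y * of_real (2 * Si (real n * (y - z)))) \<le> M * (2 * B)" if "y \<in> {a..b}" for n y
      unfolding norm_mult norm_of_real
      using B M[OF that] by (intro mult_mono order_trans[OF norm_ge_zero M[OF that]]) (auto simp: abs_mult)
    show "(\<lambda>n. f' y * of_real (2 * Si (real n * (y - z)))) \<longlonglongrightarrow> f' y * (of_real pi * of_real (sgn (y - z)))" for y
      by (intro tendsto_mult tendsto_const S)
  qed
  also have "integral {a..b} (\<lambda>y. f' y * (of_real pi * of_real (sgn (y - z)))) = of_real pi *
      (f b * of_real (sgn (b - z)) - f a * of_real (sgn (a - z)) - f z * of_real (sgn (z - a) + sgn (b - z)))"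
    using has_integral_mult_right[OF sgn_weighted_integral[OF assms(1) f], of "of_real pi" z]
    by (intro integral_unique) (simp add: mult_ac)
  finally have I: "(\<lambda>n. integral {a..b} (\<lambda>y. f' y * of_real (2 * Si (real n * (y - z))))) \<longlonglongrightarrow>
     of_real pi * (f b * of_real (sgn (b - z)) - f a * of_real (sgn (a - z)) - f z * of_real (sgn (z - a) + sgn (b - z)))" .
  have "(\<lambda>n. f b * of_real (2 * Si (real n * (b - z))) - f a * of_real (2 * Si (real n * (a - z)))
     - integral {a..b} (\<lambda>y. f' y * of_real (2 * Si (real n * (y - z))))) \<longlonglongrightarrow>
     f b * (of_real pi * of_real (sgn (b - z))) - f a * (of_real pi * of_real (sgn (a - z))) -
     of_real pi * (f b * of_real (sgn (b - z)) - f a * of_real (sgn (a - z)) - f z * of_real (sgn (z - a) + sgn (b - z)))"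
    by (intro tendsto_diff tendsto_mult tendsto_const S I)
  moreover have "integral {-real n..real n} (\<lambda>k. cis (k * z) * integral {a..b} (\<lambda>y. cis (- (k * y)) * f y))
     = f b * of_real (2 * Si (real n * (b - z))) - f a * of_real (2 * Si (real n * (a - z)))
     - integral {a..b} (\<lambda>y. f' y * of_real (2 * Si (real n * (y - z))))" for n
    by (rule truncated_inversion_interval[OF assms(1) _ f f']) auto
  ultimately show ?thesis by (simp only:) (simp add: algebra_simps)
qed

text \<open>The bound depends neither on the cut-off nor on the base point, as dominated convergence requires.\<close>

lemma truncated_inversion_interval_bound:
  assumes "a \<le> b" "A \<ge> 0" and f: "\<And>y. y \<in> {a..b} \<Longrightarrow> (f has_vector_derivative f' y) (at y within {a..b})"
    and f': "continuous_on {a..b} f'"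
    and B: "\<And>u. \<bar>Si u\<bar> \<le> B" and M: "\<And>y. y \<in> {a..b} \<Longrightarrow> norm (f y) \<le> M \<and> norm (f' y) \<le> M"
  shows "norm (integral {-A..A} (\<lambda>k. cis (k * z) * integral {a..b} (\<lambda>y. cis (- (k * y)) * f y)))
    \<le> 2 * B * M * (2 + (b - a))"
proof -
  have M0: "M \<ge> 0" using order_trans[OF norm_ge_zero] M[of a] assms(1) by auto
  have S: "norm (w * complex_of_real (2 * Si u)) \<le> M * (2 * B)" if "norm w \<le> M" for w u
    unfolding norm_mult norm_of_real using B[of u] that M0 by (intro mult_mono) (auto simp: abs_mult)
  have "norm (integral {a..b} (\<lambda>y. f' y * of_real (2 * Si (A * (y - z))))) \<le> M * (2 * B) * (b - a)"
    using assms(1) M by (intro integral_bound S) (auto intro!: continuous_intros f')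
  moreover have "norm (f b * of_real (2 * Si (A * (b - z)))) \<le> M * (2 * B)"
    by (rule S) (use M assms(1) in auto)
  moreover have "norm (f a * of_real (2 * Si (A * (a - z)))) \<le> M * (2 * B)"
    by (rule S) (use M assms(1) in auto)
  ultimately have "norm (f b * of_real (2 * Si (A * (b - z))) - f a * of_real (2 * Si (A * (a - z)))
     - integral {a..b} (\<lambda>y. f' y * of_real (2 * Si (A * (y - z))))) \<le> M * (2 * B) + M * (2 * B) + M * (2 * B) * (b - a)"
    by (intro order_trans[OF norm_triangle_ineq4] add_mono) auto
  moreover have "integral {-A..A} (\<lambda>k. cis (k * z) * integral {a..b} (\<lambda>y. cis (- (k * y)) * f y))
     = f b * of_real (2 * Si (A * (b - z))) - f a * of_real (2 * Si (A * (a - z)))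
     - integral {a..b} (\<lambda>y. f' y * of_real (2 * Si (A * (y - z))))"
    by (rule truncated_inversion_interval[OF assms(1-2) f f']) auto
  ultimately show ?thesis by (simp only:) (simp add: algebra_simps)
qed

section \<open>Inversion on the half-line\<close>

lemma half_line_fourier_cis: "half_line_fourier g k = integral {0..} (\<lambda>y. cis (- (k * y)) * g y)"
  unfolding half_line_fourier_def by (simp add: cis_conv_exp mult.assoc)

lemma decaying_cis: "decaying g \<Longrightarrow> decaying (\<lambda>y. cis (- (k * y)) * g y)"
  using decaying_mult_bounded[of g "\<lambda>y. cis (- (k * y))" 1] by (simp add: mult.commute continuous_intros)

lemma half_line_fourier_limit:
  assumes "decaying g"
  shows "(\<lambda>n. integral {0..real n} (\<lambda>y. cis (- (k * y)) * g y)) \<longlonglongrightarrow> half_line_fourier g k"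
  unfolding half_line_fourier_cis by (rule decaying_integral_limit[OF decaying_cis[OF assms]])

lemma truncated_fourier_bound:
  assumes "decaying g"
  shows "norm (integral {0..real n} (\<lambda>y. cis (- (k * y)) * g y)) \<le> integral {0..} (\<lambda>y. norm (g y))"
proof -
  have c: "continuous_on {0..real n} g"
    using assms unfolding decaying_def by (auto intro: continuous_on_subset)
  have "norm (integral {0..real n} (\<lambda>y. cis (- (k * y)) * g y)) \<le> integral {0..real n} (\<lambda>y. norm (g y))"
    by (intro Henstock_Kurzweil_Integration.integral_norm_bound_integral integrable_continuous_real continuous_intros c)
      (simp add: norm_mult)
  also have "\<dots> \<le> integral {0..} (\<lambda>y. norm (g y))"
    by (intro integral_subset_le integrable_continuous_real continuous_intros c decaying_integrable[OF assms]) auto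
  finally show ?thesis .
qed

lemma continuous_on_half_line_fourier:
  assumes "decaying g"
  shows "continuous_on S (half_line_fourier g)"
proof -
  obtain C where C: "C \<ge> 0" "\<And>x. x \<ge> 0 \<Longrightarrow> norm (g x) \<le> C * majorant x" using decayingE[OF assms] by blast
  show ?thesis
    unfolding half_line_fourier_cis
  proof (rule continuous_on_sequentiallyI)
    fix u a assume u: "u \<longlonglongrightarrow> (a::real)"
    show "(\<lambda>n. integral {0..} (\<lambda>y. cis (- (u n * y)) * g y)) \<longlonglongrightarrow> integral {0..} (\<lambda>y. cis (- (a * y)) * g y)"
    proof (rule dominated_convergence(2))
      show "(\<lambda>y. cis (- (u n * y)) * g y) integrable_on {0..}" for n
        by (rule decaying_integrable(1)[OF decaying_cis[OF assms]])
      show "(\<lambda>x. C * majorant x) integrable_on {0..}"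
        using integrable_cmul[OF majorant_integrable, of C] by simp
      show "norm (cis (- (u n * y)) * g y) \<le> C * majorant y" if "y \<in> {0..}" for n y
        using C that by (simp add: norm_mult)
      show "(\<lambda>n. cis (- (u n * y)) * g y) \<longlonglongrightarrow> cis (- (a * y)) * g y" for y
        unfolding cis_conv_exp by (intro tendsto_intros u)
    qed
  qed
qed

text \<open>The formula for \<open>[0, n]\<close> in the limit of large \<open>n\<close>.\<close>

lemma truncated_inversion_half_line:
  assumes g: "decaying g" "decaying g'" "\<And>y. y \<ge> 0 \<Longrightarrow> (g has_vector_derivative g' y) (at y within {0..})"
    and A: "A \<ge> 0"
  shows "integral {-A..A} (\<lambda>k. cis (k * z) * half_line_fourier g k) =
    - g 0 * of_real (2 * Si (A * (0 - z))) - integral {0..} (\<lambda>y. g' y * of_real (2 * Si (A * (y - z))))"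
proof (rule LIMSEQ_unique)
  let ?L = "\<lambda>n. integral {-A..A} (\<lambda>k. cis (k * z) * integral {0..real n} (\<lambda>y. cis (- (k * y)) * g y))"
  obtain B where B: "B \<ge> 0" "\<And>u. \<bar>Si u\<bar> \<le> B" using Si_bound by blast
  have c: "continuous_on {0..real n} g" "continuous_on {0..real n} g'" for n
    using g unfolding decaying_def by (auto intro: continuous_on_subset)
  have ci: "continuous_on S (\<lambda>k. integral {0..real n} (\<lambda>y. cis (- (k * y)) * g y))" for n and S :: "real set"
    by (rule continuous_on_parameter_integral)
      (intro continuous_intros continuous_on_compose2[OF c(1)], auto)
  show "?L \<longlonglongrightarrow> integral {-A..A} (\<lambda>k. cis (k * z) * half_line_fourier g k)"
  proof (rule dominated_convergence(2))
    show "(\<lambda>k. cis (k * z) * integral {0..real n} (\<lambda>y. cis (- (k * y)) * g y)) integrable_on {-A..A}" for n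
      by (intro integrable_continuous_real continuous_intros ci)
    show "(\<lambda>k. integral {0..} (\<lambda>y. norm (g y))) integrable_on {-A..A}" by (rule integrable_const_ivl)
    show "norm (cis (k * z) * integral {0..real n} (\<lambda>y. cis (- (k * y)) * g y)) \<le> integral {0..} (\<lambda>y. norm (g y))" for n k
      using truncated_fourier_bound[OF g(1)] by (simp add: norm_mult)
    show "(\<lambda>n. cis (k * z) * integral {0..real n} (\<lambda>y. cis (- (k * y)) * g y)) \<longlonglongrightarrow> cis (k * z) * half_line_fourier g k" for k
      by (intro tendsto_mult tendsto_const half_line_fourier_limit g)
  qed
  have "?L n = g (real n) * of_real (2 * Si (A * (real n - z))) - g 0 * of_real (2 * Si (A * (0 - z)))
      - integral {0..real n} (\<lambda>y. g' y * of_real (2 * Si (A * (y - z))))" for n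
    by (rule truncated_inversion_interval[OF _ A _ c(2)])
      (auto intro!: has_vector_derivative_within_subset[OF g(3)])
  moreover have "(\<lambda>n. g (real n) * of_real (2 * Si (A * (real n - z))) - g 0 * of_real (2 * Si (A * (0 - z)))
      - integral {0..real n} (\<lambda>y. g' y * of_real (2 * Si (A * (y - z))))) \<longlonglongrightarrow>
      0 - g 0 * of_real (2 * Si (A * (0 - z))) - integral {0..} (\<lambda>y. g' y * of_real (2 * Si (A * (y - z))))"
  proof (intro tendsto_diff tendsto_const)
    have b: "norm (complex_of_real (2 * Si u)) \<le> 2 * B" for u
      using B(2)[of u] unfolding norm_of_real by (simp add: abs_mult)
    show "(\<lambda>n. g (real n) * of_real (2 * Si (A * (real n - z)))) \<longlonglongrightarrow> 0"
      by (rule decaying_at_infinity[of "\<lambda>y. g y * of_real (2 * Si (A * (y - z)))"])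
        (intro decaying_mult_bounded[OF g(1) _ b] continuous_intros)
    show "(\<lambda>n. integral {0..real n} (\<lambda>y. g' y * of_real (2 * Si (A * (y - z))))) \<longlonglongrightarrow>
        integral {0..} (\<lambda>y. g' y * of_real (2 * Si (A * (y - z))))"
      by (intro decaying_integral_limit decaying_mult_bounded[OF g(2) _ b] continuous_intros)
  qed
  ultimately show "?L \<longlonglongrightarrow> - g 0 * of_real (2 * Si (A * (0 - z))) - integral {0..} (\<lambda>y. g' y * of_real (2 * Si (A * (y - z))))"
    by (simp only:) simp
qed

lemma truncated_inversion_half_line_bound:
  assumes g: "decaying g" "decaying g'" "\<And>y. y \<ge> 0 \<Longrightarrow> (g has_vector_derivative g' y) (at y within {0..})"
  obtains M where "\<And>A z. A \<ge> 0 \<Longrightarrow> norm (integral {-A..A} (\<lambda>k. cis (k * z) * half_line_fourier g k)) \<le> M"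
proof -
  obtain B where B: "B \<ge> 0" "\<And>u. \<bar>Si u\<bar> \<le> B" using Si_bound by blast
  have b: "norm (complex_of_real (2 * Si u)) \<le> 2 * B" for u
    using B(2)[of u] unfolding norm_of_real by (simp add: abs_mult)
  let ?M = "norm (g 0) * (2 * B) + integral {0..} (\<lambda>y. norm (g' y) * (2 * B))"
  have "norm (integral {-A..A} (\<lambda>k. cis (k * z) * half_line_fourier g k)) \<le> ?M" if "A \<ge> 0" for A z
  proof -
    have "norm (- g 0 * of_real (2 * Si (A * (0 - z)))) \<le> norm (g 0) * (2 * B)"
      unfolding norm_mult norm_minus_cancel using b by (intro mult_left_mono) auto
    moreover have "norm (integral {0..} (\<lambda>y. g' y * of_real (2 * Si (A * (y - z))))) \<le> integral {0..} (\<lambda>y. norm (g' y) * (2 * B))"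
    proof (rule Henstock_Kurzweil_Integration.integral_norm_bound_integral)
      show "(\<lambda>y. g' y * of_real (2 * Si (A * (y - z)))) integrable_on {0..}"
        by (intro decaying_integrable(1) decaying_mult_bounded[OF g(2) _ b] continuous_intros)
      show "(\<lambda>y. norm (g' y) * (2 * B)) integrable_on {0..}"
        using integrable_cmul[OF decaying_integrable(2)[OF g(2)], of "2 * B"] by (simp add: mult.commute)
      show "norm (g' y * of_real (2 * Si (A * (y - z)))) \<le> norm (g' y) * (2 * B)" for y
        unfolding norm_mult[of "g' y"] using b by (intro mult_left_mono) auto
    qed
    moreover have "integral {-A..A} (\<lambda>k. cis (k * z) * half_line_fourier g k) =
        - g 0 * of_real (2 * Si (A * (0 - z))) - integral {0..} (\<lambda>y. g' y * of_real (2 * Si (A * (y - z))))"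
      by (rule truncated_inversion_half_line[OF g that])
    ultimately show ?thesis
      by (simp only:) (rule order_trans[OF norm_triangle_ineq4 add_mono])
  qed
  then show ?thesis using that by blast
qed

lemma sgn_weighted_half_line_integral:
  assumes g: "decaying g" "decaying g'" "\<And>y. y \<ge> 0 \<Longrightarrow> (g has_vector_derivative g' y) (at y within {0..})"
  shows "((\<lambda>y. g' y * of_real (sgn (y - z))) has_integral
    - g 0 * of_real (sgn (0 - z)) - g z * of_real (sgn z + 1)) {0..}"
proof -
  have ftc: "(g' has_integral g b - g 0) {0..b}" if "b \<ge> 0" for b
    using that by (intro fundamental_theorem_of_calculus) (auto intro!: has_vector_derivative_within_subset[OF g(3)])
  have all: "(g' has_integral - g 0) {0..}"
  proof -
    have "(\<lambda>n. integral {0..real n} g') \<longlonglongrightarrow> 0 - g 0"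
      using tendsto_diff[OF decaying_at_infinity[OF g(1)] tendsto_const] integral_unique[OF ftc] by simp
    then have "integral {0..} g' = - g 0"
      using decaying_integral_limit[OF g(2)] LIMSEQ_unique by fastforce
    then show ?thesis using decaying_integrable(1)[OF g(2)] by (simp add: has_integral_iff)
  qed
  show ?thesis
  proof (cases "z \<le> 0")
    case True
    have "((\<lambda>y. g' y * of_real (sgn (y - z))) has_integral - g 0) {0..}"
      by (rule has_integral_spike_finite[OF _ _ all, of "{z}"]) (use True in auto)
    then show ?thesis using True by (cases "z = 0") auto
  next
    case False
    have "((\<lambda>y. if y \<in> {0..z} then g' y else 0) has_integral g z - g 0) {0..}"
      using ftc[of z] False by (subst has_integral_restrict) auto
    from has_integral_diff[OF all has_integral_mult_right[OF this, of 2]]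
    have i: "((\<lambda>y. g' y - 2 * (if y \<in> {0..z} then g' y else 0)) has_integral - g 0 - 2 * (g z - g 0)) {0..}" .
    have "((\<lambda>y. g' y * of_real (sgn (y - z))) has_integral - g 0 - 2 * (g z - g 0)) {0..}"
      by (rule has_integral_spike_finite[OF _ _ i, of "{z}"]) auto
    then show ?thesis using False by (simp add: algebra_simps)
  qed
qed

text \<open>At the jump in the origin the continuation by zero takes the mean of the one-sided limits, which is the value
  that Fourier inversion produces there.\<close>

definition half_line_extension :: "(real \<Rightarrow> complex) \<Rightarrow> real \<Rightarrow> complex" where
  "half_line_extension g z = of_real ((sgn z + 1) / 2) * g z"

lemma inversion_half_line:
  assumes g: "decaying g" "decaying g'" "\<And>y. y \<ge> 0 \<Longrightarrow> (g has_vector_derivative g' y) (at y within {0..})"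
  shows "(\<lambda>n. integral {-real n..real n} (\<lambda>k. cis (k * z) * half_line_fourier g k))
    \<longlonglongrightarrow> 2 * of_real pi * half_line_extension g z"
proof -
  obtain B where B: "B \<ge> 0" "\<And>u. \<bar>Si u\<bar> \<le> B" using Si_bound by blast
  have b: "norm (complex_of_real (2 * Si u)) \<le> 2 * B" for u
    using B(2)[of u] unfolding norm_of_real by (simp add: abs_mult)
  have S: "(\<lambda>n. complex_of_real (2 * Si (real n * u))) \<longlonglongrightarrow> of_real pi * of_real (sgn u)" for u
    using tendsto_of_real[OF tendsto_mult[OF tendsto_const[of 2] Si_limit[of u]]] by simp
  have "(\<lambda>n. integral {0..} (\<lambda>y. g' y * of_real (2 * Si (real n * (y - z))))) \<longlonglongrightarrow>
     integral {0..} (\<lambda>y. g' y * (of_real pi * of_real (sgn (y - z))))"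
  proof (rule dominated_convergence(2))
    show "(\<lambda>y. g' y * of_real (2 * Si (real n * (y - z)))) integrable_on {0..}" for n
      by (intro decaying_integrable(1) decaying_mult_bounded[OF g(2) _ b] continuous_intros)
    show "(\<lambda>y. norm (g' y) * (2 * B)) integrable_on {0..}"
      using integrable_cmul[OF decaying_integrable(2)[OF g(2)], of "2 * B"] by (simp add: mult.commute)
    show "norm (g' y * of_real (2 * Si (real n * (y - z)))) \<le> norm (g' y) * (2 * B)" for n y
      unfolding norm_mult[of "g' y"] using b by (intro mult_left_mono) auto
    show "(\<lambda>n. g' y * of_real (2 * Si (real n * (y - z)))) \<longlonglongrightarrow> g' y * (of_real pi * of_real (sgn (y - z)))" for y
      by (intro tendsto_mult tendsto_const S)
  qed
  also have "integral {0..} (\<lambda>y. g' y * (of_real pi * of_real (sgn (y - z)))) = of_real pi *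
      (- g 0 * of_real (sgn (0 - z)) - g z * of_real (sgn z + 1))"
    using has_integral_mult_right[OF sgn_weighted_half_line_integral[OF g], of "of_real pi" z]
    by (intro integral_unique) (simp add: mult_ac)
  finally have I: "(\<lambda>n. integral {0..} (\<lambda>y. g' y * of_real (2 * Si (real n * (y - z))))) \<longlonglongrightarrow>
     of_real pi * (- g 0 * of_real (sgn (0 - z)) - g z * of_real (sgn z + 1))" .
  have "(\<lambda>n. - g 0 * of_real (2 * Si (real n * (0 - z))) - integral {0..} (\<lambda>y. g' y * of_real (2 * Si (real n * (y - z)))))
     \<longlonglongrightarrow> - g 0 * (of_real pi * of_real (sgn (0 - z))) - of_real pi * (- g 0 * of_real (sgn (0 - z)) - g z * of_real (sgn z + 1))"
    by (intro tendsto_diff tendsto_mult tendsto_const S I)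
  moreover have "integral {-real n..real n} (\<lambda>k. cis (k * z) * half_line_fourier g k) =
    - g 0 * of_real (2 * Si (real n * (0 - z))) - integral {0..} (\<lambda>y. g' y * of_real (2 * Si (real n * (y - z))))" for n
    by (rule truncated_inversion_half_line[OF g]) auto
  moreover have "- g 0 * (of_real pi * of_real (sgn (0 - z))) - of_real pi * (- g 0 * of_real (sgn (0 - z)) - g z * of_real (sgn z + 1))
    = 2 * of_real pi * half_line_extension g z"
    by (simp add: half_line_extension_def algebra_simps)
  ultimately show ?thesis by (simp only:)
qed

section \<open>Multipliers acting on the data\<close>

lemma symbol_cis:
  "symbol \<alpha> \<beta> \<kappa> k s = \<alpha> * cis (k * s) + \<beta> * cis (- (k * s)) +
     of_real s * integral {-1..1} (\<lambda>r. \<kappa> (s * r) s * cis (- (k * (s * r))))"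
  unfolding symbol_def by (simp add: cis_conv_exp)

lemma continuous_on_kernel:
  assumes "continuous_on UNIV (\<lambda>p. \<kappa> (fst p) (snd p))" "continuous_on S f" "continuous_on S h"
  shows "continuous_on S (\<lambda>x. (\<kappa> :: real \<Rightarrow> real \<Rightarrow> complex) (f x) (h x))"
  using continuous_on_compose2[OF assms(1) continuous_on_Pair[OF assms(2,3)]] by simp

lemma continuous_on_symbol:
  fixes f h :: "'a::topological_space \<Rightarrow> real"
  assumes \<kappa>: "continuous_on UNIV (\<lambda>p. \<kappa> (fst p) (snd p))"
    and "continuous_on S f" "continuous_on S h"
  shows "continuous_on S (\<lambda>x. symbol \<alpha> \<beta> \<kappa> (f x) (h x))"
proof -
  have "continuous_on S (\<lambda>x. integral {-1..1} (\<lambda>r. \<kappa> (h x * r) (h x) * cis (- (f x * (h x * r)))))"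
    by (rule continuous_on_parameter_integral)
      (intro continuous_intros continuous_on_kernel[OF \<kappa>]
        continuous_on_compose2[OF assms(2)] continuous_on_compose2[OF assms(3)], auto)
  then show ?thesis unfolding symbol_cis by (intro continuous_intros assms)
qed

text \<open>Multiplication of \<open>half_line_fourier g\<close> by a symbol becomes translation by \<open>\<plusminus> t\<close> and convolution
  with the kernel. Inverting under the convolution integral is legitimate because the truncated
  inversions are bounded uniformly in the cut-off and the base point.\<close>

lemma symbol_inversion_half_line:
  assumes g: "decaying g" "decaying g'" "\<And>y. y \<ge> 0 \<Longrightarrow> (g has_vector_derivative g' y) (at y within {0..})"
    and \<kappa>: "continuous_on UNIV (\<lambda>p. \<kappa> (fst p) (snd p))"
  shows "(\<lambda>n. integral {-real n..real n} (\<lambda>k. cis (k * x) * symbol \<alpha> \<beta> \<kappa> k t * half_line_fourier g k))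
    \<longlonglongrightarrow> 2 * of_real pi * (\<alpha> * half_line_extension g (x + t) + \<beta> * half_line_extension g (x - t)
      + of_real t * integral {-1..1} (\<lambda>r. \<kappa> (t * r) t * half_line_extension g (x - t * r)))"
proof -
  let ?D = "\<lambda>n z. integral {-real n..real n} (\<lambda>k. cis (k * z) * half_line_fourier g k)"
  have D: "(\<lambda>n. ?D n z) \<longlonglongrightarrow> 2 * of_real pi * half_line_extension g z" for z
    by (rule inversion_half_line[OF g])
  obtain M where M: "\<And>A z. A \<ge> 0 \<Longrightarrow> norm (integral {-A..A} (\<lambda>k. cis (k * z) * half_line_fourier g k)) \<le> M"
    using truncated_inversion_half_line_bound[OF g] by blast
  note cg = continuous_on_half_line_fourier[OF g(1)]
  have cg': "continuous_on S (\<lambda>x. half_line_fourier g (f x))" if "continuous_on S f" for S and f :: "real \<times> real \<Rightarrow> real"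
    by (rule continuous_on_compose2[OF cg[of UNIV] that]) auto
  have c\<kappa>: "continuous_on {-1..1} (\<lambda>r. \<kappa> (t * r) t)"
    by (intro continuous_on_kernel[OF \<kappa>] continuous_intros)
  have cD: "continuous_on S (\<lambda>r. ?D n (x - t * r))" for n S
    by (rule continuous_on_parameter_integral) (intro continuous_intros cg')
  have split: "integral {-real n..real n} (\<lambda>k. cis (k * x) * symbol \<alpha> \<beta> \<kappa> k t * half_line_fourier g k)
      = \<alpha> * ?D n (x + t) + \<beta> * ?D n (x - t) + of_real t * integral {-1..1} (\<lambda>r. \<kappa> (t * r) t * ?D n (x - t * r))" for n
  proof -
    let ?I = "{-real n..real n}"
    let ?c = "\<lambda>k. integral {-1..1} (\<lambda>r. \<kappa> (t * r) t * (cis (k * (x - t * r)) * half_line_fourier g k))"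
    have cc: "continuous_on ?I ?c"
      by (rule continuous_on_parameter_integral)
        (intro continuous_intros continuous_on_kernel[OF \<kappa>] cg')
    have "cis (k * x) * symbol \<alpha> \<beta> \<kappa> k t * half_line_fourier g k =
        \<alpha> * (cis (k * (x + t)) * half_line_fourier g k) + \<beta> * (cis (k * (x - t)) * half_line_fourier g k)
        + of_real t * ?c k" for k
    proof -
      have "cis (k * x) * half_line_fourier g k * integral {-1..1} (\<lambda>r. \<kappa> (t * r) t * cis (- (k * (t * r)))) = ?c k"
      proof -
        have "cis (k * (x - t * r)) = cis (k * x) * cis (- (k * (t * r)))" for r
          by (simp add: cis_mult right_diff_distrib)
        then show ?thesis unfolding integral_mult_right[symmetric] by (simp only: mult_ac)
      qed
      moreover have "cis (k * (x + t)) = cis (k * x) * cis (k * t)" "cis (k * (x - t)) = cis (k * x) * cis (- (k * t))"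
        by (simp_all add: cis_mult algebra_simps)
      ultimately show ?thesis unfolding symbol_cis by (simp add: algebra_simps)
    qed
    moreover have "((\<lambda>k. \<alpha> * (cis (k * (x + t)) * half_line_fourier g k) + \<beta> * (cis (k * (x - t)) * half_line_fourier g k)
        + of_real t * ?c k) has_integral \<alpha> * ?D n (x + t) + \<beta> * ?D n (x - t) + of_real t * integral ?I ?c) ?I"
      by (intro has_integral_add has_integral_mult_right integrable_integral integrable_continuous_real
          continuous_intros cg cc)
    moreover have "integral ?I ?c = integral {-1..1} (\<lambda>r. integral ?I (\<lambda>k. \<kappa> (t * r) t * (cis (k * (x - t * r)) * half_line_fourier g k)))"
      by (rule swap_integrals) (intro continuous_intros continuous_on_kernel[OF \<kappa>] cg')
    ultimately show ?thesis by (simp add: integral_unique)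
  qed
  obtain N where N: "\<And>r. r \<in> {-1..1} \<Longrightarrow> norm (\<kappa> (t * r) t) \<le> N"
    using compact_continuous_image[OF c\<kappa>] compact_imp_bounded bounded_iff by (metis compact_Icc image_eqI)
  have "(\<lambda>n. integral {-1..1} (\<lambda>r. \<kappa> (t * r) t * ?D n (x - t * r))) \<longlonglongrightarrow>
      integral {-1..1} (\<lambda>r. \<kappa> (t * r) t * (2 * of_real pi * half_line_extension g (x - t * r)))"
  proof (rule dominated_convergence(2))
    show "(\<lambda>r. \<kappa> (t * r) t * ?D n (x - t * r)) integrable_on {-1..1}" for n
      by (intro integrable_continuous_real continuous_on_mult c\<kappa> cD)
    show "(\<lambda>r::real. N * M) integrable_on {-1..1}" by (rule integrable_const_ivl)
    show "norm (\<kappa> (t * r) t * ?D n (x - t * r)) \<le> N * M" if "r \<in> {-1..1}" for n r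
      unfolding norm_mult using N[OF that] M[of "real n" "x - t * r"]
      by (intro mult_mono order_trans[OF norm_ge_zero N[OF that]]) auto
    show "(\<lambda>n. \<kappa> (t * r) t * ?D n (x - t * r)) \<longlonglongrightarrow> \<kappa> (t * r) t * (2 * of_real pi * half_line_extension g (x - t * r))" for r
      by (intro tendsto_mult_left D)
  qed
  moreover have "integral {-1..1} (\<lambda>r. \<kappa> (t * r) t * (2 * of_real pi * half_line_extension g (x - t * r)))
     = 2 * of_real pi * integral {-1..1} (\<lambda>r. \<kappa> (t * r) t * half_line_extension g (x - t * r))"
    unfolding integral_mult_right[symmetric] by (intro integral_cong) (simp add: mult_ac)
  ultimately have J: "(\<lambda>n. integral {-1..1} (\<lambda>r. \<kappa> (t * r) t * ?D n (x - t * r))) \<longlonglongrightarrow>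
      2 * of_real pi * integral {-1..1} (\<lambda>r. \<kappa> (t * r) t * half_line_extension g (x - t * r))" by simp
  have "(\<lambda>n. \<alpha> * ?D n (x + t) + \<beta> * ?D n (x - t) + of_real t * integral {-1..1} (\<lambda>r. \<kappa> (t * r) t * ?D n (x - t * r)))
    \<longlonglongrightarrow> \<alpha> * (2 * of_real pi * half_line_extension g (x + t)) + \<beta> * (2 * of_real pi * half_line_extension g (x - t))
      + of_real t * (2 * of_real pi * integral {-1..1} (\<lambda>r. \<kappa> (t * r) t * half_line_extension g (x - t * r)))"
    by (intro tendsto_add tendsto_mult_left D J)
  then show ?thesis unfolding split by (simp add: algebra_simps)
qed

lemma symbol_kernel_interval:
  assumes \<kappa>: "continuous_on UNIV (\<lambda>p. \<kappa> (fst p) (snd p))" and s: "s \<ge> 0"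
  shows "symbol 0 0 \<kappa> k s = integral {-s..s} (\<lambda>u. cis (- (k * u)) * \<kappa> u s)"
proof -
  have "of_real s * integral {-1..1} (\<lambda>r. (\<lambda>u. cis (- (k * u)) * \<kappa> u s) (0 + s * r)) =
      integral {0 + s * (-1)..0 + s * 1} (\<lambda>u. cis (- (k * u)) * \<kappa> u s)"
    by (rule integral_rescale) (use s in \<open>auto intro!: continuous_intros continuous_on_kernel[OF \<kappa>]\<close>)
  then show ?thesis unfolding symbol_cis by (simp add: mult.commute)
qed

text \<open>The mass \<open>\<beta>\<close> transports the boundary datum to the right, whereas the wave of the mass \<open>\<alpha>\<close> travels to the
  left and never meets a point \<open>x > 0\<close>. For the density, each time \<open>y\<close> contributes a truncated inversion on
  \<open>[- (t - y), t - y]\<close> at \<open>x\<close>, and the uniform bound allows the limit under the integral in \<open>y\<close>.\<close>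

lemma symbol_inversion_interval:
  assumes t: "0 < t" and x: "0 < x" "x \<noteq> t"
    and h: "\<And>y. y \<in> {0..t} \<Longrightarrow> (h has_vector_derivative h' y) (at y within {0..t})" "continuous_on {0..t} h'"
    and \<kappa>: "continuous_on UNIV (\<lambda>p. \<kappa> (fst p) (snd p))" "continuous_on UNIV (\<lambda>p. \<kappa>' (fst p) (snd p))"
      "\<And>u s. ((\<lambda>u. \<kappa> u s) has_vector_derivative \<kappa>' u s) (at u)"
  shows "(\<lambda>n. integral {-real n..real n} (\<lambda>k. cis (k * x) * integral {0..t} (\<lambda>y. h y * symbol \<alpha> \<beta> \<kappa> k (t - y))))
    \<longlonglongrightarrow> (if x < t then 2 * of_real pi * (\<beta> * h (t - x) + integral {0..t - x} (\<lambda>y. h y * \<kappa> x (t - y))) else 0)"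
proof -
  have ch: "continuous_on {0..t} h"
    unfolding continuous_on_eq_continuous_within using h has_vector_derivative_continuous by blast
  have ch2: "continuous_on S (\<lambda>p. h (f p))" if "continuous_on S f" "\<And>p. p \<in> S \<Longrightarrow> f p \<in> {0..t}"
    for S and f :: "'b::topological_space \<Rightarrow> real"
    using continuous_on_compose2[OF ch that(1)] that(2) by blast
  let ?I = "\<lambda>n. {-real n..real n}"
  let ?F = "\<lambda>k. integral {0..t} (\<lambda>y. cis (- (k * y)) * h y)" and ?F' = "\<lambda>k. integral {0..t} (\<lambda>y. cis (k * y) * h y)"
  let ?T = "\<lambda>n z. integral (?I n) (\<lambda>k. cis (k * z) * ?F k)"
  let ?K = "integral {0..t - x} (\<lambda>y. h y * \<kappa> x (t - y))"
  let ?q = "\<lambda>y. h y * (of_real pi * of_real (sgn (x - (- (t - y))) + sgn (t - y - x)) * \<kappa> x (t - y))"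
  let ?M = "\<lambda>n s. integral (?I n) (\<lambda>k. cis (k * x) * symbol 0 0 \<kappa> k s)"
  have T: "(\<lambda>n. ?T n z) \<longlonglongrightarrow> of_real pi * of_real (sgn (z - 0) + sgn (t - z)) * h z" for z
    by (rule inversion_interval[OF _ h]) (use t in auto)
  have cF: "continuous_on S (\<lambda>k. ?F k)" for S
    by (rule continuous_on_parameter_integral) (intro continuous_intros ch2; auto)
  have cF': "continuous_on S (\<lambda>k. ?F' k)" for S
    by (rule continuous_on_parameter_integral) (intro continuous_intros ch2; auto)
  have cS: "continuous_on S (\<lambda>k. integral {0..t} (\<lambda>y. cis (k * x) * (h y * symbol 0 0 \<kappa> k (t - y))))" for S
    by (rule continuous_on_parameter_integral) (intro continuous_intros continuous_on_symbol[OF \<kappa>(1)] ch2; auto)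
  have split: "integral (?I n) (\<lambda>k. cis (k * x) * integral {0..t} (\<lambda>y. h y * symbol \<alpha> \<beta> \<kappa> k (t - y)))
      = \<alpha> * ?T n (x + t) + \<beta> * ?T n (t - x) + integral {0..t} (\<lambda>y. h y * ?M n (t - y))" for n
  proof -
    let ?J = "\<lambda>k. integral {0..t} (\<lambda>y. cis (k * x) * (h y * symbol 0 0 \<kappa> k (t - y)))"
    have "cis (k * x) * integral {0..t} (\<lambda>y. h y * symbol \<alpha> \<beta> \<kappa> k (t - y)) =
       \<alpha> * (cis (k * (x + t)) * ?F k)
       + \<beta> * (cis (k * (x - t)) * ?F' k) + ?J k" for k
    proof -
      have "((\<lambda>y. \<alpha> * (cis (k * (x + t)) * (cis (- (k * y)) * h y)) + \<beta> * (cis (k * (x - t)) * (cis (k * y) * h y))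
           + cis (k * x) * (h y * symbol 0 0 \<kappa> k (t - y))) has_integral
         \<alpha> * (cis (k * (x + t)) * ?F k)
           + \<beta> * (cis (k * (x - t)) * ?F' k) + ?J k) {0..t}"
        by (intro has_integral_add has_integral_mult_right integrable_integral integrable_continuous_real
            continuous_intros ch continuous_on_symbol[OF \<kappa>(1)])
      moreover have "\<alpha> * (cis (k * (x + t)) * (cis (- (k * y)) * h y)) + \<beta> * (cis (k * (x - t)) * (cis (k * y) * h y))
           + cis (k * x) * (h y * symbol 0 0 \<kappa> k (t - y)) = cis (k * x) * (h y * symbol \<alpha> \<beta> \<kappa> k (t - y))" for y
      proof -
        have "cis (k * (x + t)) * cis (- (k * y)) = cis (k * x) * cis (k * (t - y))"
          "cis (k * (x - t)) * cis (k * y) = cis (k * x) * cis (- (k * (t - y)))"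
          by (simp_all add: cis_mult algebra_simps)
        then have "\<alpha> * (cis (k * (x + t)) * (cis (- (k * y)) * h y)) + \<beta> * (cis (k * (x - t)) * (cis (k * y) * h y))
            = cis (k * x) * (h y * (\<alpha> * cis (k * (t - y)) + \<beta> * cis (- (k * (t - y)))))"
          by (simp add: distrib_left mult.assoc[symmetric])
        then show ?thesis unfolding symbol_cis by (simp add: distrib_left mult.assoc)
      qed
      ultimately have "((\<lambda>y. cis (k * x) * (h y * symbol \<alpha> \<beta> \<kappa> k (t - y))) has_integral
         \<alpha> * (cis (k * (x + t)) * ?F k)
           + \<beta> * (cis (k * (x - t)) * ?F' k) + ?J k) {0..t}"
        by (simp only:)
      from integral_unique[OF this] show ?thesis by (simp only: integral_mult_right)
    qed
    moreover have "((\<lambda>k. \<alpha> * (cis (k * (x + t)) * ?F k)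
       + \<beta> * (cis (k * (x - t)) * ?F' k) + ?J k) has_integral
        \<alpha> * ?T n (x + t) + \<beta> * integral (?I n) (\<lambda>k. cis (k * (x - t)) * ?F' k)
        + integral (?I n) ?J) (?I n)"
      by (intro has_integral_add has_integral_mult_right integrable_integral integrable_continuous_real
            continuous_intros cF cF' cS)
    moreover have "integral (?I n) (\<lambda>k. cis (k * (x - t)) * ?F' k) = ?T n (t - x)"
      using Henstock_Kurzweil_Integration.integral_reflect_real[of "real n" "- real n" "\<lambda>k. cis (k * (x - t)) * ?F' k"]
      by (simp add: algebra_simps)
    moreover have "integral (?I n) ?J = integral {0..t} (\<lambda>y. integral (?I n) (\<lambda>k. cis (k * x) * (h y * symbol 0 0 \<kappa> k (t - y))))"
      by (rule swap_integrals) (intro continuous_intros continuous_on_symbol[OF \<kappa>(1)] ch2; auto)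
    moreover have "integral (?I n) (\<lambda>k. cis (k * x) * (h y * symbol 0 0 \<kappa> k (t - y))) = h y * ?M n (t - y)" for y
      unfolding integral_mult_right[symmetric] by (intro integral_cong) (simp add: mult_ac)
    ultimately show ?thesis by (simp add: integral_unique)
  qed
  have d\<kappa>: "((\<lambda>u. \<kappa> u s) has_vector_derivative \<kappa>' u s) (at u within S)" for u s S
    using \<kappa>(3) by (rule has_vector_derivative_at_within)
  have M_lim: "(\<lambda>n. ?M n s) \<longlonglongrightarrow> of_real pi * of_real (sgn (x - (- s)) + sgn (s - x)) * \<kappa> x s" if "s \<ge> 0" for s
    unfolding symbol_kernel_interval[OF \<kappa>(1) that]
    by (rule inversion_interval[OF _ d\<kappa>]) (use that in \<open>auto intro!: continuous_on_kernel[OF \<kappa>(2)] continuous_intros\<close>)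
  obtain B where B: "B \<ge> 0" "\<And>u. \<bar>Si u\<bar> \<le> B" using Si_bound by blast
  obtain N where N: "\<And>u s. u \<in> {-t..t} \<Longrightarrow> s \<in> {0..t} \<Longrightarrow> norm (\<kappa> u s) \<le> N \<and> norm (\<kappa>' u s) \<le> N"
  proof -
    have k: "compact ({-t..t} \<times> {0..t})" by (intro compact_Times compact_Icc)
    have c1: "continuous_on ({-t..t} \<times> {0..t}) (\<lambda>p. \<kappa> (fst p) (snd p))"
      and c2: "continuous_on ({-t..t} \<times> {0..t}) (\<lambda>p. \<kappa>' (fst p) (snd p))"
      using \<kappa> continuous_on_subset by blast+
    from compact_imp_bounded[OF compact_continuous_image[OF c1 k]]
    obtain N1 where N1: "\<forall>w\<in>(\<lambda>p. \<kappa> (fst p) (snd p)) ` ({-t..t} \<times> {0..t}). norm w \<le> N1"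
      unfolding bounded_iff by blast
    from compact_imp_bounded[OF compact_continuous_image[OF c2 k]]
    obtain N2 where N2: "\<forall>w\<in>(\<lambda>p. \<kappa>' (fst p) (snd p)) ` ({-t..t} \<times> {0..t}). norm w \<le> N2"
      unfolding bounded_iff by blast
    show ?thesis
    proof (rule that[of "max N1 N2"])
      fix u s assume "u \<in> {-t..t}" "s \<in> {0..t}"
      then have "(u, s) \<in> {-t..t} \<times> {0..t}" by simp
      then have "norm (\<kappa> u s) \<le> N1" "norm (\<kappa>' u s) \<le> N2" using N1 N2 by force+
      then show "norm (\<kappa> u s) \<le> max N1 N2 \<and> norm (\<kappa>' u s) \<le> max N1 N2" by auto
    qed
  qed
  have N0: "N \<ge> 0" using order_trans[OF norm_ge_zero] N[of 0 0] t by auto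
  have M_bound: "norm (?M n s) \<le> 2 * B * N * (2 + 2 * t)" if "s \<in> {0..t}" for n s
  proof -
    have "?M n s = integral (?I n) (\<lambda>k. cis (k * x) * integral {-s..s} (\<lambda>u. cis (- (k * u)) * \<kappa> u s))"
      using that symbol_kernel_interval[OF \<kappa>(1)] by simp
    also have "norm \<dots> \<le> 2 * B * N * (2 + (s - (- s)))"
    proof (rule truncated_inversion_interval_bound[OF _ _ d\<kappa> _ B(2)])
      show "continuous_on {-s..s} (\<lambda>u. \<kappa>' u s)"
        by (intro continuous_on_kernel[OF \<kappa>(2)] continuous_intros)
      show "norm (\<kappa> u s) \<le> N \<and> norm (\<kappa>' u s) \<le> N" if "u \<in> {-s..s}" for u
        using that \<open>s \<in> {0..t}\<close> by (intro N) auto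
    qed (use that in auto)
    also have "\<dots> \<le> 2 * B * N * (2 + 2 * t)" using that B N0 by (intro mult_left_mono) auto
    finally show ?thesis .
  qed
  obtain H where H: "\<And>y. y \<in> {0..t} \<Longrightarrow> norm (h y) \<le> H"
    using compact_continuous_image[OF ch] compact_imp_bounded bounded_iff by (metis compact_Icc image_eqI)
  have "(\<lambda>n. integral {0..t} (\<lambda>y. h y * ?M n (t - y))) \<longlonglongrightarrow>
     integral {0..t} ?q"
  proof (rule dominated_convergence(2))
    have "continuous_on {0..t} (\<lambda>y. ?M n (t - y))" for n
      by (rule continuous_on_parameter_integral) (intro continuous_intros continuous_on_symbol[OF \<kappa>(1)])
    then show "(\<lambda>y. h y * ?M n (t - y)) integrable_on {0..t}" for n
      by (intro integrable_continuous_real continuous_on_mult ch)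
    show "(\<lambda>y. H * (2 * B * N * (2 + 2 * t))) integrable_on {0..t}" by (rule integrable_const_ivl)
    show "norm (h y * ?M n (t - y)) \<le> H * (2 * B * N * (2 + 2 * t))" if "y \<in> {0..t}" for n y
      unfolding norm_mult using that
      by (intro mult_mono H M_bound order_trans[OF norm_ge_zero H[OF that]]) auto
    show "(\<lambda>n. h y * ?M n (t - y)) \<longlonglongrightarrow>
       ?q y" if "y \<in> {0..t}" for y
      using that by (intro tendsto_mult_left M_lim) auto
  qed
  moreover have "integral {0..t} ?q
     = (if x < t then 2 * of_real pi * ?K else 0)"
  proof (cases "x < t")
    case True
    have "((\<lambda>y. h y * \<kappa> x (t - y)) has_integral ?K) {0..t - x}"
      using True x by (intro integrable_integral integrable_continuous_real continuous_intros
          continuous_on_subset[OF ch] continuous_on_kernel[OF \<kappa>(1)]) auto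
    then have "((\<lambda>y. if y \<in> {0..t - x} then h y * \<kappa> x (t - y) else 0) has_integral
        ?K) {0..t}"
      using True x by (subst has_integral_restrict) auto
    from has_integral_mult_right[OF this, of "2 * of_real pi"]
    have "(?q has_integral 2 * of_real pi * ?K) {0..t}"
      by (rule has_integral_spike_finite[rotated 2, of _ _ _ "{t - x}"]) (use x in \<open>auto simp: sgn_if\<close>)
    then show ?thesis using True by (simp add: integral_unique)
  next
    case False
    have "integral {0..t} ?q = integral {0..t} (\<lambda>y. 0)"
      using False x by (intro integral_cong) (auto simp: sgn_if)
    then show ?thesis using False by simp
  qed
  ultimately have K: "(\<lambda>n. integral {0..t} (\<lambda>y. h y * ?M n (t - y))) \<longlonglongrightarrow>
      (if x < t then 2 * of_real pi * ?K else 0)" by simp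
  have "(\<lambda>n. \<alpha> * ?T n (x + t) + \<beta> * ?T n (t - x) + integral {0..t} (\<lambda>y. h y * ?M n (t - y))) \<longlonglongrightarrow>
     \<alpha> * (of_real pi * of_real (sgn (x + t - 0) + sgn (t - (x + t))) * h (x + t))
     + \<beta> * (of_real pi * of_real (sgn (t - x - 0) + sgn (t - (t - x))) * h (t - x))
     + (if x < t then 2 * of_real pi * ?K else 0)"
    by (intro tendsto_add tendsto_mult_left T K)
  then show ?thesis unfolding split using x t by (auto simp: algebra_simps sgn_if split: if_splits)
qed

section \<open>Conditional convergence on the line\<close>

text \<open>The generalized integral adds two limits, one for each half of the line. Each of them has to exist on its own; a
  limit of symmetric truncations alone would not do.\<close>

definition half_convergent :: "(real \<Rightarrow> complex) \<Rightarrow> bool" where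
  "half_convergent f \<longleftrightarrow> (\<forall>A. f integrable_on {0..A}) \<and> (\<exists>l. ((\<lambda>A. integral {0..A} f) \<longlongrightarrow> l) at_top)"

definition line_convergent :: "(real \<Rightarrow> complex) \<Rightarrow> bool" where
  "line_convergent f \<longleftrightarrow> half_convergent f \<and> half_convergent (\<lambda>k. f (- k))"

lemma line_convergent_integral:
  assumes "line_convergent f"
  shows "f integrable_on {-real n..real n}"
    and "(\<lambda>n. integral {-real n..real n} f) \<longlonglongrightarrow> generalized_integral f"
proof -
  obtain l1 l2 where l: "((\<lambda>A. integral {0..A} f) \<longlongrightarrow> l1) at_top" "((\<lambda>A. integral {0..A} (\<lambda>k. f (- k))) \<longlongrightarrow> l2) at_top"
    and i: "\<And>A. f integrable_on {0..A}" "\<And>A. (\<lambda>k. f (- k)) integrable_on {0..A}"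
    using assms unfolding line_convergent_def half_convergent_def by blast
  have i': "f integrable_on {-A..0}" for A
    using Henstock_Kurzweil_Integration.integrable_reflect_real[where f = f and a = "- A" and b = 0] i(2)[of A] by simp
  have r: "integral {0..A} (\<lambda>k. f (- k)) = integral {-A..0} f" for A
    using Henstock_Kurzweil_Integration.integral_reflect_real[of 0 "- A" f] by simp
  have g: "generalized_integral f = l1 + l2"
    unfolding generalized_integral_def using tendsto_Lim[OF _ l(1)] tendsto_Lim[OF _ l(2)[unfolded r]] by simp
  show int: "f integrable_on {-real n..real n}" for n
    by (rule Henstock_Kurzweil_Integration.integrable_combine[OF _ _ i'[of "real n"] i(1)]) auto
  have "integral {-real n..real n} f = integral {0..real n} f + integral {0..real n} (\<lambda>k. f (- k))" for n
    unfolding r using Henstock_Kurzweil_Integration.integral_combine[OF _ _ int[of n], of 0] by (simp add: add.commute)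
  then show "(\<lambda>n. integral {-real n..real n} f) \<longlonglongrightarrow> generalized_integral f"
    unfolding g using tendsto_add[OF filterlim_compose[OF l(1) filterlim_real_sequentially]
      filterlim_compose[OF l(2) filterlim_real_sequentially]] by simp
qed

section \<open>Convergence of oscillating tails\<close>

lemma inverse_square_integrable:
  assumes "A > 0"
  shows "((\<lambda>k::real. C / k ^ 2) has_integral C / A) {A..}"
proof -
  have "((\<lambda>k::real. k powr (-2)) has_integral A powr (-1)) {A..}"
    using has_integral_powr_to_inf[of "-2" A] assms by simp
  from has_integral_mult_right[OF this, of C]
  have "((\<lambda>k::real. C * k powr (-2)) has_integral C / A) {A..}"
    using assms by (simp add: powr_minus divide_inverse)
  then show ?thesis
    by (rule has_integral_eq[rotated]) (use assms in \<open>auto simp: powr_minus powr_realpow divide_inverse\<close>)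
qed

lemma inverse_square_tail_convergent:
  fixes f :: "real \<Rightarrow> complex"
  assumes c: "continuous_on {1..} f" and C: "\<And>k. k \<ge> 1 \<Longrightarrow> norm (f k) \<le> C / k ^ 2"
  shows "\<exists>l. ((\<lambda>A. integral {1..A} f) \<longlongrightarrow> l) at_top"
proof -
  have cA: "continuous_on {A..B} f" if "A \<ge> 1" for A B
    using c by (rule continuous_on_subset) (use that in auto)
  have i: "f integrable_on {A..}" if "A \<ge> 1" for A
    using that C
    by (intro measurable_bounded_by_integrable_imp_integrable[OF _ has_integral_integrable[OF inverse_square_integrable[of A C]]]
        continuous_imp_measurable_on_sets_lebesgue continuous_on_subset[OF c]) auto
  have "norm (integral {1..A} f - integral {1..} f) \<le> C / A" if "A \<ge> 1" for A
  proof -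
    have "(f has_integral integral {1..A} f + integral {A..} f) ({1..A} \<union> {A..})"
      using that by (intro has_integral_Un integrable_integral i integrable_continuous_real cA)
        (auto intro: negligible_subset[of "{A}"])
    moreover have "{1..A} \<union> {A..} = {1..}" using that by auto
    ultimately have "integral {1..A} f - integral {1..} f = - integral {A..} f"
      by (simp add: integral_unique)
    moreover have "norm (integral {A..} f) \<le> integral {A..} (\<lambda>k. C / k ^ 2)"
      using that C by (intro Henstock_Kurzweil_Integration.integral_norm_bound_integral i
          has_integral_integrable[OF inverse_square_integrable]) auto
    moreover have "integral {A..} (\<lambda>k. C / k ^ 2) = C / A"
      using that by (intro integral_unique inverse_square_integrable) auto
    ultimately show ?thesis by simp
  qed
  then have "eventually (\<lambda>A. norm (integral {1..A} f - integral {1..} f) \<le> C / A) at_top"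
    by (rule eventually_mono[OF eventually_ge_at_top[of 1]])
  moreover have "((\<lambda>A. C / A) \<longlongrightarrow> 0) at_top"
    by (rule tendsto_divide_0[OF tendsto_const filterlim_at_top_imp_at_infinity[OF filterlim_ident]])
  ultimately have "((\<lambda>A. integral {1..A} f - integral {1..} f) \<longlongrightarrow> 0) at_top"
    by (rule Lim_null_comparison)
  then show ?thesis using Lim_null by blast
qed

text \<open>An integration by parts gains a factor \<open>1 / k\<close>.\<close>

lemma oscillating_tail_convergent:
  assumes "u \<noteq> 0"
  shows "\<exists>l. ((\<lambda>A. integral {1..A} (\<lambda>k. cis (k * u) / of_real k)) \<longlongrightarrow> l) at_top"
proof -
  let ?G = "\<lambda>k. cis (u * k) / (\<i> * of_real u * of_real k)"
  have d: "(?G has_vector_derivative cis (u * k) / of_real k - cis (u * k) / of_real (k ^ 2) / (\<i> * of_real u)) (at k within S)"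
    if "k > 0" for k S
  proof -
    have "((\<lambda>k. cis (u * k) * of_real (inverse k)) has_vector_derivative
        cis (u * k) * of_real (- inverse (k ^ 2)) + \<i> * of_real u * cis (u * k) * of_real (inverse k)) (at k within S)"
      by (intro has_vector_derivative_mult has_vector_derivative_cis has_vector_derivative_of_real)
        (use that in \<open>auto intro!: derivative_eq_intros simp: power2_eq_square\<close>)
    from has_vector_derivative_divide[OF this, of "\<i> * of_real u"]
    have "((\<lambda>k. cis (u * k) * of_real (inverse k) / (\<i> * of_real u)) has_vector_derivative
      cis (u * k) / of_real k - cis (u * k) / of_real (k ^ 2) / (\<i> * of_real u)) (at k within S)"
      by (rule has_vector_derivative_eq_rhs) (use assms that in \<open>simp add: field_simps\<close>)
    moreover have "?G = (\<lambda>k. cis (u * k) * of_real (inverse k) / (\<i> * of_real u))"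
      by (simp add: divide_inverse mult_ac)
    ultimately show ?thesis by simp
  qed
  have "\<exists>l. ((\<lambda>A. integral {1..A} (\<lambda>k. cis (u * k) / of_real (k ^ 2) / (\<i> * of_real u))) \<longlongrightarrow> l) at_top"
  proof (rule inverse_square_tail_convergent)
    show "continuous_on {1..} (\<lambda>k. cis (u * k) / of_real (k ^ 2) / (\<i> * of_real u))"
      using assms by (intro continuous_intros) auto
    show "norm (cis (u * k) / of_real (k ^ 2) / (\<i> * of_real u)) \<le> (1 / \<bar>u\<bar>) / k ^ 2" for k
      by (simp add: norm_divide norm_mult norm_power mult_ac)
  qed
  then obtain l where l: "((\<lambda>A. integral {1..A} (\<lambda>k. cis (u * k) / of_real (k ^ 2) / (\<i> * of_real u))) \<longlongrightarrow> l) at_top" ..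
  have lim: "((\<lambda>A. ?G A - ?G 1 + integral {1..A} (\<lambda>k. cis (u * k) / of_real (k ^ 2) / (\<i> * of_real u))) \<longlongrightarrow> 0 - ?G 1 + l) at_top"
  proof (intro tendsto_add tendsto_diff tendsto_const l)
    have "((\<lambda>A. (1 / \<bar>u\<bar>) / A) \<longlongrightarrow> 0) at_top"
      by (rule tendsto_divide_0[OF tendsto_const filterlim_at_top_imp_at_infinity[OF filterlim_ident]])
    moreover have "eventually (\<lambda>A. norm (?G A) \<le> (1 / \<bar>u\<bar>) / A) at_top"
      using eventually_gt_at_top[of 0] by eventually_elim (simp add: norm_divide norm_mult)
    ultimately show "(?G \<longlongrightarrow> 0) at_top" by (rule Lim_null_comparison[rotated])
  qed
  have ev: "eventually (\<lambda>A. integral {1..A} (\<lambda>k. cis (k * u) / of_real k) =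
     ?G A - ?G 1 + integral {1..A} (\<lambda>k. cis (u * k) / of_real (k ^ 2) / (\<i> * of_real u))) at_top"
    using eventually_ge_at_top[of 1]
  proof eventually_elim
    case (elim A)
    have 1: "((\<lambda>k. cis (u * k) / of_real k - cis (u * k) / of_real (k ^ 2) / (\<i> * of_real u)) has_integral ?G A - ?G 1) {1..A}"
      by (rule fundamental_theorem_of_calculus[OF elim d]) auto
    have 2: "((\<lambda>k. cis (u * k) / of_real (k ^ 2) / (\<i> * of_real u)) has_integral
        integral {1..A} (\<lambda>k. cis (u * k) / of_real (k ^ 2) / (\<i> * of_real u))) {1..A}"
      using assms by (intro integrable_integral integrable_continuous_real continuous_intros) auto
    from has_integral_add[OF 1 2] show ?case
      by (intro integral_unique) (simp add: mult.commute)
  qed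
  from iffD2[OF tendsto_cong[OF ev] lim] show ?thesis ..
qed

text \<open>Up to an absolutely integrable remainder the tail consists of two pure oscillations of non-zero phase.\<close>

lemma half_convergentI:
  assumes c: "continuous_on {0<..} f" and M: "\<And>k. 0 < k \<Longrightarrow> k \<le> 1 \<Longrightarrow> norm (f k) \<le> M"
    and u: "u \<noteq> 0" "v \<noteq> 0"
    and C: "\<And>k. k \<ge> 1 \<Longrightarrow> norm (f k - (a * cis (k * u) + b * cis (k * v)) / of_real k) \<le> C / k ^ 2"
  shows "half_convergent f"
proof -
  let ?q = "\<lambda>k. (a * cis (k * u) + b * cis (k * v)) / of_real k"
  have "(\<lambda>_. M) integrable_on {0<..1::real}"
    by (rule integrable_spike_set[OF integrable_const_ivl[of M 0 1]]) (auto intro: negligible_subset[of "{0}"])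
  then have "f integrable_on {0<..1}"
    by (rule measurable_bounded_by_integrable_imp_integrable[rotated])
      (use M in \<open>auto intro!: continuous_imp_measurable_on_sets_lebesgue continuous_on_subset[OF c]\<close>)
  then have i1: "f integrable_on {0..1}"
    by (rule integrable_spike_set) (auto intro: negligible_subset[of "{0}"])
  have i2: "f integrable_on {1..A}" for A
    by (intro integrable_continuous_real continuous_on_subset[OF c]) auto
  have i: "f integrable_on {0..A}" for A
  proof (cases "A \<ge> 1")
    case True
    then show ?thesis
      using Henstock_Kurzweil_Integration.integrable_combine[OF _ _ i1 i2] by simp
  next
    case False
    then show ?thesis using integrable_on_subinterval[OF i1] by simp
  qed
  obtain l1 where l1: "((\<lambda>A. integral {1..A} (\<lambda>k. f k - ?q k)) \<longlongrightarrow> l1) at_top"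
  proof -
    have "continuous_on {1..} (\<lambda>k. f k - ?q k)"
      by (intro continuous_intros continuous_on_subset[OF c]) auto
    then show ?thesis using inverse_square_tail_convergent[OF _ C] that by blast
  qed
  obtain l2 l3 where l2: "((\<lambda>A. integral {1..A} (\<lambda>k. cis (k * u) / of_real k)) \<longlongrightarrow> l2) at_top"
    and l3: "((\<lambda>A. integral {1..A} (\<lambda>k. cis (k * v) / of_real k)) \<longlongrightarrow> l3) at_top"
    using oscillating_tail_convergent u by meson
  have lim: "((\<lambda>A. integral {0..1} f + (integral {1..A} (\<lambda>k. f k - ?q k) + (a * integral {1..A} (\<lambda>k. cis (k * u) / of_real k)
     + b * integral {1..A} (\<lambda>k. cis (k * v) / of_real k)))) \<longlongrightarrow> integral {0..1} f + (l1 + (a * l2 + b * l3))) at_top"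
    by (intro tendsto_intros l1 l2 l3)
  have ev: "eventually (\<lambda>A. integral {0..A} f = integral {0..1} f + (integral {1..A} (\<lambda>k. f k - ?q k) + (a * integral {1..A} (\<lambda>k. cis (k * u) / of_real k)
     + b * integral {1..A} (\<lambda>k. cis (k * v) / of_real k)))) at_top"
    using eventually_ge_at_top[of 1]
  proof eventually_elim
    case (elim A)
    have "((\<lambda>k. (f k - ?q k) + (a * (cis (k * u) / of_real k) + b * (cis (k * v) / of_real k))) has_integral
       integral {1..A} (\<lambda>k. f k - ?q k) + (a * integral {1..A} (\<lambda>k. cis (k * u) / of_real k)
     + b * integral {1..A} (\<lambda>k. cis (k * v) / of_real k))) {1..A}"
      by (intro has_integral_add has_integral_mult_right integrable_integral integrable_continuous_real
          continuous_intros continuous_on_subset[OF c]) auto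
    moreover have "(f k - ?q k) + (a * (cis (k * u) / of_real k) + b * (cis (k * v) / of_real k)) = f k" for k
      by (simp add: add_divide_distrib)
    ultimately have "integral {1..A} f = integral {1..A} (\<lambda>k. f k - ?q k) + (a * integral {1..A} (\<lambda>k. cis (k * u) / of_real k)
     + b * integral {1..A} (\<lambda>k. cis (k * v) / of_real k))" by (simp only: integral_unique)
    then show ?case
      using Henstock_Kurzweil_Integration.integral_combine[OF _ elim i[of A]] by simp
  qed
  from i iffD2[OF tendsto_cong[OF ev] lim] show ?thesis
    unfolding half_convergent_def by (intro conjI allI exI)
qed

section \<open>Asymptotic calculus\<close>

text \<open>\<open>near0 f g\<close> means \<open>f = g + O(1/k)\<close> for a bounded \<open>g\<close>, and \<open>near1 f g\<close> means
  \<open>f = g / k + O(1/k\<^sup>2)\<close> for a bounded \<open>g\<close>, so that leading terms of products can be found factor by factor.\<close>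

definition near0 :: "(real \<Rightarrow> complex) \<Rightarrow> (real \<Rightarrow> complex) \<Rightarrow> bool" where
  "near0 f g \<longleftrightarrow> (\<exists>C. \<forall>k\<ge>1. norm (g k) \<le> C \<and> norm (f k - g k) \<le> C / k)"

definition near1 :: "(real \<Rightarrow> complex) \<Rightarrow> (real \<Rightarrow> complex) \<Rightarrow> bool" where
  "near1 f g \<longleftrightarrow> (\<exists>C. \<forall>k\<ge>1. norm (g k) \<le> C \<and> norm (f k - g k / of_real k) \<le> C / k ^ 2)"

lemma near0I: "(\<And>k. k \<ge> 1 \<Longrightarrow> norm (g k) \<le> B) \<Longrightarrow> (\<And>k. k \<ge> 1 \<Longrightarrow> norm (f k - g k) \<le> C / k) \<Longrightarrow> near0 f g"
  unfolding near0_def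
  by (rule exI[of _ "max B C"]) (auto intro!: order_trans[OF _ divide_right_mono[OF max.cobounded2[of C B]]] simp: le_max_iff_disj)

lemma near1I: "(\<And>k. k \<ge> 1 \<Longrightarrow> norm (g k) \<le> B) \<Longrightarrow> (\<And>k. k \<ge> 1 \<Longrightarrow> norm (f k - g k / of_real k) \<le> C / k ^ 2) \<Longrightarrow> near1 f g"
  unfolding near1_def
  by (rule exI[of _ "max B C"]) (auto intro!: order_trans[OF _ divide_right_mono[OF max.cobounded2[of C B]]] simp: le_max_iff_disj)

lemma near0E:
  assumes "near0 f g"
  obtains C where "C \<ge> 0" "\<And>k. k \<ge> 1 \<Longrightarrow> norm (g k) \<le> C" "\<And>k. k \<ge> 1 \<Longrightarrow> norm (f k - g k) \<le> C / k"
    "\<And>k. k \<ge> 1 \<Longrightarrow> norm (f k) \<le> 2 * C"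
proof -
  obtain C where C: "\<And>k. k \<ge> 1 \<Longrightarrow> norm (g k) \<le> C \<and> norm (f k - g k) \<le> C / k"
    using assms unfolding near0_def by blast
  have C0: "C \<ge> 0" using order_trans[OF norm_ge_zero] C[of 1] by auto
  have "norm (f k) \<le> 2 * C" if "k \<ge> 1" for k
  proof -
    have "norm (f k) \<le> norm (g k) + norm (f k - g k)" by (metis add.commute norm_triangle_sub)
    moreover have "C / k \<le> C" using C0 that by (simp add: divide_le_eq mult_le_cancel_left1)
    ultimately show ?thesis using C[OF that] by linarith
  qed
  then show ?thesis using that C C0 by blast
qed

lemma near1E:
  assumes "near1 f g"
  obtains C where "C \<ge> 0" "\<And>k. k \<ge> 1 \<Longrightarrow> norm (g k) \<le> C" "\<And>k. k \<ge> 1 \<Longrightarrow> norm (f k - g k / of_real k) \<le> C / k ^ 2"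
proof -
  obtain C where C: "\<And>k. k \<ge> 1 \<Longrightarrow> norm (g k) \<le> C \<and> norm (f k - g k / of_real k) \<le> C / k ^ 2"
    using assms unfolding near1_def by blast
  have C0: "C \<ge> 0" using order_trans[OF norm_ge_zero] C[of 1] by auto
  then show ?thesis using that C by blast
qed

lemma near1D: "near1 f g \<Longrightarrow> \<exists>C. \<forall>k\<ge>1. norm (f k - g k / of_real k) \<le> C / k ^ 2"
  unfolding near1_def by blast

lemma near0_const: "near0 (\<lambda>k. c) (\<lambda>k. c)"
  by (rule near0I[of _ "norm c" _ 0]) auto

lemma near0_add:
  assumes "near0 f g" "near0 f' g'"
  shows "near0 (\<lambda>k. f k + f' k) (\<lambda>k. g k + g' k)"
proof -
  obtain C where C: "\<And>k. k \<ge> 1 \<Longrightarrow> norm (g k) \<le> C" "\<And>k. k \<ge> 1 \<Longrightarrow> norm (f k - g k) \<le> C / k" using near0E[OF assms(1)] by metis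
  obtain C' where C': "\<And>k. k \<ge> 1 \<Longrightarrow> norm (g' k) \<le> C'" "\<And>k. k \<ge> 1 \<Longrightarrow> norm (f' k - g' k) \<le> C' / k" using near0E[OF assms(2)] by metis
  show ?thesis
  proof (rule near0I[of _ "C + C'" _ "C + C'"])
    show "norm (g k + g' k) \<le> C + C'" if "k \<ge> 1" for k using norm_triangle_mono C(1) C'(1) that by blast
    show "norm (f k + f' k - (g k + g' k)) \<le> (C + C') / k" if "k \<ge> 1" for k
      unfolding add_diff_add add_divide_distrib using norm_triangle_mono C(2) C'(2) that by blast
  qed
qed

lemma near0_mult:
  assumes "near0 f g" "near0 f' g'"
  shows "near0 (\<lambda>k. f k * f' k) (\<lambda>k. g k * g' k)"
proof -
  obtain C where C: "C \<ge> 0" "\<And>k. k \<ge> 1 \<Longrightarrow> norm (g k) \<le> C" "\<And>k. k \<ge> 1 \<Longrightarrow> norm (f k - g k) \<le> C / k" "\<And>k. k \<ge> 1 \<Longrightarrow> norm (f k) \<le> 2 * C"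
    using near0E[OF assms(1)] by metis
  obtain C' where C': "C' \<ge> 0" "\<And>k. k \<ge> 1 \<Longrightarrow> norm (g' k) \<le> C'" "\<And>k. k \<ge> 1 \<Longrightarrow> norm (f' k - g' k) \<le> C' / k" using near0E[OF assms(2)] by metis
  show ?thesis
  proof (rule near0I[of _ "C * C'" _ "2 * C * C' + C * C'"])
    show "norm (g k * g' k) \<le> C * C'" if "k \<ge> 1" for k
      unfolding norm_mult using C(1) C(2)[OF that] C'(2)[OF that] by (intro mult_mono) auto
    show "norm (f k * f' k - g k * g' k) \<le> (2 * C * C' + C * C') / k" if "k \<ge> 1" for k
    proof -
      have "f k * f' k - g k * g' k = f k * (f' k - g' k) + (f k - g k) * g' k" by (simp add: algebra_simps)
      also have "norm \<dots> \<le> (2 * C) * (C' / k) + (C / k) * C'"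
      proof (rule norm_triangle_mono)
        show "norm (f k * (f' k - g' k)) \<le> (2 * C) * (C' / k)"
          unfolding norm_mult using C(1) C(4)[OF that] C'(3)[OF that] by (intro mult_mono) auto
        show "norm ((f k - g k) * g' k) \<le> (C / k) * C'"
          unfolding norm_mult using C(1) C(3)[OF that] C'(2)[OF that] that by (intro mult_mono) auto
      qed
      finally show ?thesis by (simp add: add_divide_distrib mult_ac)
    qed
  qed
qed

lemma near1_add:
  assumes "near1 f g" "near1 f' g'"
  shows "near1 (\<lambda>k. f k + f' k) (\<lambda>k. g k + g' k)"
proof -
  obtain C where C: "\<And>k. k \<ge> 1 \<Longrightarrow> norm (g k) \<le> C" "\<And>k. k \<ge> 1 \<Longrightarrow> norm (f k - g k / of_real k) \<le> C / k ^ 2" using near1E[OF assms(1)] by metis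
  obtain C' where C': "\<And>k. k \<ge> 1 \<Longrightarrow> norm (g' k) \<le> C'" "\<And>k. k \<ge> 1 \<Longrightarrow> norm (f' k - g' k / of_real k) \<le> C' / k ^ 2" using near1E[OF assms(2)] by metis
  show ?thesis
  proof (rule near1I[of _ "C + C'" _ "C + C'"])
    show "norm (g k + g' k) \<le> C + C'" if "k \<ge> 1" for k using norm_triangle_mono C(1) C'(1) that by blast
    show "norm (f k + f' k - (g k + g' k) / of_real k) \<le> (C + C') / k ^ 2" if "k \<ge> 1" for k
      unfolding add_divide_distrib add_diff_add using norm_triangle_mono C(2) C'(2) that by blast
  qed
qed

lemma near01_mult:
  assumes "near0 f g" "near1 f' g'"
  shows "near1 (\<lambda>k. f k * f' k) (\<lambda>k. g k * g' k)"
proof -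
  obtain C where C: "C \<ge> 0" "\<And>k. k \<ge> 1 \<Longrightarrow> norm (g k) \<le> C" "\<And>k. k \<ge> 1 \<Longrightarrow> norm (f k - g k) \<le> C / k" "\<And>k. k \<ge> 1 \<Longrightarrow> norm (f k) \<le> 2 * C"
    using near0E[OF assms(1)] by metis
  obtain C' where C': "C' \<ge> 0" "\<And>k. k \<ge> 1 \<Longrightarrow> norm (g' k) \<le> C'" "\<And>k. k \<ge> 1 \<Longrightarrow> norm (f' k - g' k / of_real k) \<le> C' / k ^ 2" using near1E[OF assms(2)] by metis
  show ?thesis
  proof (rule near1I[of _ "C * C'" _ "2 * C * C' + C * C'"])
    show "norm (g k * g' k) \<le> C * C'" if "k \<ge> 1" for k
      unfolding norm_mult using C(1) C(2)[OF that] C'(2)[OF that] by (intro mult_mono) auto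
    show "norm (f k * f' k - g k * g' k / of_real k) \<le> (2 * C * C' + C * C') / k ^ 2" if "k \<ge> 1" for k
    proof -
      have "f k * f' k - g k * g' k / of_real k = f k * (f' k - g' k / of_real k) + (f k - g k) * (g' k / of_real k)"
        by (simp add: algebra_simps diff_divide_distrib)
      also have "norm \<dots> \<le> (2 * C) * (C' / k ^ 2) + (C / k) * (C' / k)"
      proof (rule norm_triangle_mono)
        show "norm (f k * (f' k - g' k / of_real k)) \<le> (2 * C) * (C' / k ^ 2)"
          unfolding norm_mult using C(1) C(4)[OF that] C'(3)[OF that] by (intro mult_mono) auto
        have "norm (g' k / of_real k) \<le> C' / k"
          using C'(2)[OF that] that by (simp add: norm_divide divide_right_mono)
        then show "norm ((f k - g k) * (g' k / of_real k)) \<le> (C / k) * (C' / k)"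
          unfolding norm_mult[of "f k - g k"] using C(1) C(3)[OF that] that by (intro mult_mono) auto
      qed
      finally show ?thesis by (simp add: add_divide_distrib power2_eq_square mult_ac)
    qed
  qed
qed

lemma near0_imp_near1: "near0 f g \<Longrightarrow> near1 (\<lambda>k. f k / of_real k) g"
proof (erule near0E)
  fix C assume C: "\<And>k. k \<ge> 1 \<Longrightarrow> norm (g k) \<le> C" "\<And>k. k \<ge> 1 \<Longrightarrow> norm (f k - g k) \<le> C / k"
  show ?thesis
  proof (rule near1I[OF C(1)])
    fix k :: real assume "k \<ge> 1"
    then show "norm (f k / of_real k - g k / of_real k) \<le> C / k ^ 2"
      unfolding diff_divide_distrib[symmetric] norm_divide
      using divide_right_mono[OF C(2), of k k] by (simp add: power2_eq_square)
  qed
qed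

section \<open>Integration by parts against plane waves\<close>

lemma interval_by_parts:
  assumes "a \<le> b" "\<kappa> \<noteq> 0" and f: "\<And>y. y \<in> {a..b} \<Longrightarrow> (f has_vector_derivative f' y) (at y within {a..b})"
    and f': "continuous_on {a..b} f'"
  shows "integral {a..b} (\<lambda>y. cis (- (\<kappa> * y)) * f y) =
    (cis (- (\<kappa> * a)) * f a - cis (- (\<kappa> * b)) * f b + integral {a..b} (\<lambda>y. cis (- (\<kappa> * y)) * f' y)) / (\<i> * of_real \<kappa>)"
proof -
  have cf: "continuous_on {a..b} f"
    unfolding continuous_on_eq_continuous_within using f has_vector_derivative_continuous by blast
  have "((\<lambda>y. cis (- (\<kappa> * y)) * f y) has_vector_derivative
     cis (- (\<kappa> * y)) * f' y - \<i> * of_real \<kappa> * (cis (- (\<kappa> * y)) * f y)) (at y within {a..b})" if "y \<in> {a..b}" for y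
    using has_vector_derivative_mult[OF has_vector_derivative_cis[of "- \<kappa>" y "{a..b}"] f[OF that]] by (simp add: mult.assoc)
  from fundamental_theorem_of_calculus[OF assms(1) this]
  have "((\<lambda>y. cis (- (\<kappa> * y)) * f' y - \<i> * of_real \<kappa> * (cis (- (\<kappa> * y)) * f y)) has_integral
     cis (- (\<kappa> * b)) * f b - cis (- (\<kappa> * a)) * f a) {a..b}" .
  moreover have "((\<lambda>y. cis (- (\<kappa> * y)) * f' y - \<i> * of_real \<kappa> * (cis (- (\<kappa> * y)) * f y)) has_integral
      integral {a..b} (\<lambda>y. cis (- (\<kappa> * y)) * f' y) - \<i> * of_real \<kappa> * integral {a..b} (\<lambda>y. cis (- (\<kappa> * y)) * f y)) {a..b}"
    by (intro has_integral_diff has_integral_mult_right integrable_integral integrable_continuous_real continuous_intros f' cf)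
  ultimately have "integral {a..b} (\<lambda>y. cis (- (\<kappa> * y)) * f' y) - \<i> * of_real \<kappa> * integral {a..b} (\<lambda>y. cis (- (\<kappa> * y)) * f y)
    = cis (- (\<kappa> * b)) * f b - cis (- (\<kappa> * a)) * f a" using has_integral_unique by blast
  then have "\<i> * of_real \<kappa> * integral {a..b} (\<lambda>y. cis (- (\<kappa> * y)) * f y) =
     cis (- (\<kappa> * a)) * f a - cis (- (\<kappa> * b)) * f b + integral {a..b} (\<lambda>y. cis (- (\<kappa> * y)) * f' y)"
    by (simp add: algebra_simps)
  then show ?thesis using assms(2) by (metis complex_i_not_zero mult_eq_0_iff nonzero_mult_div_cancel_left of_real_eq_0_iff)
qed

text \<open>Two integrations by parts: the end points give the leading term, and the remainder decays quadratically.\<close>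

lemma interval_fourier_asymptotics:
  assumes "0 \<le> b" "\<kappa> \<noteq> 0" and f: "\<And>y. y \<in> {0..b} \<Longrightarrow> (f has_vector_derivative f' y) (at y within {0..b})"
    and f': "\<And>y. y \<in> {0..b} \<Longrightarrow> (f' has_vector_derivative f'' y) (at y within {0..b})"
    and f'': "continuous_on {0..b} f''"
  shows "norm (integral {0..b} (\<lambda>y. cis (- (\<kappa> * y)) * f y) - (f 0 - cis (- (\<kappa> * b)) * f b) / (\<i> * of_real \<kappa>))
    \<le> (norm (f' 0) + norm (f' b) + integral {0..b} (\<lambda>y. norm (f'' y))) / \<kappa> ^ 2"
proof -
  have cf': "continuous_on {0..b} f'"
    unfolding continuous_on_eq_continuous_within using f' has_vector_derivative_continuous by blast
  let ?J = "integral {0..b} (\<lambda>y. cis (- (\<kappa> * y)) * f' y)"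
  have 1: "integral {0..b} (\<lambda>y. cis (- (\<kappa> * y)) * f y) - (f 0 - cis (- (\<kappa> * b)) * f b) / (\<i> * of_real \<kappa>) = ?J / (\<i> * of_real \<kappa>)"
    by (subst interval_by_parts[OF assms(1,2) f cf']) (auto simp: diff_divide_distrib add_divide_distrib)
  have 2: "?J = (f' 0 - cis (- (\<kappa> * b)) * f' b + integral {0..b} (\<lambda>y. cis (- (\<kappa> * y)) * f'' y)) / (\<i> * of_real \<kappa>)"
    by (subst interval_by_parts[OF assms(1,2) f' f'']) auto
  have 3: "norm (integral {0..b} (\<lambda>y. cis (- (\<kappa> * y)) * f'' y)) \<le> integral {0..b} (\<lambda>y. norm (f'' y))"
    by (intro Henstock_Kurzweil_Integration.integral_norm_bound_integral integrable_continuous_real continuous_intros f'')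
      (simp add: norm_mult)
  have "norm (f' 0 - cis (- (\<kappa> * b)) * f' b + integral {0..b} (\<lambda>y. cis (- (\<kappa> * y)) * f'' y))
      \<le> norm (f' 0) + norm (cis (- (\<kappa> * b)) * f' b) + integral {0..b} (\<lambda>y. norm (f'' y))"
    using 3 by (intro order_trans[OF norm_triangle_ineq] add_mono norm_triangle_ineq4)
  then have "norm (f' 0 - cis (- (\<kappa> * b)) * f' b + integral {0..b} (\<lambda>y. cis (- (\<kappa> * y)) * f'' y)) / \<kappa>\<^sup>2
      \<le> (norm (f' 0) + norm (f' b) + integral {0..b} (\<lambda>y. norm (f'' y))) / \<kappa>\<^sup>2"
    by (intro divide_right_mono) (auto simp: norm_mult)
  moreover have "norm (?J / (\<i> * of_real \<kappa>)) =
     norm (f' 0 - cis (- (\<kappa> * b)) * f' b + integral {0..b} (\<lambda>y. cis (- (\<kappa> * y)) * f'' y)) / \<kappa>\<^sup>2"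
    unfolding 2 norm_divide norm_mult by (simp add: power2_eq_square)
  ultimately show ?thesis unfolding 1 by simp
qed

lemma half_line_fourier_bound:
  assumes "decaying g"
  shows "norm (half_line_fourier g k) \<le> integral {0..} (\<lambda>y. norm (g y))"
  by (rule LIMSEQ_le_const2[OF tendsto_norm[OF half_line_fourier_limit[OF assms]]])
    (use truncated_fourier_bound[OF assms] in auto)

lemma half_line_fourier_asymptotics:
  assumes dec: "decaying g" "decaying g'" "decaying g''"
    and g: "\<And>y. y \<ge> 0 \<Longrightarrow> (g has_vector_derivative g' y) (at y within {0..})"
      "\<And>y. y \<ge> 0 \<Longrightarrow> (g' has_vector_derivative g'' y) (at y within {0..})"
    and "\<delta> = 1 \<or> \<delta> = -1"
  shows "near1 (\<lambda>k. half_line_fourier g (\<delta> * k)) (\<lambda>k. g 0 / (\<i> * of_real \<delta>))"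
proof -
  let ?N = "integral {0..} (\<lambda>y. norm (g'' y))"
  have bound: "norm (half_line_fourier g \<kappa> - g 0 / (\<i> * of_real \<kappa>)) \<le> (norm (g' 0) + ?N) / \<kappa> ^ 2" if "\<kappa> \<noteq> 0" for \<kappa>
  proof (rule LIMSEQ_le)
    have c: "continuous_on {0..real n} g''" for n
      using dec(3) unfolding decaying_def by (auto intro: continuous_on_subset)
    have cz: "(\<lambda>n. cis (- (\<kappa> * real n)) * g (real n)) \<longlonglongrightarrow> 0"
      using decaying_at_infinity[OF decaying_cis[OF dec(1)]] .
    have "(\<lambda>n. integral {0..real n} (\<lambda>y. cis (- (\<kappa> * y)) * g y) - (g 0 - cis (- (\<kappa> * real n)) * g (real n)) / (\<i> * of_real \<kappa>))
      \<longlonglongrightarrow> half_line_fourier g \<kappa> - (g 0 - 0) / (\<i> * of_real \<kappa>)"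
      using that by (intro tendsto_intros half_line_fourier_limit dec cz) auto
    then show "(\<lambda>n. norm (integral {0..real n} (\<lambda>y. cis (- (\<kappa> * y)) * g y) - (g 0 - cis (- (\<kappa> * real n)) * g (real n)) / (\<i> * of_real \<kappa>)))
      \<longlonglongrightarrow> norm (half_line_fourier g \<kappa> - g 0 / (\<i> * of_real \<kappa>))" by (intro tendsto_norm) simp
    have "(\<lambda>n. (norm (g' 0) + norm (g' (real n)) + ?N) / \<kappa> ^ 2) \<longlonglongrightarrow> (norm (g' 0) + 0 + ?N) / \<kappa> ^ 2"
      using that by (intro tendsto_intros tendsto_norm_zero decaying_at_infinity[OF dec(2)]) auto
    then show "(\<lambda>n. (norm (g' 0) + norm (g' (real n)) + ?N) / \<kappa> ^ 2) \<longlonglongrightarrow> (norm (g' 0) + ?N) / \<kappa> ^ 2" by simp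
    have "norm (integral {0..real n} (\<lambda>y. cis (- (\<kappa> * y)) * g y) - (g 0 - cis (- (\<kappa> * real n)) * g (real n)) / (\<i> * of_real \<kappa>))
        \<le> (norm (g' 0) + norm (g' (real n)) + ?N) / \<kappa> ^ 2" for n
    proof -
      have "norm (integral {0..real n} (\<lambda>y. cis (- (\<kappa> * y)) * g y) - (g 0 - cis (- (\<kappa> * real n)) * g (real n)) / (\<i> * of_real \<kappa>))
        \<le> (norm (g' 0) + norm (g' (real n)) + integral {0..real n} (\<lambda>y. norm (g'' y))) / \<kappa> ^ 2"
        by (rule interval_fourier_asymptotics[OF _ that _ _ c])
          (auto intro!: has_vector_derivative_within_subset[OF g(1)] has_vector_derivative_within_subset[OF g(2)])
      also have "integral {0..real n} (\<lambda>y. norm (g'' y)) \<le> ?N"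
        by (intro integral_subset_le integrable_continuous_real continuous_intros c decaying_integrable[OF dec(3)]) auto
      finally show ?thesis by (simp add: divide_right_mono)
    qed
    then show "\<exists>N. \<forall>n\<ge>N. norm (integral {0..real n} (\<lambda>y. cis (- (\<kappa> * y)) * g y) - (g 0 - cis (- (\<kappa> * real n)) * g (real n)) / (\<i> * of_real \<kappa>))
        \<le> (norm (g' 0) + norm (g' (real n)) + ?N) / \<kappa> ^ 2" by blast
  qed
  show ?thesis
  proof (rule near1I)
    show "norm (g 0 / (\<i> * of_real \<delta>)) \<le> norm (g 0 / (\<i> * of_real \<delta>))" by simp
    fix k :: real assume k: "k \<ge> 1"
    have "g 0 / (\<i> * of_real \<delta>) / of_real k = g 0 / (\<i> * of_real (\<delta> * k))" by (simp add: mult.assoc)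
    moreover have "(\<delta> * k)\<^sup>2 = k\<^sup>2" using assms(6) by auto
    ultimately show "norm (half_line_fourier g (\<delta> * k) - g 0 / (\<i> * of_real \<delta>) / of_real k) \<le> (norm (g' 0) + ?N) / k\<^sup>2"
      using bound[of "\<delta> * k"] k assms(6) by auto
  qed
qed

section \<open>The dispersion relation\<close>

definition freq :: "real \<Rightarrow> real \<Rightarrow> real" where
  "freq m k = sqrt (k\<^sup>2 + m\<^sup>2)"

lemma freq_minus [simp]: "freq m (- k) = freq m k"
  by (simp add: freq_def)

lemma freq_square: "(freq m k)\<^sup>2 = k\<^sup>2 + m\<^sup>2"
  by (simp add: freq_def)

lemma freq_pos: "k \<noteq> 0 \<Longrightarrow> freq m k > 0"
  by (simp add: freq_def sum_power2_gt_zero_iff)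

lemma freq_ge: "\<bar>k\<bar> \<le> freq m k" "\<bar>m\<bar> \<le> freq m k"
  unfolding freq_def by (simp_all add: real_le_rsqrt)

text \<open>From \<open>(\<rho> - k) (\<rho> + k) = m\<^sup>2\<close>: for large \<open>k\<close> the dispersion is that of the massless equation.\<close>

lemma freq_le:
  assumes "k > 0"
  shows "freq m k - k \<le> m\<^sup>2 / k"
proof -
  have "(freq m k - k) * k \<le> (freq m k - k) * (freq m k + k)"
    using freq_ge[of k m] assms by (intro mult_left_mono) auto
  also have "\<dots> = m\<^sup>2" using freq_square[of m k] by (simp add: algebra_simps power2_eq_square)
  finally show ?thesis using assms by (simp add: pos_le_divide_eq)
qed

lemma continuous_on_freq [continuous_intros]: "continuous_on S f \<Longrightarrow> continuous_on S (\<lambda>x. freq m (f x))"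
  unfolding freq_def by (intro continuous_intros)

lemma norm_cis_diff: "norm (cis a - cis b) \<le> \<bar>a - b\<bar>"
proof -
  have "cis ((a + b) / 2) * (2 * \<i> * of_real (sin ((a - b) / 2))) = cis ((a + b) / 2) * (cis ((a - b) / 2) - cis (- ((a - b) / 2)))"
    by (simp add: complex_eq_iff)
  also have "\<dots> = cis a - cis b"
    by (simp add: right_diff_distrib cis_mult field_simps)
  finally have "norm (cis a - cis b) = norm (cis ((a + b) / 2) * (2 * \<i> * of_real (sin ((a - b) / 2))))" by simp
  also have "\<dots> = 2 * \<bar>sin ((a - b) / 2)\<bar>" by (simp add: norm_mult)
  also have "\<dots> \<le> 2 * \<bar>(a - b) / 2\<bar>" using abs_sin_x_le_abs_x[of "(a - b) / 2"] by linarith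
  finally show ?thesis by simp
qed

lemma near0_wave:
  assumes "\<epsilon> = 1 \<or> \<epsilon> = -1"
  shows "near0 (\<lambda>k. cis (k * \<xi> + \<epsilon> * freq m k * t)) (\<lambda>k. cis (k * (\<xi> + \<epsilon> * t)))"
proof (rule near0I[of _ 1 _ "\<bar>t\<bar> * m\<^sup>2"])
  fix k :: real assume k: "k \<ge> 1"
  have "norm (cis (k * \<xi> + \<epsilon> * freq m k * t) - cis (k * (\<xi> + \<epsilon> * t))) \<le> \<bar>(k * \<xi> + \<epsilon> * freq m k * t) - k * (\<xi> + \<epsilon> * t)\<bar>"
    by (rule norm_cis_diff)
  also have "(k * \<xi> + \<epsilon> * freq m k * t) - k * (\<xi> + \<epsilon> * t) = \<epsilon> * t * (freq m k - k)" by (simp add: algebra_simps)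
  also have "\<bar>\<epsilon> * t * (freq m k - k)\<bar> = \<bar>t\<bar> * (freq m k - k)"
    using assms freq_ge[of k m] k by (auto simp: abs_mult)
  also have "\<dots> \<le> \<bar>t\<bar> * (m\<^sup>2 / k)" using freq_le[of k m] k by (intro mult_left_mono) auto
  finally show "norm (cis (k * \<xi> + \<epsilon> * freq m k * t) - cis (k * (\<xi> + \<epsilon> * t))) \<le> \<bar>t\<bar> * m\<^sup>2 / k" by simp
qed simp

lemma near0_ratio: "near0 (\<lambda>k. of_real (k / freq m k)) (\<lambda>k. 1)"
proof (rule near0I[of _ 1 _ "m\<^sup>2"])
  fix k :: real assume k: "k \<ge> 1"
  have f: "freq m k \<ge> 1" using freq_ge(1)[of k m] k by linarith
  have "complex_of_real (k / freq m k) - 1 = of_real ((k - freq m k) / freq m k)"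
    using f by (simp add: diff_divide_distrib)
  also have "norm \<dots> = (freq m k - k) / freq m k" 
    unfolding norm_of_real using f freq_ge(1)[of k m] by simp
  also have "\<dots> \<le> (freq m k - k) / 1"
    using f freq_ge(1)[of k m] by (intro divide_left_mono) auto
  also have "\<dots> \<le> m\<^sup>2 / k" using freq_le[of k m] k by simp
  finally show "norm (complex_of_real (k / freq m k) - 1) \<le> m\<^sup>2 / k" .
qed simp

lemma near0_mass: "near0 (\<lambda>k. of_real (m / freq m k)) (\<lambda>k. 0)"
proof (rule near0I[of _ 0 _ "\<bar>m\<bar>"])
  fix k :: real assume k: "k \<ge> 1"
  then have "\<bar>m\<bar> / freq m k \<le> \<bar>m\<bar> / k" using freq_ge(1)[of k m] by (intro divide_left_mono) auto
  then show "norm (complex_of_real (m / freq m k) - 0) \<le> \<bar>m\<bar> / k"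
    using freq_pos[of k m] k by (simp add: norm_divide)
qed simp

lemma ratio_bounds: "k \<noteq> 0 \<Longrightarrow> norm (complex_of_real (k / freq m k)) \<le> 1" "k \<noteq> 0 \<Longrightarrow> norm (complex_of_real (m / freq m k)) \<le> 1"
  using freq_ge[where k = k and m = m] freq_pos[of k m] by (simp_all add: norm_divide)

section \<open>Convergence of the defining integrals\<close>

text \<open>Only one phase occurs, \<open>\<xi> + \<epsilon> t\<close>, because the transform of the data is \<open>g 0 / (\<i> k) + O(1/k\<^sup>2)\<close> without oscillation.\<close>

lemma data_integral_half_convergent:
  assumes dec: "decaying ga" "decaying ga'" "decaying ga''" "decaying gb" "decaying gb'" "decaying gb''"
    and ga: "\<And>y. y \<ge> 0 \<Longrightarrow> (ga has_vector_derivative ga' y) (at y within {0..})"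
      "\<And>y. y \<ge> 0 \<Longrightarrow> (ga' has_vector_derivative ga'' y) (at y within {0..})"
    and gb: "\<And>y. y \<ge> 0 \<Longrightarrow> (gb has_vector_derivative gb' y) (at y within {0..})"
      "\<And>y. y \<ge> 0 \<Longrightarrow> (gb' has_vector_derivative gb'' y) (at y within {0..})"
    and signs: "\<epsilon> = 1 \<or> \<epsilon> = -1" "\<delta> = 1 \<or> \<delta> = -1"
    and u: "\<xi> + \<epsilon> * t \<noteq> 0"
  shows "half_convergent (\<lambda>k. cis (k * \<xi> + \<epsilon> * freq m k * t) * (c1 * of_real (k / freq m k) * half_line_fourier ga (\<delta> * k)
    + (c2 + c3 * of_real (m / freq m k)) * half_line_fourier gb (\<delta> * k)))" (is "half_convergent ?f")
proof -
  let ?D = "c1 * 1 * (ga 0 / (\<i> * of_real \<delta>)) + (c2 + c3 * 0) * (gb 0 / (\<i> * of_real \<delta>))"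
  have "near1 ?f (\<lambda>k. cis (k * (\<xi> + \<epsilon> * t)) * ?D)"
    by (intro near01_mult near1_add near0_add near0_mult near0_const near0_wave signs near0_ratio near0_mass
        half_line_fourier_asymptotics[OF dec(1-3) ga] half_line_fourier_asymptotics[OF dec(4-6) gb])
  from near1D[OF this] obtain C where C: "\<forall>k\<ge>1. norm (?f k - cis (k * (\<xi> + \<epsilon> * t)) * ?D / of_real k) \<le> C / k ^ 2" ..
  let ?Na = "integral {0..} (\<lambda>y. norm (ga y))" and ?Nb = "integral {0..} (\<lambda>y. norm (gb y))"
  show ?thesis
  proof (rule half_convergentI[OF _ _ u zero_neq_one[symmetric]])
    have cont: "continuous_on {0<..} (\<lambda>k::real. half_line_fourier g (\<delta> * k))" if "decaying g" for g
      by (rule continuous_on_compose2[OF continuous_on_half_line_fourier[OF that, of UNIV]]) (auto intro!: continuous_intros)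
    show "continuous_on {0<..} ?f"
      using freq_pos[of _ m] by (intro continuous_intros cont dec) (auto simp: less_imp_neq[symmetric] intro!: less_imp_neq[symmetric])
    show "norm (?f k) \<le> norm c1 * 1 * ?Na + (norm c2 + norm c3 * 1) * ?Nb" if "0 < k" "k \<le> 1" for k
    proof -
      have n: "0 \<le> ?Na" "0 \<le> ?Nb"
        using half_line_fourier_bound[OF dec(1), of 0] half_line_fourier_bound[OF dec(4), of 0] norm_ge_zero order_trans by blast+
      have "norm (?f k) = norm (c1 * of_real (k / freq m k) * half_line_fourier ga (\<delta> * k)
          + (c2 + c3 * of_real (m / freq m k)) * half_line_fourier gb (\<delta> * k))"
        by (simp only: norm_mult norm_cis mult_1)
      also have "\<dots> \<le> norm c1 * 1 * ?Na + (norm c2 + norm c3 * 1) * ?Nb"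
      proof (rule norm_triangle_mono)
        show "norm (c1 * of_real (k / freq m k) * half_line_fourier ga (\<delta> * k)) \<le> norm c1 * 1 * ?Na"
          unfolding norm_mult using ratio_bounds(1)[of k m] that n
          by (intro mult_mono half_line_fourier_bound dec) auto
        have "norm (c3 * of_real (m / freq m k)) \<le> norm c3 * 1"
          unfolding norm_mult using ratio_bounds(2)[of k m] that by (intro mult_left_mono) auto
        then have "norm (c2 + c3 * of_real (m / freq m k)) \<le> norm c2 + norm c3 * 1"
          by (rule norm_triangle_mono[OF order_refl])
        then show "norm ((c2 + c3 * of_real (m / freq m k)) * half_line_fourier gb (\<delta> * k)) \<le> (norm c2 + norm c3 * 1) * ?Nb"
          unfolding norm_mult[of "c2 + c3 * of_real (m / freq m k)"] using n
          by (intro mult_mono half_line_fourier_bound dec) auto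
      qed
      finally show ?thesis .
    qed
    show "norm (?f k - (?D * cis (k * (\<xi> + \<epsilon> * t)) + 0 * cis (k * 1)) / of_real k) \<le> C / k ^ 2" if "k \<ge> 1" for k
    proof -
      have "?D * cis (k * (\<xi> + \<epsilon> * t)) + 0 * cis (k * 1) = cis (k * (\<xi> + \<epsilon> * t)) * ?D"
        by (simp only: mult_zero_left add_0_right mult.commute)
      then show ?thesis using C[rule_format, OF that] by (simp only:)
    qed
  qed
qed

lemma data_integral_line_convergent:
  assumes dec: "decaying ga" "decaying ga'" "decaying ga''" "decaying gb" "decaying gb'" "decaying gb''"
    and ga: "\<And>y. y \<ge> 0 \<Longrightarrow> (ga has_vector_derivative ga' y) (at y within {0..})"
      "\<And>y. y \<ge> 0 \<Longrightarrow> (ga' has_vector_derivative ga'' y) (at y within {0..})"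
    and gb: "\<And>y. y \<ge> 0 \<Longrightarrow> (gb has_vector_derivative gb' y) (at y within {0..})"
      "\<And>y. y \<ge> 0 \<Longrightarrow> (gb' has_vector_derivative gb'' y) (at y within {0..})"
    and signs: "\<epsilon> = 1 \<or> \<epsilon> = -1" "\<delta> = 1 \<or> \<delta> = -1"
    and xt: "x > 0" "t > 0" "x \<noteq> t"
  shows "line_convergent (\<lambda>k. cis (k * x + \<epsilon> * freq m k * t) * (c1 * of_real (k / freq m k) * half_line_fourier ga (\<delta> * k)
    + (c2 + c3 * of_real (m / freq m k)) * half_line_fourier gb (\<delta> * k)))"
  unfolding line_convergent_def
proof
  note conv = data_integral_half_convergent[OF dec ga gb signs(1)]
  show "half_convergent (\<lambda>k. cis (k * x + \<epsilon> * freq m k * t) * (c1 * of_real (k / freq m k) * half_line_fourier ga (\<delta> * k)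
    + (c2 + c3 * of_real (m / freq m k)) * half_line_fourier gb (\<delta> * k)))"
    by (rule conv) (use signs xt in auto)
  have "half_convergent (\<lambda>k. cis (k * (- x) + \<epsilon> * freq m k * t) * ((- c1) * of_real (k / freq m k) * half_line_fourier ga ((- \<delta>) * k)
    + (c2 + c3 * of_real (m / freq m k)) * half_line_fourier gb ((- \<delta>) * k)))"
    by (rule conv) (use signs xt in auto)
  then show "half_convergent (\<lambda>k. cis ((- k) * x + \<epsilon> * freq m (- k) * t) * (c1 * of_real ((- k) / freq m (- k)) * half_line_fourier ga (\<delta> * (- k))
    + (c2 + c3 * of_real (m / freq m (- k))) * half_line_fourier gb (\<delta> * (- k))))"
    by simp
qed

text \<open>The end points \<open>0\<close> and \<open>t\<close> of the time integral produce the two phases \<open>\<xi> - \<sigma> t\<close> and \<open>\<xi>\<close>.\<close>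

lemma boundary_integral_half_convergent:
  assumes h: "\<And>y. y \<in> {0..t} \<Longrightarrow> (h has_vector_derivative h' y) (at y within {0..t})"
      "\<And>y. y \<in> {0..t} \<Longrightarrow> (h' has_vector_derivative h'' y) (at y within {0..t})"
    and h'': "continuous_on {0..t} h''"
    and signs: "\<sigma> = 1 \<or> \<sigma> = -1" and u: "\<xi> \<noteq> 0" "\<xi> - \<sigma> * t \<noteq> 0" and t: "t > 0"
  shows "half_convergent (\<lambda>k. cis (k * \<xi>) * (c1 * of_real (k / freq m k) + c2 + c3 * of_real (m / freq m k))
    * (cis (- (\<sigma> * freq m k * t)) * integral {0..t} (\<lambda>y. h y * cis (\<sigma> * freq m k * y))))" (is "half_convergent ?f")
proof -
  let ?amp = "\<lambda>k. c1 * of_real (k / freq m k) + c2 + c3 * of_real (m / freq m k)"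
  let ?L = "\<lambda>k. (h 0 * cis (k * (0 + (- \<sigma>) * t)) + (- h t)) * (1 / (- (\<i> * of_real \<sigma>)))"
  have ch: "continuous_on {0..t} h"
    unfolding continuous_on_eq_continuous_within using h has_vector_derivative_continuous by blast
  define J where "J k = cis (- (\<sigma> * freq m k * t)) * integral {0..t} (\<lambda>y. h y * cis (\<sigma> * freq m k * y))" for k
  define p where "p k = of_real (k / freq m k) * ((h 0 * cis (k * 0 + (- \<sigma>) * freq m k * t) + (- h t)) * (1 / (- (\<i> * of_real \<sigma>))))" for k
  let ?C = "norm (h' 0) + norm (h' t) + integral {0..t} (\<lambda>y. norm (h'' y))"
  have p: "near0 p (\<lambda>k. 1 * ?L k)"
    unfolding p_def using signs by (intro near0_mult near0_add near0_const near0_ratio near0_wave) auto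
  have "near1 (\<lambda>k. J k - p k / of_real k) (\<lambda>k. 0)"
  proof (rule near1I[of _ 0 _ ?C])
    fix k :: real assume k: "k \<ge> 1"
    let ?\<kappa> = "- (\<sigma> * freq m k)"
    have f: "freq m k \<ge> k" using freq_ge(1)[of k m] by simp
    have \<kappa>: "?\<kappa> \<noteq> 0" using f k signs by auto
    have "p k / of_real k = cis (?\<kappa> * t) * ((h 0 - cis (- (?\<kappa> * t)) * h t) / (\<i> * of_real ?\<kappa>))"
    proof -
      have "cis (?\<kappa> * t) * (h 0 - cis (- (?\<kappa> * t)) * h t) = h 0 * cis (?\<kappa> * t) - h t"
      proof -
        have "cis (?\<kappa> * t) * cis (- (?\<kappa> * t)) = 1" by (simp only: cis_mult) simp
        then have "cis (?\<kappa> * t) * (cis (- (?\<kappa> * t)) * h t) = h t" by (simp only: mult.assoc[symmetric] mult_1_left)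
        then show ?thesis by (simp only: right_diff_distrib mult.commute)
      qed
      moreover have "of_real (k / freq m k) * (1 / (- (\<i> * of_real \<sigma>))) / of_real k = 1 / (\<i> * of_real ?\<kappa>)"
      proof -
        have "complex_of_real (k / freq m k) = of_real k / of_real (freq m k)" by simp
        then show ?thesis using k f by (simp only:) simp
      qed
      moreover have "p k / of_real k = (h 0 * cis (?\<kappa> * t) - h t) * (of_real (k / freq m k) * (1 / (- (\<i> * of_real \<sigma>))) / of_real k)"
      proof -
        have "k * 0 + (- \<sigma>) * freq m k * t = ?\<kappa> * t" by simp
        then have "p k = of_real (k / freq m k) * ((h 0 * cis (?\<kappa> * t) - h t) * (1 / (- (\<i> * of_real \<sigma>))))"
          unfolding p_def by (simp only: add_uminus_conv_diff)
        moreover have "a * (b * c) / d = b * (a * c / d)" for a b c d :: complex by simp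
        ultimately show ?thesis by (simp only:)
      qed
      ultimately show ?thesis by (simp only: times_divide_eq_right mult_1_right)
    qed
    moreover have "J k = cis (?\<kappa> * t) * integral {0..t} (\<lambda>y. cis (- (?\<kappa> * y)) * h y)"
      unfolding J_def by (simp add: mult.commute)
    ultimately have "J k - p k / of_real k = cis (?\<kappa> * t) * (integral {0..t} (\<lambda>y. cis (- (?\<kappa> * y)) * h y) - (h 0 - cis (- (?\<kappa> * t)) * h t) / (\<i> * of_real ?\<kappa>))"
      by (simp only: right_diff_distrib)
    also have "norm \<dots> \<le> ?C / ?\<kappa> ^ 2"
      unfolding norm_mult norm_cis mult_1
      by (rule interval_fourier_asymptotics[OF _ \<kappa> h h'']) (use t in auto)
    also have "\<dots> \<le> ?C / k ^ 2"
    proof (rule divide_left_mono)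
      show "k ^ 2 \<le> ?\<kappa> ^ 2" using f k signs by (auto intro!: power_mono simp: power_mult_distrib)
      show "0 \<le> ?C" by (intro add_nonneg_nonneg integral_nonneg integrable_continuous_real continuous_intros h'') auto
      show "0 < ?\<kappa>\<^sup>2 * k\<^sup>2" using \<kappa> k by auto
    qed
    finally show "norm (J k - p k / of_real k - 0 / of_real k) \<le> ?C / k ^ 2" by simp
  qed simp
  from near1_add[OF this near0_imp_near1[OF p]]
  have J: "near1 J (\<lambda>k. 0 + 1 * ?L k)" by simp
  have w: "near0 (\<lambda>k. cis (k * \<xi>)) (\<lambda>k. cis (k * \<xi>))" by (rule near0I[of _ 1 _ 0]) auto
  have "near1 (\<lambda>k. cis (k * \<xi>) * ?amp k * J k)
    (\<lambda>k. cis (k * \<xi>) * (c1 * 1 + c2 + c3 * 0) * (0 + 1 * ?L k))"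
    by (intro near01_mult near0_mult near0_add near0_const w near0_ratio near0_mass J)
  from near1D[OF this] obtain C where C: "\<forall>k\<ge>1. norm (cis (k * \<xi>) * ?amp k * J k
     - cis (k * \<xi>) * (c1 * 1 + c2 + c3 * 0) * (0 + 1 * ?L k) / of_real k) \<le> C / k ^ 2" ..
  let ?a = "(c1 + c2) * h 0 * (1 / (- (\<i> * of_real \<sigma>)))" and ?b = "- (c1 + c2) * h t * (1 / (- (\<i> * of_real \<sigma>)))"
  let ?N = "integral {0..t} (\<lambda>y. norm (h y))"
  show ?thesis
    unfolding J_def[symmetric]
  proof (rule half_convergentI[OF _ _ u(2,1)])
    have "continuous_on S (\<lambda>k. integral {0..t} (\<lambda>y. h y * cis (\<sigma> * freq m k * y)))" for S
      by (rule continuous_on_parameter_integral) (intro continuous_intros continuous_on_compose2[OF ch], auto)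
    then have "continuous_on {0<..} J" unfolding J_def by (intro continuous_intros)
    then show "continuous_on {0<..} (\<lambda>k. cis (k * \<xi>) * ?amp k * J k)"
      using freq_pos[of _ m] by (intro continuous_intros) (auto intro!: less_imp_neq[symmetric])
    show "norm (cis (k * \<xi>) * ?amp k * J k)
       \<le> (norm c1 * 1 + norm c2 + norm c3 * 1) * ?N" if "0 < k" "k \<le> 1" for k
    proof -
      have "norm (integral {0..t} (\<lambda>y. h y * cis (\<sigma> * freq m k * y))) \<le> ?N"
        by (intro Henstock_Kurzweil_Integration.integral_norm_bound_integral integrable_continuous_real continuous_intros ch)
          (simp add: norm_mult)
      then have N: "norm (J k) \<le> ?N" unfolding J_def by (simp add: norm_mult)
      have "norm (c1 * of_real (k / freq m k)) \<le> norm c1 * 1" "norm (c3 * of_real (m / freq m k)) \<le> norm c3 * 1"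
        unfolding norm_mult using ratio_bounds[of k m] that by (intro mult_left_mono; simp)+
      then have "norm (?amp k) \<le> norm c1 * 1 + norm c2 + norm c3 * 1"
        by (intro norm_triangle_mono order_refl)
      then show ?thesis unfolding norm_mult[of _ "J k"] norm_mult[of "cis (k * \<xi>)"] norm_cis mult_1
        using N by (intro mult_mono order_trans[OF norm_ge_zero N]) auto
    qed
    show "norm (cis (k * \<xi>) * ?amp k * J k
       - (?a * cis (k * (\<xi> - \<sigma> * t)) + ?b * cis (k * \<xi>)) / of_real k) \<le> C / k ^ 2" if "k \<ge> 1" for k
    proof -
      have "cis (k * (\<xi> - \<sigma> * t)) = cis (k * \<xi>) * cis (k * (0 + (- \<sigma>) * t))"
        by (simp add: cis_mult algebra_simps)
      then have "?a * cis (k * (\<xi> - \<sigma> * t)) + ?b * cis (k * \<xi>) =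
        cis (k * \<xi>) * (c1 * 1 + c2 + c3 * 0) * (0 + 1 * ?L k)"
        by (simp add: algebra_simps add_divide_distrib diff_divide_distrib)
      then show ?thesis using C[rule_format, OF that] by (simp only:)
    qed
  qed
qed

lemma boundary_integral_line_convergent:
  assumes h: "\<And>y. y \<in> {0..t} \<Longrightarrow> (h has_vector_derivative h' y) (at y within {0..t})"
      "\<And>y. y \<in> {0..t} \<Longrightarrow> (h' has_vector_derivative h'' y) (at y within {0..t})"
    and h'': "continuous_on {0..t} h''"
    and signs: "\<sigma> = 1 \<or> \<sigma> = -1" and xt: "x > 0" "t > 0" "x \<noteq> t"
  shows "line_convergent (\<lambda>k. cis (k * x) * (c1 * of_real (k / freq m k) + c2 + c3 * of_real (m / freq m k))
    * (cis (- (\<sigma> * freq m k * t)) * integral {0..t} (\<lambda>y. h y * cis (\<sigma> * freq m k * y))))"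
  unfolding line_convergent_def
proof
  note conv = boundary_integral_half_convergent[OF h h'' signs]
  show "half_convergent (\<lambda>k. cis (k * x) * (c1 * of_real (k / freq m k) + c2 + c3 * of_real (m / freq m k))
    * (cis (- (\<sigma> * freq m k * t)) * integral {0..t} (\<lambda>y. h y * cis (\<sigma> * freq m k * y))))"
    by (rule conv) (use signs xt in auto)
  have "half_convergent (\<lambda>k. cis (k * (- x)) * ((- c1) * of_real (k / freq m k) + c2 + c3 * of_real (m / freq m k))
    * (cis (- (\<sigma> * freq m k * t)) * integral {0..t} (\<lambda>y. h y * cis (\<sigma> * freq m k * y))))"
    by (rule conv) (use signs xt in auto)
  then show "half_convergent (\<lambda>k. cis ((- k) * x) * (c1 * of_real ((- k) / freq m (- k)) + c2 + c3 * of_real (m / freq m (- k)))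
    * (cis (- (\<sigma> * freq m (- k) * t)) * integral {0..t} (\<lambda>y. h y * cis (\<sigma> * freq m (- k) * y))))"
    by simp
qed

section \<open>Smooth data on the half-line\<close>

lemma half_line_derivative:
  assumes "smooth_on {0..} f"
  shows "x \<ge> 0 \<Longrightarrow> (f has_vector_derivative vector_derivative f (at x within {0..})) (at x within {0..})"
    and "smooth_on {0..} (\<lambda>x. vector_derivative f (at x within {0..}))"
proof -
  have bot: "at x within {0..} \<noteq> bot" if "x \<ge> 0" for x :: real
  proof -
    have "\<nexists>y. {0..} = {y::real}"
    proof
      assume "\<exists>y. {0..} = {y::real}"
      then obtain y :: real where "{0..} = {y}" ..
      moreover have "(0::real) \<in> {0..}" "(1::real) \<in> {0..}" by auto
      ultimately show False by auto
    qed
    then have "x islimpt {0..}" using that by (intro connected_imp_perfect) auto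
    then show ?thesis using trivial_limit_within by blast
  qed
  have eq: "vector_derivative f (at x within {0..}) = D x 1" "(f has_vector_derivative D x 1) (at x within {0..})"
    if "x \<ge> 0" "\<forall>p\<in>{0..}. (f has_derivative D p) (at p within {0..})" for D x
  proof -
    have d: "(f has_derivative D x) (at x within {0..})" using that by simp
    have "D x h = h *\<^sub>R D x 1" for h
      using linear_scale[OF has_derivative_linear[OF d], of h 1] by simp
    then have "D x = (\<lambda>h. h *\<^sub>R D x 1)" by (rule ext)
    then show v: "(f has_vector_derivative D x 1) (at x within {0..})"
      using d unfolding has_vector_derivative_def by (rule has_derivative_eq_rhs[rotated])
    show "vector_derivative f (at x within {0..}) = D x 1"
      by (rule vector_derivative_within[OF bot[OF that(1)] v])
  qed
  show "(f has_vector_derivative vector_derivative f (at x within {0..})) (at x within {0..})" if "x \<ge> 0"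
  proof -
    have "Ck_on (Suc 0) {0..} f" using assms unfolding smooth_on_def by blast
    then obtain D where "\<forall>p\<in>{0..}. (f has_derivative D p) (at p within {0..})" by auto
    from eq[OF that this] show ?thesis by (simp only:)
  qed
  show "smooth_on {0..} (\<lambda>x. vector_derivative f (at x within {0..}))"
    unfolding smooth_on_def
  proof
    fix k
    have "Ck_on (Suc k) {0..} f" using assms unfolding smooth_on_def by blast
    then obtain D where D: "\<forall>p\<in>{0..}. (f has_derivative D p) (at p within {0..})" "\<forall>v. Ck_on k {0..} (\<lambda>p. D p v)" by auto
    show "Ck_on k {0..} (\<lambda>x. vector_derivative f (at x within {0..}))"
      by (rule Ck_on_cong[OF _ D(2)[rule_format, of 1]]) (use eq(1)[OF _ D(1)] in simp)
  qed
qed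

lemma smooth_on_half_line_deriv:
  assumes "smooth_on {0..} f"
  shows "smooth_on {0..} (half_line_deriv b f)"
proof (induction b)
  case 0
  then show ?case using assms by (simp add: half_line_deriv_def)
next
  case (Suc b)
  then show ?case using half_line_derivative(2)[OF Suc] by (simp add: half_line_deriv_def)
qed

lemma half_line_deriv_Suc:
  assumes "smooth_on {0..} f" "x \<ge> 0"
  shows "(half_line_deriv b f has_vector_derivative half_line_deriv (Suc b) f x) (at x within {0..})"
  using half_line_derivative(1)[OF smooth_on_half_line_deriv[OF assms(1), of b] assms(2)]
  by (simp add: half_line_deriv_def)

lemma half_line_deriv_0 [simp]: "half_line_deriv 0 f = f"
  by (simp add: half_line_deriv_def)

lemma schwartz_decaying:
  assumes "g \<in> schwartz_half_line"
  shows "decaying (half_line_deriv b g)"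
proof -
  have sm: "smooth_on {0..} g"
    and bd: "\<And>a b. bdd_above ((\<lambda>x. x ^ a * norm (half_line_deriv b g x)) ` {0..})"
    using assms unfolding schwartz_half_line_def by auto
  obtain C0 where C0: "\<And>x. x \<ge> 0 \<Longrightarrow> norm (half_line_deriv b g x) \<le> C0"
    using bd[of 0 b] unfolding bdd_above_def by auto
  obtain C2 where C2: "\<And>x. x \<ge> 0 \<Longrightarrow> x ^ 2 * norm (half_line_deriv b g x) \<le> C2"
    using bd[of 2 b] unfolding bdd_above_def by auto
  have "norm (half_line_deriv b g x) \<le> max C0 C2 * majorant x" if "x \<ge> 0" for x
  proof (cases "x \<le> 1")
    case True
    then show ?thesis using C0[OF that] by (simp add: majorant_def)
  next
    case False
    then have "norm (half_line_deriv b g x) \<le> C2 / x ^ 2"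
      using C2[OF that] by (simp add: pos_le_divide_eq mult.commute)
    also have "\<dots> \<le> max C0 C2 / x ^ 2" by (intro divide_right_mono) auto
    finally show ?thesis using False by (simp add: majorant_def)
  qed
  then show ?thesis
    using smooth_on_imp_continuous_on[OF smooth_on_half_line_deriv[OF sm]] unfolding decaying_def by blast
qed

lemma schwartz_data:
  assumes "g \<in> schwartz_half_line"
  shows "decaying g" "decaying (half_line_deriv 1 g)" "decaying (half_line_deriv 2 g)"
    and "\<And>y. y \<ge> 0 \<Longrightarrow> (g has_vector_derivative half_line_deriv 1 g y) (at y within {0..})"
    and "\<And>y. y \<ge> 0 \<Longrightarrow> (half_line_deriv 1 g has_vector_derivative half_line_deriv 2 g y) (at y within {0..})"
proof -
  have sm: "smooth_on {0..} g" using assms unfolding schwartz_half_line_def by blast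
  show "decaying g" "decaying (half_line_deriv 1 g)" "decaying (half_line_deriv 2 g)"
    using schwartz_decaying[OF assms, of 0] schwartz_decaying[OF assms] by simp_all
  show "(g has_vector_derivative half_line_deriv 1 g y) (at y within {0..})" if "y \<ge> 0" for y
    using half_line_deriv_Suc[OF sm that, of 0] by simp
  show "(half_line_deriv 1 g has_vector_derivative half_line_deriv 2 g y) (at y within {0..})" if "y \<ge> 0" for y
    using half_line_deriv_Suc[OF sm that, of 1] by (simp add: numeral_2_eq_2)
qed

lemma boundary_data:
  assumes "smooth_on {0..} h"
  shows "\<And>y. y \<in> {0..t} \<Longrightarrow> (h has_vector_derivative half_line_deriv 1 h y) (at y within {0..t})"
    and "\<And>y. y \<in> {0..t} \<Longrightarrow> (half_line_deriv 1 h has_vector_derivative half_line_deriv 2 h y) (at y within {0..t})"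
    and "continuous_on {0..t} (half_line_deriv 1 h)" "continuous_on {0..t} (half_line_deriv 2 h)"
proof -
  show "(h has_vector_derivative half_line_deriv 1 h y) (at y within {0..t})" if "y \<in> {0..t}" for y
    using half_line_deriv_Suc[OF assms, of y 0] that by (auto intro: has_vector_derivative_within_subset)
  show "(half_line_deriv 1 h has_vector_derivative half_line_deriv 2 h y) (at y within {0..t})" if "y \<in> {0..t}" for y
    using half_line_deriv_Suc[OF assms, of y 1] that
    by (auto simp: numeral_2_eq_2 intro: has_vector_derivative_within_subset)
  show "continuous_on {0..t} (half_line_deriv 1 h)" "continuous_on {0..t} (half_line_deriv 2 h)"
    by (rule continuous_on_subset[OF smooth_on_imp_continuous_on[OF smooth_on_half_line_deriv[OF assms]]], auto)+
qed

section \<open>The symbols of the problem\<close>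

text \<open>The density of \<open>cos (\<rho> s) + c sin (\<rho> s) / \<rho>\<close>.\<close>

definition kernel_mix :: "real \<Rightarrow> complex \<Rightarrow> real \<Rightarrow> real \<Rightarrow> complex" where
  "kernel_mix m c u s = kernel_cos m u s + c * kernel_sin m u s"

lemma smooth_on_of_real_add: "smooth_on S (\<lambda>p. complex_of_real (f p)) \<Longrightarrow> smooth_on S (\<lambda>p. complex_of_real (g p)) \<Longrightarrow>
    smooth_on S (\<lambda>p. complex_of_real (f p + g p))"
  and smooth_on_of_real_diff: "smooth_on S (\<lambda>p. complex_of_real (f p)) \<Longrightarrow> smooth_on S (\<lambda>p. complex_of_real (g p)) \<Longrightarrow>
    smooth_on S (\<lambda>p. complex_of_real (f p - g p))"
  and smooth_on_of_real_mult: "smooth_on S (\<lambda>p. complex_of_real (f p)) \<Longrightarrow> smooth_on S (\<lambda>p. complex_of_real (g p)) \<Longrightarrow>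
    smooth_on S (\<lambda>p. complex_of_real (f p * g p))"
  and smooth_on_of_real_minus: "smooth_on S (\<lambda>p. complex_of_real (f p)) \<Longrightarrow> smooth_on S (\<lambda>p. complex_of_real (- f p))"
  unfolding of_real_add of_real_diff of_real_mult of_real_minus
  by (intro smooth_on_add smooth_on_diff smooth_on_mult smooth_on_uminus; assumption)+

lemmas smooth_on_of_real_intros =
  smooth_on_of_real_add smooth_on_of_real_diff smooth_on_of_real_mult smooth_on_of_real_minus smooth_on_const
  smooth_on_linear[OF bounded_linear_fst] smooth_on_linear[OF bounded_linear_snd]
  smooth_on_linear[OF bounded_linear_compose[OF bounded_linear_fst bounded_linear_fst]]
  smooth_on_linear[OF bounded_linear_compose[OF bounded_linear_snd bounded_linear_fst]]

lemma smooth_on_kernels: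
  "smooth_on UNIV (\<lambda>p. kernel_sin m (fst p) (snd p))"
  "smooth_on UNIV (\<lambda>p. kernel_cos m (fst p) (snd p))"
  "smooth_on UNIV (\<lambda>p. kernel_dsin m (fst p) (snd p))"
  "smooth_on UNIV (\<lambda>p. kernel_mix m c (fst p) (snd p))"
proof -
  have a: "smooth_on UNIV (\<lambda>p::real \<times> real. complex_of_real (m\<^sup>2 * ((snd p)\<^sup>2 - (fst p)\<^sup>2)))"
    unfolding power2_eq_square by (intro smooth_on_of_real_intros)
  have 0: "smooth_on UNIV (\<lambda>p. bessel_profile (m\<^sup>2 * ((snd p)\<^sup>2 - (fst p)\<^sup>2)))"
    "smooth_on UNIV (\<lambda>p. bessel_profile' (m\<^sup>2 * ((snd p)\<^sup>2 - (fst p)\<^sup>2)))"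
    by (rule smooth_on_compose_real[OF smooth_on_bessel_profile[of UNIV] a], simp)
      (rule smooth_on_compose_real[OF smooth_on_bessel_profile'[of UNIV] a], simp)
  show 1: "smooth_on UNIV (\<lambda>p. kernel_sin m (fst p) (snd p))"
    unfolding kernel_sin_def divide_inverse by (intro smooth_on_mult 0 smooth_on_const)
  show 2: "smooth_on UNIV (\<lambda>p. kernel_cos m (fst p) (snd p))"
    unfolding kernel_cos_def by (intro smooth_on_mult 0 smooth_on_of_real_intros)
  show "smooth_on UNIV (\<lambda>p. kernel_dsin m (fst p) (snd p))"
    unfolding kernel_dsin_def by (intro smooth_on_mult 0 smooth_on_uminus smooth_on_of_real_intros)
  show "smooth_on UNIV (\<lambda>p. kernel_mix m c (fst p) (snd p))"
    unfolding kernel_mix_def by (intro smooth_on_add smooth_on_mult smooth_on_const 1 2)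
qed

lemma symbol_dsin_eq:
  assumes "k \<noteq> 0"
  shows "symbol (1/2) (- 1/2) (kernel_dsin m) k s = \<i> * of_real (k / freq m k) * of_real (sin (freq m k * s))"
proof -
  have "complex_of_real (freq m k) * symbol (1/2) (- 1/2) (kernel_dsin m) k s = \<i> * of_real k * of_real (sin (freq m k * s))"
    by (rule symbol_dsin[OF freq_square])
  then show ?thesis using freq_pos[OF assms, of m] by (simp add: field_simps)
qed

lemma symbol_mix_eq:
  assumes "k \<noteq> 0"
  shows "symbol (1/2) (1/2) (kernel_mix m (c * of_real m)) k s =
    of_real (cos (freq m k * s)) + c * of_real (m / freq m k) * of_real (sin (freq m k * s))"
proof -
  note ck = smooth_on_imp_continuous_on[OF smooth_on_kernels(1)[of m]] smooth_on_imp_continuous_on[OF smooth_on_kernels(2)[of m]]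
  have "integral {-1..1} (\<lambda>r. kernel_mix m (c * of_real m) (s * r) s * cis (- (k * (s * r)))) =
     integral {-1..1} (\<lambda>r. kernel_cos m (s * r) s * cis (- (k * (s * r)))) +
     (c * of_real m) * integral {-1..1} (\<lambda>r. kernel_sin m (s * r) s * cis (- (k * (s * r))))"
  proof (rule integral_unique)
    have "((\<lambda>r. kernel_cos m (s * r) s * cis (- (k * (s * r))) + (c * of_real m) * (kernel_sin m (s * r) s * cis (- (k * (s * r))))) has_integral
      integral {-1..1} (\<lambda>r. kernel_cos m (s * r) s * cis (- (k * (s * r)))) +
     (c * of_real m) * integral {-1..1} (\<lambda>r. kernel_sin m (s * r) s * cis (- (k * (s * r))))) {-1..1}"
      by (intro has_integral_add has_integral_mult_right integrable_integral integrable_continuous_real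
          continuous_intros continuous_on_kernel[OF ck(1)] continuous_on_kernel[OF ck(2)])
    then show "((\<lambda>r. kernel_mix m (c * of_real m) (s * r) s * cis (- (k * (s * r)))) has_integral
      integral {-1..1} (\<lambda>r. kernel_cos m (s * r) s * cis (- (k * (s * r)))) +
     (c * of_real m) * integral {-1..1} (\<lambda>r. kernel_sin m (s * r) s * cis (- (k * (s * r))))) {-1..1}"
      by (rule has_integral_eq[rotated]) (simp add: kernel_mix_def distrib_right)
  qed
  then have "symbol (1/2) (1/2) (kernel_mix m (c * of_real m)) k s =
     symbol (1/2) (1/2) (kernel_cos m) k s + c * of_real m * symbol 0 0 (kernel_sin m) k s"
    unfolding symbol_cis by (simp add: distrib_left mult_ac)
  moreover have "symbol 0 0 (kernel_sin m) k s = of_real (sin (freq m k * s)) / of_real (freq m k)"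
    using symbol_sin_cos(1)[OF freq_square, of m k s] freq_pos[OF assms, of m] by (simp add: field_simps)
  ultimately show ?thesis using symbol_sin_cos(2)[OF freq_square, of m k s] by simp
qed

section \<open>Propagators\<close>

text \<open>A multiplier applied to the continuation of \<open>g\<close> by zero: translates from the masses, a convolution from
  the density.\<close>

definition half_line_propagator ::
    "complex \<Rightarrow> complex \<Rightarrow> (real \<Rightarrow> real \<Rightarrow> complex) \<Rightarrow> (real \<Rightarrow> complex) \<Rightarrow> real \<Rightarrow> real \<Rightarrow> complex" where
  "half_line_propagator \<alpha> \<beta> \<kappa> g x t = \<alpha> * half_line_extension g (x + t) + \<beta> * half_line_extension g (x - t)
      + of_real t * integral {-1..1} (\<lambda>r. \<kappa> (t * r) t * half_line_extension g (x - t * r))"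

definition boundary_propagator ::
    "complex \<Rightarrow> (real \<Rightarrow> real \<Rightarrow> complex) \<Rightarrow> (real \<Rightarrow> complex) \<Rightarrow> real \<Rightarrow> real \<Rightarrow> complex" where
  "boundary_propagator \<beta> \<kappa> h x t =
     (if x < t then \<beta> * h (t - x) + integral {0..t - x} (\<lambda>y. h y * \<kappa> x (t - y)) else 0)"

text \<open>For \<open>\<delta> = - 1\<close> the substitution of \<open>- k\<close> for \<open>k\<close> exchanges reflected data at \<open>x\<close> with the data themselves
  at \<open>- x\<close>; the parity \<open>\<theta>\<close> of the symbol remains as a factor.\<close>

lemma signed_symbol_inversion:
  assumes g: "g \<in> schwartz_half_line" and \<kappa>: "continuous_on UNIV (\<lambda>p. \<kappa> (fst p) (snd p))"
    and \<delta>: "\<delta> = 1 \<or> \<delta> = -1" and \<theta>: "\<And>k. k \<noteq> 0 \<Longrightarrow> symbol \<alpha> \<beta> \<kappa> (\<delta> * k) t = \<theta> * symbol \<alpha> \<beta> \<kappa> k t" "\<theta> * \<theta> = 1"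
  shows "(\<lambda>n. integral {-real n..real n} (\<lambda>k. cis (k * x) * symbol \<alpha> \<beta> \<kappa> k t * half_line_fourier g (\<delta> * k)))
    \<longlonglongrightarrow> 2 * of_real pi * (\<theta> * half_line_propagator \<alpha> \<beta> \<kappa> g (\<delta> * x) t)"
proof -
  let ?f = "\<lambda>k. cis (k * (\<delta> * x)) * symbol \<alpha> \<beta> \<kappa> k t * half_line_fourier g k"
  let ?I = "\<lambda>n. integral {-real n..real n} ?f"
  have "integral {-real n..real n} (\<lambda>k. cis (k * x) * symbol \<alpha> \<beta> \<kappa> k t * half_line_fourier g (\<delta> * k)) = \<theta> * ?I n" for n
  proof -
    have "integral {-real n..real n} (\<lambda>k. cis (k * x) * symbol \<alpha> \<beta> \<kappa> k t * half_line_fourier g (\<delta> * k))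
       = integral {-real n..real n} (\<lambda>k. \<theta> * ?f (\<delta> * k))"
    proof (rule integral_spike[of "{0}"])
      fix k assume "k \<in> {-real n..real n} - {0}"
      then have 1: "\<theta> * symbol \<alpha> \<beta> \<kappa> (\<delta> * k) t = symbol \<alpha> \<beta> \<kappa> k t"
        using \<theta> by (simp add: mult.assoc[symmetric])
      have 2: "\<delta> * k * (\<delta> * x) = k * x" using \<delta> by auto
      show "\<theta> * ?f (\<delta> * k) = cis (k * x) * symbol \<alpha> \<beta> \<kappa> k t * half_line_fourier g (\<delta> * k)"
      proof -
        have "\<theta> * (a * b * c) = a * (\<theta> * b) * c" for a b c by simp
        then show ?thesis by (simp only: 1 2)
      qed
    qed simp
    also have "\<dots> = \<theta> * integral {-real n..real n} (\<lambda>k. ?f (\<delta> * k))" by (rule integral_mult_right)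
    also have "integral {-real n..real n} (\<lambda>k. ?f (\<delta> * k)) = ?I n"
      using \<delta> Henstock_Kurzweil_Integration.integral_reflect_real[of "real n" "- real n" ?f] by auto
    finally show ?thesis .
  qed
  moreover have "?I \<longlonglongrightarrow> 2 * of_real pi * half_line_propagator \<alpha> \<beta> \<kappa> g (\<delta> * x) t"
    unfolding half_line_propagator_def by (rule symbol_inversion_half_line[OF schwartz_data(1,2,4)[OF g] \<kappa>])
  from tendsto_mult_left[OF this, of \<theta>]
  have "(\<lambda>n. \<theta> * ?I n) \<longlonglongrightarrow> 2 * of_real pi * (\<theta> * half_line_propagator \<alpha> \<beta> \<kappa> g (\<delta> * x) t)"
    by (simp only: mult.left_commute)
  ultimately show ?thesis by (simp only:)
qed

section \<open>The solution in closed form\<close>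

lemma generalized_integral_spike:
  assumes "\<And>k. k \<noteq> 0 \<Longrightarrow> F k = G k"
  shows "generalized_integral F = generalized_integral G"
proof -
  have "integral {a..b} F = integral {a..b} G" for a b
    by (rule integral_spike[of "{0}"]) (use assms in auto)
  then show ?thesis unfolding generalized_integral_def by simp
qed

text \<open>Individual convergence comes first. Then the difference may be evaluated along symmetric truncations, where the
  two integrands can be combined into one that is easier to invert.\<close>

lemma generalized_integral_diff_eqI:
  assumes conv: "line_convergent F" "line_convergent G"
    and T: "\<And>k. k \<noteq> 0 \<Longrightarrow> F k - G k = T k" "(\<lambda>n. integral {-real n..real n} T) \<longlonglongrightarrow> L"
  shows "generalized_integral F - generalized_integral G = L"
proof (rule LIMSEQ_unique)
  show "(\<lambda>n. integral {-real n..real n} F - integral {-real n..real n} G) \<longlonglongrightarrow> generalized_integral F - generalized_integral G"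
    by (intro tendsto_diff line_convergent_integral(2) conv)
  have "integral {-real n..real n} F - integral {-real n..real n} G = integral {-real n..real n} T" for n
  proof -
    have "((\<lambda>k. F k - G k) has_integral integral {-real n..real n} F - integral {-real n..real n} G) {-real n..real n}"
      by (intro has_integral_diff integrable_integral line_convergent_integral(1) conv)
    then have "(T has_integral integral {-real n..real n} F - integral {-real n..real n} G) {-real n..real n}"
      by (rule has_integral_spike_finite[rotated 2, of _ _ _ "{0}"]) (use T(1) in auto)
    then show ?thesis by (simp only: integral_unique)
  qed
  then show "(\<lambda>n. integral {-real n..real n} F - integral {-real n..real n} G) \<longlonglongrightarrow> L" using T(2) by simp
qed

text \<open>The eight integrals of the initial data, in pairs of equal \<open>\<delta>\<close> with opposite signs \<open>\<epsilon>\<close> of the frequency. The sign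
  \<open>\<delta> = - 1\<close> marks reflected data, and \<open>\<mu> = \<plusminus> 1\<close> is the sign of the mass term.\<close>

definition data_integral ::
    "real \<Rightarrow> (real \<Rightarrow> complex) \<Rightarrow> (real \<Rightarrow> complex) \<Rightarrow> complex \<Rightarrow> real \<Rightarrow> real \<Rightarrow> real \<Rightarrow> real \<Rightarrow> complex" where
  "data_integral m ga gb \<mu> \<delta> \<epsilon> x t = generalized_integral (\<lambda>k. cis (k * x + \<epsilon> * freq m k * t) *
     ((1/2) * of_real (k / freq m k) * half_line_fourier ga (\<delta> * k)
      + (of_real (- \<delta> * \<epsilon> / 2) + of_real \<delta> * \<mu> / 2 * of_real (m / freq m k)) * half_line_fourier gb (\<delta> * k)))"

definition boundary_integral ::
    "real \<Rightarrow> (real \<Rightarrow> complex) \<Rightarrow> complex \<Rightarrow> complex \<Rightarrow> complex \<Rightarrow> real \<Rightarrow> real \<Rightarrow> real \<Rightarrow> complex" where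
  "boundary_integral m h c1 c2 c3 \<sigma> x t = generalized_integral (\<lambda>k.
     cis (k * x) * (c1 * of_real (k / freq m k) + c2 + c3 * of_real (m / freq m k))
      * (cis (- (\<sigma> * freq m k * t)) * integral {0..t} (\<lambda>y. h y * cis (\<sigma> * freq m k * y))))"

lemma rho_freq: "rho m k = of_real (freq m k)"
  by (simp add: rho_def freq_def)

lemma i_omega: "\<i> * omega1 m k = - of_real (freq m k)" "\<i> * omega2 m k = of_real (freq m k)"
  by (simp_all add: omega1_def omega2_def rho_freq)

lemma exp_omega:
  "exp (\<i> * of_real k * of_real x - omega1 m k * of_real t) = cis (k * x + (-1) * freq m k * t)"
  "exp (\<i> * of_real k * of_real x - omega2 m k * of_real t) = cis (k * x + 1 * freq m k * t)"
  "exp (omega1 m k * of_real y) = cis (1 * freq m k * y)"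
  "exp (omega2 m k * of_real y) = cis ((-1) * freq m k * y)"
  by (simp_all add: omega1_def omega2_def rho_freq cis_conv_exp algebra_simps)

lemma cis_omega: "cis (k * x + (-1) * r * t) = cis (k * x) * cis (- (1 * r * t))"
  "cis (k * x + 1 * r * t) = cis (k * x) * cis (- ((-1) * r * t))"
  by (simp_all add: cis_mult)

lemma G_eq_data_integral:
  "G11 m g1 g2 x t = data_integral m g2 g1 1 1 (-1) x t" "G12 m g1 g2 x t = data_integral m g2 g1 1 (-1) (-1) x t"
  "G13 m g1 g2 x t = data_integral m g2 g1 1 1 1 x t" "G14 m g1 g2 x t = data_integral m g2 g1 1 (-1) 1 x t"
  "G21 m g1 g2 x t = data_integral m g1 g2 (-1) 1 (-1) x t" "G22 m g1 g2 x t = data_integral m g1 g2 (-1) (-1) (-1) x t"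
  "G23 m g1 g2 x t = data_integral m g1 g2 (-1) 1 1 x t" "G24 m g1 g2 x t = data_integral m g1 g2 (-1) (-1) 1 x t"
  unfolding G11_def G12_def G13_def G14_def G21_def G22_def G23_def G24_def data_integral_def exp_omega i_omega rho_freq
  by (rule generalized_integral_spike, use freq_pos[of _ m] in \<open>force simp: field_simps\<close>)+

lemma H_eq_boundary_integral:
  "H11 m h x t = boundary_integral m h 1 0 0 1 x t" "H12 m h x t = boundary_integral m h 1 0 0 (-1) x t"
  "H21 m h x t = boundary_integral m h 0 (-1) 1 1 x t" "H22 m h x t = boundary_integral m h 0 1 1 (-1) x t"
  unfolding H11_def H12_def H21_def H22_def boundary_integral_def exp_omega i_omega rho_freq cis_omega
  by (rule generalized_integral_spike, use freq_pos[of _ m] in \<open>force simp: field_simps\<close>)+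

text \<open>The difference over the two signs of the frequency turns the exponentials into the derivative symbol acting on
  \<open>ga\<close> and the mixed symbol acting on \<open>gb\<close>.\<close>

lemma data_integral_diff:
  assumes g: "ga \<in> schwartz_half_line" "gb \<in> schwartz_half_line" and xt: "x > 0" "t > 0" "x \<noteq> t"
    and \<delta>: "\<delta> = 1 \<or> \<delta> = -1"
  shows "data_integral m ga gb \<mu> \<delta> (-1) x t - data_integral m ga gb \<mu> \<delta> 1 x t =
    2 * of_real pi * (of_real \<delta> * (half_line_propagator (1/2) (1/2) (kernel_mix m (- \<i> * \<mu> * of_real m)) gb (\<delta> * x) t
      - half_line_propagator (1/2) (- 1/2) (kernel_dsin m) ga (\<delta> * x) t))"
    (is "_ = 2 * of_real pi * (of_real \<delta> * (?Q - ?D))")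
proof -
  let ?E = "symbol (1/2) (- 1/2) (kernel_dsin m)" and ?P = "symbol (1/2) (1/2) (kernel_mix m (- \<i> * \<mu> * of_real m))"
  let ?a = "\<lambda>k. half_line_fourier ga (\<delta> * k)" and ?b = "\<lambda>k. half_line_fourier gb (\<delta> * k)"
  let ?fa = "\<lambda>k. cis (k * x) * ?E k t * ?a k" and ?fb = "\<lambda>k. cis (k * x) * ?P k t * ?b k"
  note ck = smooth_on_imp_continuous_on[OF smooth_on_kernels(3)[of m]]
    smooth_on_imp_continuous_on[OF smooth_on_kernels(4)[of m "- \<i> * \<mu> * of_real m"]]
  have E: "?E (\<delta> * k) t = of_real \<delta> * ?E k t" if "k \<noteq> 0" for k
    using \<delta> that symbol_dsin_eq[of k m t] symbol_dsin_eq[of "- k" m t] by auto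
  have P: "?P (\<delta> * k) t = 1 * ?P k t" if "k \<noteq> 0" for k
    using \<delta> that symbol_mix_eq[of k m "- \<i> * \<mu>" t] symbol_mix_eq[of "- k" m "- \<i> * \<mu>" t] by auto
  have \<delta>2: "complex_of_real \<delta> * complex_of_real \<delta> = 1" using \<delta> by auto
  have cg: "continuous_on A (\<lambda>k. half_line_fourier g (\<delta> * k))" if "g \<in> schwartz_half_line" for g A
    by (rule continuous_on_compose2[OF continuous_on_half_line_fourier[OF schwartz_data(1)[OF that], of UNIV]])
      (auto intro!: continuous_intros)
  have int: "?fa integrable_on {-real n..real n}" "?fb integrable_on {-real n..real n}" for n
    by (intro integrable_continuous_real continuous_intros cg g continuous_on_symbol[OF ck(1)] continuous_on_symbol[OF ck(2)])+
  have conv: "line_convergent (\<lambda>k. cis (k * x + \<epsilon> * freq m k * t) * ((1/2) * of_real (k / freq m k) * ?a k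
      + (of_real (- \<delta> * \<epsilon> / 2) + of_real \<delta> * \<mu> / 2 * of_real (m / freq m k)) * ?b k))" if "\<epsilon> = 1 \<or> \<epsilon> = -1" for \<epsilon>
    by (rule data_integral_line_convergent[OF schwartz_data(1-3)[OF g(1)] schwartz_data(1-3)[OF g(2)]
        schwartz_data(4-5)[OF g(1)] schwartz_data(4-5)[OF g(2)] that \<delta> xt])
  show ?thesis
    unfolding data_integral_def
  proof (rule generalized_integral_diff_eqI[where T = "\<lambda>k. of_real \<delta> * ?fb k - ?fa k"])
    have "(\<lambda>n. of_real \<delta> * integral {-real n..real n} ?fb - integral {-real n..real n} ?fa) \<longlonglongrightarrow>
        of_real \<delta> * (2 * of_real pi * (1 * ?Q)) - 2 * of_real pi * (of_real \<delta> * ?D)"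
      by (intro tendsto_diff tendsto_mult_left signed_symbol_inversion[OF g(2) ck(2) \<delta> P]
          signed_symbol_inversion[OF g(1) ck(1) \<delta> E \<delta>2]) auto
    moreover have "integral {-real n..real n} (\<lambda>k. of_real \<delta> * ?fb k - ?fa k) =
        of_real \<delta> * integral {-real n..real n} ?fb - integral {-real n..real n} ?fa" for n
      by (intro integral_unique has_integral_diff has_integral_mult_right integrable_integral int)
    moreover have "of_real \<delta> * (2 * of_real pi * (1 * ?Q)) - 2 * of_real pi * (of_real \<delta> * ?D) = 2 * of_real pi * (of_real \<delta> * (?Q - ?D))"
      by (simp add: algebra_simps)
    ultimately show "(\<lambda>n. integral {-real n..real n} (\<lambda>k. of_real \<delta> * ?fb k - ?fa k)) \<longlonglongrightarrow> 2 * of_real pi * (of_real \<delta> * (?Q - ?D))"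
      by (simp only:)
    fix k :: real assume k: "k \<noteq> 0"
    let ?C = "complex_of_real (cos (freq m k * t))" and ?S = "complex_of_real (sin (freq m k * t))"
    have c: "cis (k * x + (-1) * freq m k * t) = cis (k * x) * (?C - \<i> * ?S)"
      "cis (k * x + 1 * freq m k * t) = cis (k * x) * (?C + \<i> * ?S)"
      unfolding cis_omega by (simp_all add: complex_eq_iff)
    have alg: "w * (C - \<i> * S) * ((1/2) * K * a + (d / 2 + d * \<mu> / 2 * M) * b) - w * (C + \<i> * S) * ((1/2) * K * a + (- d / 2 + d * \<mu> / 2 * M) * b)
        = d * (w * (C + - \<i> * \<mu> * M * S) * b) - w * (\<i> * K * S) * a" for w C S K a b d M :: complex
      by (simp add: field_simps)
    show "cis (k * x + (-1) * freq m k * t) * ((1/2) * of_real (k / freq m k) * ?a k + (of_real (- \<delta> * (-1) / 2) + of_real \<delta> * \<mu> / 2 * of_real (m / freq m k)) * ?b k)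
        - cis (k * x + 1 * freq m k * t) * ((1/2) * of_real (k / freq m k) * ?a k + (of_real (- \<delta> * 1 / 2) + of_real \<delta> * \<mu> / 2 * of_real (m / freq m k)) * ?b k)
        = of_real \<delta> * ?fb k - ?fa k"
      using alg[of "cis (k * x)" ?C ?S "of_real (k / freq m k)" "?a k" "of_real \<delta>" "of_real (m / freq m k)" "?b k"]
      unfolding c symbol_dsin_eq[OF k] symbol_mix_eq[OF k] by simp
  qed (rule conv, simp)+
qed

text \<open>Splitting the retarded exponentials into sine and cosine turns the boundary integrals into integrals of
  multipliers at the elapsed time \<open>t - y\<close>.\<close>

lemma delayed_waves:
  assumes "continuous_on {0..t} h"
  defines "W \<equiv> \<lambda>\<sigma> r. cis (- (\<sigma> * r * t)) * integral {0..t} (\<lambda>y. h y * cis (\<sigma> * r * y))"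
  shows "W 1 r - W (-1) r = - 2 * \<i> * integral {0..t} (\<lambda>y. h y * of_real (sin (r * (t - y))))"
    and "W 1 r + W (-1) r = 2 * integral {0..t} (\<lambda>y. h y * of_real (cos (r * (t - y))))"
proof -
  let ?c = "integral {0..t} (\<lambda>y. h y * of_real (cos (r * (t - y))))"
  let ?s = "integral {0..t} (\<lambda>y. h y * of_real (sin (r * (t - y))))"
  have W: "W \<sigma> r = ?c - \<i> * of_real \<sigma> * ?s" if "\<sigma> = 1 \<or> \<sigma> = -1" for \<sigma>
  proof -
    have "((\<lambda>y. h y * of_real (cos (r * (t - y))) - \<i> * of_real \<sigma> * (h y * of_real (sin (r * (t - y))))) has_integral
      ?c - \<i> * of_real \<sigma> * ?s) {0..t}"
      by (intro has_integral_diff has_integral_mult_right integrable_integral integrable_continuous_real continuous_intros assms)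
    moreover have "h y * of_real (cos (r * (t - y))) - \<i> * of_real \<sigma> * (h y * of_real (sin (r * (t - y))))
      = cis (- (\<sigma> * r * t)) * (h y * cis (\<sigma> * r * y))" for y
    proof -
      have "cis (- (\<sigma> * r * t)) * cis (\<sigma> * r * y) = cis (- (\<sigma> * (r * (t - y))))"
        by (simp add: cis_mult algebra_simps)
      also have "\<dots> = of_real (cos (r * (t - y))) - \<i> * of_real \<sigma> * of_real (sin (r * (t - y)))"
        using that by (auto simp: complex_eq_iff)
      finally have eq: "cis (- (\<sigma> * r * t)) * cis (\<sigma> * r * y) = of_real (cos (r * (t - y))) - \<i> * of_real \<sigma> * of_real (sin (r * (t - y)))" .
      have "h y * a - \<i> * of_real \<sigma> * (h y * b) = h y * (a - \<i> * of_real \<sigma> * b)" for a b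
        by (simp add: algebra_simps)
      then show ?thesis by (simp only: eq[symmetric] mult.left_commute)
    qed
    ultimately have "((\<lambda>y. cis (- (\<sigma> * r * t)) * (h y * cis (\<sigma> * r * y))) has_integral ?c - \<i> * of_real \<sigma> * ?s) {0..t}"
      by (simp only:)
    from integral_unique[OF this] show ?thesis unfolding W_def by (simp only: integral_mult_right)
  qed
  show "W 1 r - W (-1) r = - 2 * \<i> * ?s" "W 1 r + W (-1) r = 2 * ?c"
    using W[of 1] W[of "-1"] by (simp_all add: algebra_simps)
qed

lemma boundary_integral_diff:
  fixes m t :: real and c1 c2 c2' c3 \<beta> :: complex and h :: "real \<Rightarrow> complex"
  assumes h: "smooth_on {0..} h" and xt: "x > 0" "t > 0" "x \<noteq> t" and \<kappa>: "smooth_on UNIV (\<lambda>p. \<kappa> (fst p) (snd p))"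
  defines "W \<equiv> \<lambda>\<sigma> k. cis (- (\<sigma> * freq m k * t)) * integral {0..t} (\<lambda>y. h y * cis (\<sigma> * freq m k * y))"
  assumes sym: "\<And>k. k \<noteq> 0 \<Longrightarrow> (c1 * of_real (k / freq m k) + c2 + c3 * of_real (m / freq m k)) * W 1 k
      - (c1 * of_real (k / freq m k) + c2' + c3 * of_real (m / freq m k)) * W (-1) k
      = - 2 * integral {0..t} (\<lambda>y. h y * symbol (1/2) \<beta> \<kappa> k (t - y))"
  shows "boundary_integral m h c1 c2 c3 1 x t - boundary_integral m h c1 c2' c3 (-1) x t
    = - 2 * (2 * of_real pi * boundary_propagator \<beta> \<kappa> h x t)"
proof -
  let ?f = "\<lambda>k. cis (k * x) * integral {0..t} (\<lambda>y. h y * symbol (1/2) \<beta> \<kappa> k (t - y))"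
  have \<kappa>': "continuous_on UNIV (\<lambda>p. partial_x \<kappa> (fst p) (snd p))"
      "\<And>u s. ((\<lambda>u. \<kappa> u s) has_vector_derivative partial_x \<kappa> u s) (at u)"
    using smooth_on_imp_continuous_on[OF smooth_on_open_slices(3)[OF open_UNIV \<kappa>]] smooth_on_open_slices(1)[OF open_UNIV \<kappa>] by auto
  have "(\<lambda>n. integral {-real n..real n} ?f) \<longlonglongrightarrow> 2 * of_real pi * boundary_propagator \<beta> \<kappa> h x t"
    using symbol_inversion_interval[OF xt(2,1,3) boundary_data(1)[OF h] boundary_data(3)[OF h] smooth_on_imp_continuous_on[OF \<kappa>] \<kappa>',
        of "1/2" \<beta>]
    unfolding boundary_propagator_def by (auto split: if_splits)
  from tendsto_mult_left[OF this, of "-2"]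
  have lim: "(\<lambda>n. integral {-real n..real n} (\<lambda>k. - 2 * ?f k)) \<longlonglongrightarrow> - 2 * (2 * of_real pi * boundary_propagator \<beta> \<kappa> h x t)"
    by (simp only: integral_mult_right)
  note conv = boundary_integral_line_convergent[OF boundary_data(1,2,4)[OF h] _ xt, where m = m]
  show ?thesis
    unfolding boundary_integral_def
  proof (rule generalized_integral_diff_eqI[OF _ _ _ lim])
    fix k :: real assume k: "k \<noteq> 0"
    have "w * a * v - w * b * u = - 2 * (w * i)" if "a * v - b * u = - 2 * i" for w a v b u i :: complex
    proof -
      have "w * a * v - w * b * u = w * (a * v - b * u)" by (simp add: algebra_simps)
      then show ?thesis unfolding that by simp
    qed
    from this[OF sym[OF k]] show "cis (k * x) * (c1 * of_real (k / freq m k) + c2 + c3 * of_real (m / freq m k))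
        * (cis (- (1 * freq m k * t)) * integral {0..t} (\<lambda>y. h y * cis (1 * freq m k * y)))
      - cis (k * x) * (c1 * of_real (k / freq m k) + c2' + c3 * of_real (m / freq m k))
        * (cis (- (-1 * freq m k * t)) * integral {0..t} (\<lambda>y. h y * cis (-1 * freq m k * y))) = - 2 * ?f k"
      unfolding W_def .
  qed (rule conv; auto)+
qed

text \<open>The derivative symbol is odd in \<open>k\<close> and the mixed one even. Together with the signs in the definition this makes
  the right-hand side odd in \<open>x\<close>, apart from the contribution of the boundary datum.\<close>

lemma psi1_closed_form:
  assumes g: "g1 \<in> schwartz_half_line" "g2 \<in> schwartz_half_line" and h: "smooth_on {0..} h"
    and xt: "x > 0" "t > 0" "x \<noteq> t"
  shows "psi1 m g1 g2 h x t =
    - half_line_propagator (1/2) (- 1/2) (kernel_dsin m) g2 x t + half_line_propagator (1/2) (- 1/2) (kernel_dsin m) g2 (- x) t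
    + half_line_propagator (1/2) (1/2) (kernel_mix m (- \<i> * of_real m)) g1 x t
    - half_line_propagator (1/2) (1/2) (kernel_mix m (- \<i> * of_real m)) g1 (- x) t
    - 2 * boundary_propagator (- 1/2) (kernel_dsin m) h x t"
proof -
  have ch: "continuous_on {0..t} h"
    using smooth_on_imp_continuous_on[OF h] by (rule continuous_on_subset) auto
  have "boundary_integral m h 1 0 0 1 x t - boundary_integral m h 1 0 0 (-1) x t
      = - 2 * (2 * of_real pi * boundary_propagator (- 1/2) (kernel_dsin m) h x t)"
  proof (rule boundary_integral_diff[OF h xt smooth_on_kernels(3)])
    fix k :: real assume k: "k \<noteq> 0"
    let ?s = "integral {0..t} (\<lambda>y. h y * of_real (sin (freq m k * (t - y))))"
    have "integral {0..t} (\<lambda>y. h y * symbol (1/2) (- 1/2) (kernel_dsin m) k (t - y)) = \<i> * of_real (k / freq m k) * ?s"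
      unfolding symbol_dsin_eq[OF k] integral_mult_right[symmetric] by (simp add: mult_ac)
    moreover have "(1 * K + 0 + 0 * M) * v - (1 * K + 0 + 0 * M) * u = - 2 * (\<i> * K * s)" if "v - u = - 2 * \<i> * s" for K M v u s :: complex
      unfolding left_diff_distrib[symmetric] right_diff_distrib[symmetric] that by simp
    note this[OF delayed_waves(1)[OF ch, of "freq m k"]]
    ultimately show "(1 * of_real (k / freq m k) + 0 + 0 * of_real (m / freq m k)) *
        (cis (- (1 * freq m k * t)) * integral {0..t} (\<lambda>y. h y * cis (1 * freq m k * y)))
      - (1 * of_real (k / freq m k) + 0 + 0 * of_real (m / freq m k)) *
        (cis (- (-1 * freq m k * t)) * integral {0..t} (\<lambda>y. h y * cis (-1 * freq m k * y)))
      = - 2 * integral {0..t} (\<lambda>y. h y * symbol (1/2) (- 1/2) (kernel_dsin m) k (t - y))" by (simp only:)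
  qed
  note bd = this
  let ?D = "\<lambda>x. half_line_propagator (1/2) (- 1/2) (kernel_dsin m) g2 x t" and ?M = "\<lambda>x. half_line_propagator (1/2) (1/2) (kernel_mix m (- \<i> * of_real m)) g1 x t"
    and ?B = "boundary_propagator (- 1/2) (kernel_dsin m) h x t"
  have d1: "data_integral m g2 g1 1 1 (-1) x t - data_integral m g2 g1 1 1 1 x t = 2 * of_real pi * (?M x - ?D x)"
    using data_integral_diff[OF g(2,1) xt, of 1 m 1] by simp
  have d2: "data_integral m g2 g1 1 (-1) (-1) x t - data_integral m g2 g1 1 (-1) 1 x t = 2 * of_real pi * (?D (- x) - ?M (- x))"
    using data_integral_diff[OF g(2,1) xt, of "-1" m 1] by simp
  have "psi1 m g1 g2 h x t * (2 * of_real pi) = (data_integral m g2 g1 1 1 (-1) x t - data_integral m g2 g1 1 1 1 x t)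
      + (data_integral m g2 g1 1 (-1) (-1) x t - data_integral m g2 g1 1 (-1) 1 x t)
      + (boundary_integral m h 1 0 0 1 x t - boundary_integral m h 1 0 0 (-1) x t)"
    unfolding psi1_def G_eq_data_integral H_eq_boundary_integral by simp
  also have "\<dots> = (- ?D x + ?D (- x) + ?M x - ?M (- x) - 2 * ?B) * (2 * of_real pi)"
    unfolding d1 d2 bd by (simp add: algebra_simps)
  finally have "psi1 m g1 g2 h x t * (2 * of_real pi) = (- ?D x + ?D (- x) + ?M x - ?M (- x) - 2 * ?B) * (2 * of_real pi)" .
  then show ?thesis by (rule mult_right_cancel[THEN iffD1, rotated]) simp
qed

text \<open>Here the signs make the right-hand side even in \<open>x\<close>, again apart from the contribution of the boundary datum.\<close>

lemma psi2_closed_form: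
  assumes g: "g1 \<in> schwartz_half_line" "g2 \<in> schwartz_half_line" and h: "smooth_on {0..} h"
    and xt: "x > 0" "t > 0" "x \<noteq> t"
  shows "psi2 m g1 g2 h x t =
    - half_line_propagator (1/2) (- 1/2) (kernel_dsin m) g1 x t - half_line_propagator (1/2) (- 1/2) (kernel_dsin m) g1 (- x) t
    + half_line_propagator (1/2) (1/2) (kernel_mix m (\<i> * of_real m)) g2 x t
    + half_line_propagator (1/2) (1/2) (kernel_mix m (\<i> * of_real m)) g2 (- x) t
    + 2 * boundary_propagator (1/2) (kernel_mix m (\<i> * of_real m)) h x t"
proof -
  have ch: "continuous_on {0..t} h"
    using smooth_on_imp_continuous_on[OF h] by (rule continuous_on_subset) auto
  have "boundary_integral m h 0 (-1) 1 1 x t - boundary_integral m h 0 1 1 (-1) x t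
      = - 2 * (2 * of_real pi * boundary_propagator (1/2) (kernel_mix m (\<i> * of_real m)) h x t)"
  proof (rule boundary_integral_diff[OF h xt smooth_on_kernels(4)])
    fix k :: real assume k: "k \<noteq> 0"
    let ?s = "integral {0..t} (\<lambda>y. h y * of_real (sin (freq m k * (t - y))))"
    let ?c = "integral {0..t} (\<lambda>y. h y * of_real (cos (freq m k * (t - y))))"
    have "integral {0..t} (\<lambda>y. h y * symbol (1/2) (1/2) (kernel_mix m (\<i> * of_real m)) k (t - y)) = ?c + \<i> * of_real (m / freq m k) * ?s"
    proof (rule integral_unique)
      have "((\<lambda>y. h y * of_real (cos (freq m k * (t - y))) + \<i> * of_real (m / freq m k) * (h y * of_real (sin (freq m k * (t - y)))))
          has_integral ?c + \<i> * of_real (m / freq m k) * ?s) {0..t}"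
        by (intro has_integral_add has_integral_mult_right integrable_integral integrable_continuous_real continuous_intros ch)
      then show "((\<lambda>y. h y * symbol (1/2) (1/2) (kernel_mix m (\<i> * of_real m)) k (t - y)) has_integral ?c + \<i> * of_real (m / freq m k) * ?s) {0..t}"
        by (rule has_integral_eq[rotated]) (simp add: symbol_mix_eq[OF k] algebra_simps)
    qed
    moreover have "(0 * K + (-1) + 1 * M) * v - (0 * K + 1 + 1 * M) * u = - 2 * (c + \<i> * M * s)"
      if "v - u = - 2 * \<i> * s" "v + u = 2 * c" for K M v u s c :: complex
    proof -
      have "(0 * K + (-1) + 1 * M) * v - (0 * K + 1 + 1 * M) * u = M * (v - u) - (v + u)" by (simp add: algebra_simps)
      then show ?thesis unfolding that by (simp add: algebra_simps)
    qed
    note this[OF delayed_waves[OF ch, of "freq m k"]]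
    ultimately show "(0 * of_real (k / freq m k) + -1 + 1 * of_real (m / freq m k)) *
        (cis (- (1 * freq m k * t)) * integral {0..t} (\<lambda>y. h y * cis (1 * freq m k * y)))
      - (0 * of_real (k / freq m k) + 1 + 1 * of_real (m / freq m k)) *
        (cis (- (-1 * freq m k * t)) * integral {0..t} (\<lambda>y. h y * cis (-1 * freq m k * y)))
      = - 2 * integral {0..t} (\<lambda>y. h y * symbol (1/2) (1/2) (kernel_mix m (\<i> * of_real m)) k (t - y))" by (simp only:)
  qed
  note bd = this
  let ?D = "\<lambda>x. half_line_propagator (1/2) (- 1/2) (kernel_dsin m) g1 x t" and ?M = "\<lambda>x. half_line_propagator (1/2) (1/2) (kernel_mix m (\<i> * of_real m)) g2 x t"
    and ?B = "boundary_propagator (1/2) (kernel_mix m (\<i> * of_real m)) h x t"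
  have d1: "data_integral m g1 g2 (-1) 1 (-1) x t - data_integral m g1 g2 (-1) 1 1 x t = 2 * of_real pi * (?M x - ?D x)"
    using data_integral_diff[OF g xt, of 1 m "-1"] by simp
  have d2: "data_integral m g1 g2 (-1) (-1) (-1) x t - data_integral m g1 g2 (-1) (-1) 1 x t = 2 * of_real pi * (?D (- x) - ?M (- x))"
    using data_integral_diff[OF g xt, of "-1" m "-1"] by simp
  have "psi2 m g1 g2 h x t * (2 * of_real pi) = (data_integral m g1 g2 (-1) 1 (-1) x t - data_integral m g1 g2 (-1) 1 1 x t)
      - (data_integral m g1 g2 (-1) (-1) (-1) x t - data_integral m g1 g2 (-1) (-1) 1 x t)
      - (boundary_integral m h 0 (-1) 1 1 x t - boundary_integral m h 0 1 1 (-1) x t)"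
    unfolding psi2_def G_eq_data_integral H_eq_boundary_integral by simp
  also have "\<dots> = (- ?D x - ?D (- x) + ?M x + ?M (- x) + 2 * ?B) * (2 * of_real pi)"
    unfolding d1 d2 bd by (simp add: algebra_simps)
  finally have "psi2 m g1 g2 h x t * (2 * of_real pi) = (- ?D x - ?D (- x) + ?M x + ?M (- x) + 2 * ?B) * (2 * of_real pi)" .
  then show ?thesis by (rule mult_right_cancel[THEN iffD1, rotated]) simp
qed

section \<open>Smoothness in the two sectors\<close>

lemma smooth_on_kernel_compose:
  fixes \<kappa> :: "real \<Rightarrow> real \<Rightarrow> complex" and \<phi> \<zeta> :: "'a::euclidean_space \<Rightarrow> real"
  assumes "smooth_on UNIV (\<lambda>p. \<kappa> (fst p) (snd p))"
    and "smooth_on S (\<lambda>p. complex_of_real (\<phi> p))" "smooth_on S (\<lambda>p. complex_of_real (\<zeta> p))"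
  shows "smooth_on S (\<lambda>p. \<kappa> (\<phi> p) (\<zeta> p))"
  using smooth_on_compose_Pair[OF assms] by simp

lemma convex_abs_snd_less: "convex {p::real \<times> real. \<bar>snd p\<bar> < fst p}"
  and convex_abs_fst_less: "convex {p::real \<times> real. \<bar>fst p\<bar> < snd p}"
proof -
  have "{p::real \<times> real. \<bar>snd p\<bar> < fst p} = {p. (-1, 1) \<bullet> p < 0} \<inter> {p. (-1, -1) \<bullet> p < 0}"
    by (auto simp: inner_prod_def)
  then show "convex {p::real \<times> real. \<bar>snd p\<bar> < fst p}"
    by (simp add: convex_Int convex_halfspace_lt)
  have "{p::real \<times> real. \<bar>fst p\<bar> < snd p} = {p. (1, -1) \<bullet> p < 0} \<inter> {p. (-1, -1) \<bullet> p < 0}"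
    by (auto simp: inner_prod_def)
  then show "convex {p::real \<times> real. \<bar>fst p\<bar> < snd p}"
    by (simp add: convex_Int convex_halfspace_lt)
qed

text \<open>For \<open>\<bar>t\<bar> < x\<close> the interval of dependence \<open>[x - t, x + t]\<close> consists of positive points, and the continuation by
  zero is not felt.\<close>

definition right_propagator ::
    "complex \<Rightarrow> complex \<Rightarrow> (real \<Rightarrow> real \<Rightarrow> complex) \<Rightarrow> (real \<Rightarrow> complex) \<Rightarrow> real \<Rightarrow> real \<Rightarrow> complex" where
  "right_propagator \<alpha> \<beta> \<kappa> g x t = \<alpha> * g (x + t) + \<beta> * g (x - t)
      + of_real t * integral {-1..1} (\<lambda>r. \<kappa> (t * r) t * g (x - t * r))"

text \<open>For \<open>\<bar>x\<bar> < t\<close> the mass at \<open>t\<close> only sees the zero continuation, and the convolution is cut off at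
  \<open>u = x\<close>. Here \<open>[- t, x]\<close> is parametrised by \<open>u = - t + (x + t) r\<close>; with fixed limits of integration the expression is smooth
  across \<open>x = 0\<close>.\<close>

definition left_propagator ::
    "complex \<Rightarrow> (real \<Rightarrow> real \<Rightarrow> complex) \<Rightarrow> (real \<Rightarrow> complex) \<Rightarrow> real \<Rightarrow> real \<Rightarrow> complex" where
  "left_propagator \<alpha> \<kappa> g x t = \<alpha> * g (x + t)
      + of_real (x + t) * integral {0..1} (\<lambda>r. \<kappa> (- t + (x + t) * r) t * g ((x + t) * (1 - r)))"

definition left_boundary_propagator ::
    "complex \<Rightarrow> (real \<Rightarrow> real \<Rightarrow> complex) \<Rightarrow> (real \<Rightarrow> complex) \<Rightarrow> real \<Rightarrow> real \<Rightarrow> complex" where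
  "left_boundary_propagator \<beta> \<kappa> h x t = \<beta> * h (t - x)
      + of_real (t - x) * integral {0..1} (\<lambda>r. h ((t - x) * r) * \<kappa> x (t - (t - x) * r))"

lemma abs_mult_le_abs: "\<bar>r\<bar> \<le> 1 \<Longrightarrow> \<bar>t * r\<bar> \<le> \<bar>t::real\<bar>"
  by (simp add: abs_mult mult_left_le)

lemma half_line_propagator_right:
  assumes "0 < t" "t < x"
  shows "half_line_propagator \<alpha> \<beta> \<kappa> g x t = right_propagator \<alpha> \<beta> \<kappa> g x t"
    and "half_line_propagator \<alpha> \<beta> \<kappa> g (- x) t = 0"
proof -
  have r: "\<bar>t * r\<bar> < x" if "r \<in> {-1..1}" for r
  proof -
    have "\<bar>r\<bar> \<le> 1" using that by auto
    from abs_mult_le_abs[OF this, of t] show ?thesis using assms by linarith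
  qed
  have pos: "half_line_extension g z = g z" if "z > 0" for z using that by (simp add: half_line_extension_def)
  have neg: "half_line_extension g z = 0" if "z < 0" for z using that by (simp add: half_line_extension_def)
  have "integral {-1..1} (\<lambda>r. \<kappa> (t * r) t * half_line_extension g (x - t * r)) = integral {-1..1} (\<lambda>r. \<kappa> (t * r) t * g (x - t * r))"
  proof (rule integral_cong)
    fix r :: real assume "r \<in> {-1..1}"
    then show "\<kappa> (t * r) t * half_line_extension g (x - t * r) = \<kappa> (t * r) t * g (x - t * r)"
      using r[of r] by (subst pos) auto
  qed
  then show "half_line_propagator \<alpha> \<beta> \<kappa> g x t = right_propagator \<alpha> \<beta> \<kappa> g x t"
    unfolding half_line_propagator_def right_propagator_def using assms by (simp add: pos)
  have "integral {-1..1} (\<lambda>r. \<kappa> (t * r) t * half_line_extension g (- x - t * r)) = integral {-1..1} (\<lambda>r::real. 0)"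
  proof (rule integral_cong)
    fix r :: real assume "r \<in> {-1..1}"
    then show "\<kappa> (t * r) t * half_line_extension g (- x - t * r) = 0"
      using r[of r] by (subst neg) auto
  qed
  then show "half_line_propagator \<alpha> \<beta> \<kappa> g (- x) t = 0"
    unfolding half_line_propagator_def using assms by (simp add: neg)
qed

lemma half_line_propagator_left:
  assumes "\<bar>x\<bar> < t" and g: "continuous_on {0..} g" and \<kappa>: "continuous_on UNIV (\<lambda>p. \<kappa> (fst p) (snd p))"
  shows "half_line_propagator \<alpha> \<beta> \<kappa> g x t = left_propagator \<alpha> \<kappa> g x t"
proof -
  have t: "t > 0" using assms by linarith
  have pos: "half_line_extension g z = g z" if "z > 0" for z using that by (simp add: half_line_extension_def)
  have neg: "half_line_extension g z = 0" if "z < 0" for z using that by (simp add: half_line_extension_def)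
  let ?F = "\<lambda>u. \<kappa> u t * g (x - u)"
  have cg: "continuous_on S (\<lambda>r. g (f r))" if "continuous_on S f" "\<And>r. r \<in> S \<Longrightarrow> f r \<ge> 0" for S and f :: "real \<Rightarrow> real"
    by (rule continuous_on_compose2[OF g that(1)]) (use that(2) in auto)
  have cF: "continuous_on {-t..x} ?F"
    by (intro continuous_intros continuous_on_kernel[OF \<kappa>] cg) auto
  have le: "t * r \<le> x" if "r \<le> x / t" for r using that t by (simp add: pos_le_divide_eq mult.commute)
  have "((\<lambda>r. ?F (t * r)) has_integral integral {-1..x / t} (\<lambda>r. ?F (t * r))) {-1..x / t}"
    by (intro integrable_integral integrable_continuous_real continuous_intros continuous_on_kernel[OF \<kappa>] cg) (use le in auto)
  then have "((\<lambda>r. if r \<in> {-1..x / t} then ?F (t * r) else 0) has_integral integral {-1..x / t} (\<lambda>r. ?F (t * r))) {-1..1}"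
    using assms(1) t by (subst has_integral_restrict) (auto simp: pos_divide_le_eq)
  then have "((\<lambda>r. \<kappa> (t * r) t * half_line_extension g (x - t * r)) has_integral integral {-1..x / t} (\<lambda>r. ?F (t * r))) {-1..1}"
  proof (rule has_integral_spike_finite[rotated 2, of _ _ _ "{x / t}"])
    fix r assume r: "r \<in> {-1..1} - {x / t}"
    show "\<kappa> (t * r) t * half_line_extension g (x - t * r) = (if r \<in> {-1..x / t} then ?F (t * r) else 0)"
    proof (cases "r < x / t")
      case True
      then have "x - t * r > 0" using t by (simp add: pos_less_divide_eq mult.commute)
      then show ?thesis using True r by (simp add: pos)
    next
      case False
      then have "r > x / t" using r by auto
      then have "x - t * r < 0" using t by (simp add: pos_divide_less_eq mult.commute)
      then show ?thesis using \<open>r > x / t\<close> by (simp add: neg)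
    qed
  qed simp
  then have "of_real t * integral {-1..1} (\<lambda>r. \<kappa> (t * r) t * half_line_extension g (x - t * r))
      = of_real t * integral {-1..x / t} (\<lambda>r. ?F (0 + t * r))"
    by (simp add: integral_unique)
  also have "\<dots> = integral {0 + t * (-1)..0 + t * (x / t)} ?F"
    by (rule integral_rescale) (use assms(1) t cF in \<open>auto simp: pos_le_divide_eq\<close>)
  also have "{0 + t * (-1)..0 + t * (x / t)} = {- t + (x + t) * 0..- t + (x + t) * 1}" using t by simp
  also have "integral \<dots> ?F = of_real (x + t) * integral {0..1} (\<lambda>r. ?F (- t + (x + t) * r))"
    by (rule integral_rescale[symmetric]) (use assms(1) cF in auto)
  also have "(\<lambda>r. ?F (- t + (x + t) * r)) = (\<lambda>r. \<kappa> (- t + (x + t) * r) t * g ((x + t) * (1 - r)))"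
    by (simp add: algebra_simps)
  finally show ?thesis
    unfolding half_line_propagator_def left_propagator_def using assms(1) by (simp add: pos neg)
qed

lemma boundary_propagator_left:
  assumes "x < t" and h: "continuous_on {0..} h" and \<kappa>: "continuous_on UNIV (\<lambda>p. \<kappa> (fst p) (snd p))"
  shows "boundary_propagator \<beta> \<kappa> h x t = left_boundary_propagator \<beta> \<kappa> h x t"
proof -
  have "of_real (t - x) * integral {0..1} (\<lambda>r. (\<lambda>y. h y * \<kappa> x (t - y)) (0 + (t - x) * r)) =
      integral {0 + (t - x) * 0..0 + (t - x) * 1} (\<lambda>y. h y * \<kappa> x (t - y))"
    by (rule integral_rescale)
      (use assms(1) in \<open>auto intro!: continuous_intros continuous_on_kernel[OF \<kappa>] continuous_on_subset[OF h]\<close>)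
  then show ?thesis unfolding boundary_propagator_def left_boundary_propagator_def using assms(1) by simp
qed

lemma smooth_on_right_propagator:
  assumes g: "smooth_on {0..} g" and \<kappa>: "smooth_on UNIV (\<lambda>p. \<kappa> (fst p) (snd p))"
  shows "smooth_on {p. \<bar>snd p\<bar> < fst p} (\<lambda>p. right_propagator \<alpha> \<beta> \<kappa> g (fst p) (snd p))"
proof -
  let ?U = "{p::real \<times> real. \<bar>snd p\<bar> < fst p}"
  have r: "fst q - snd q * r \<ge> 0" if "\<bar>snd q\<bar> < fst q" "r \<in> {-1..1}" for q :: "real \<times> real" and r
    using abs_mult_le_abs[of r "snd q"] that by (auto simp: abs_le_iff)
  have "smooth_on ?U (\<lambda>p. integral {-1..1} (\<lambda>r. (\<lambda>q. \<kappa> (snd (fst q) * snd q) (snd (fst q)) * g (fst (fst q) - snd (fst q) * snd q)) (p, r)))"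
    by (intro smooth_on_integral convex_abs_snd_less smooth_on_mult smooth_on_kernel_compose[OF \<kappa>] smooth_on_compose_real[OF g]
        smooth_on_of_real_intros) (use r in auto)
  then have "smooth_on ?U (\<lambda>p. integral {-1..1} (\<lambda>r. \<kappa> (snd p * r) (snd p) * g (fst p - snd p * r)))" by simp
  then show ?thesis unfolding right_propagator_def
    by (intro smooth_on_add smooth_on_mult smooth_on_const smooth_on_compose_real[OF g] smooth_on_of_real_intros) auto
qed

lemma smooth_on_left_propagator:
  assumes g: "smooth_on {0..} g" and \<kappa>: "smooth_on UNIV (\<lambda>p. \<kappa> (fst p) (snd p))"
  shows "smooth_on {p. \<bar>fst p\<bar> < snd p} (\<lambda>p. left_propagator \<alpha> \<kappa> g (fst p) (snd p))"
    and "smooth_on {p. \<bar>fst p\<bar> < snd p} (\<lambda>p. left_propagator \<alpha> \<kappa> g (- fst p) (snd p))"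
proof -
  let ?U = "{p::real \<times> real. \<bar>fst p\<bar> < snd p}"
  have one: "smooth_on S (\<lambda>p. complex_of_real 1)" for S :: "((real \<times> real) \<times> real) set" by (rule smooth_on_const)
  have "smooth_on ?U (\<lambda>p. integral {0..1} (\<lambda>r. (\<lambda>q. \<kappa> (- snd (fst q) + (fst (fst q) + snd (fst q)) * snd q) (snd (fst q))
      * g ((fst (fst q) + snd (fst q)) * (1 - snd q))) (p, r)))"
    by (intro smooth_on_integral convex_abs_fst_less smooth_on_mult smooth_on_kernel_compose[OF \<kappa>] smooth_on_compose_real[OF g]
        smooth_on_of_real_intros one) auto
  then have "smooth_on ?U (\<lambda>p. integral {0..1} (\<lambda>r. \<kappa> (- snd p + (fst p + snd p) * r) (snd p) * g ((fst p + snd p) * (1 - r))))" by simp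
  then show 1: "smooth_on ?U (\<lambda>p. left_propagator \<alpha> \<kappa> g (fst p) (snd p))"
    unfolding left_propagator_def
    by (intro smooth_on_add smooth_on_mult smooth_on_const smooth_on_compose_real[OF g] smooth_on_of_real_intros) auto
  have "smooth_on ?U (\<lambda>p. (\<lambda>q. left_propagator \<alpha> \<kappa> g (fst q) (snd q)) (- fst p, snd p))"
    by (rule smooth_on_compose_Pair[OF 1 smooth_on_of_real_minus[OF smooth_on_linear[OF bounded_linear_fst]]
          smooth_on_linear[OF bounded_linear_snd]]) auto
  then show "smooth_on ?U (\<lambda>p. left_propagator \<alpha> \<kappa> g (- fst p) (snd p))" by simp
qed

lemma smooth_on_left_boundary_propagator:
  assumes h: "smooth_on {0..} h" and \<kappa>: "smooth_on UNIV (\<lambda>p. \<kappa> (fst p) (snd p))"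
  shows "smooth_on {p. \<bar>fst p\<bar> < snd p} (\<lambda>p. left_boundary_propagator \<beta> \<kappa> h (fst p) (snd p))"
proof -
  let ?U = "{p::real \<times> real. \<bar>fst p\<bar> < snd p}"
  have "smooth_on ?U (\<lambda>p. integral {0..1} (\<lambda>r. (\<lambda>q. h ((snd (fst q) - fst (fst q)) * snd q)
      * \<kappa> (fst (fst q)) (snd (fst q) - (snd (fst q) - fst (fst q)) * snd q)) (p, r)))"
    by (intro smooth_on_integral convex_abs_fst_less smooth_on_mult smooth_on_kernel_compose[OF \<kappa>] smooth_on_compose_real[OF h]
        smooth_on_of_real_intros) auto
  then have "smooth_on ?U (\<lambda>p. integral {0..1} (\<lambda>r. h ((snd p - fst p) * r) * \<kappa> (fst p) (snd p - (snd p - fst p) * r)))" by simp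
  then show ?thesis
    unfolding left_boundary_propagator_def
    by (intro smooth_on_add smooth_on_mult smooth_on_const smooth_on_compose_real[OF h] smooth_on_of_real_intros) auto
qed

theorem theorem2:
  fixes m :: real and g1 g2 h1 :: "real \<Rightarrow> complex"
  assumes "m \<ge> 0"
    and "g1 \<in> schwartz_half_line" and "g2 \<in> schwartz_half_line"
    and "smooth_on {0..} h1"
  shows "(\<forall>n l. partial_limit_at_t0 n l (psi1 m g1 g2 h1) \<and> partial_limit_at_t0 n l (psi2 m g1 g2 h1)) \<and>
         (\<forall>n l. partial_limit_at_x0 n l (psi1 m g1 g2 h1) \<and> partial_limit_at_x0 n l (psi2 m g1 g2 h1)) \<and>
         (\<forall>\<psi>\<in>{psi1 m g1 g2 h1, psi2 m g1 g2 h1}. extends_smoothly_near {(x, 0) | x. x > 0} \<psi> \<and>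
                     extends_smoothly_near {(0, t) | t. t > 0} \<psi>) \<and>
         (\<forall>n. \<forall>x>0. ((\<lambda>t. mixed_partial n 0 (psi1 m g1 g2 h1) x t) \<longlongrightarrow> half_line_deriv n g1 x) (at_right 0) \<and>
                    ((\<lambda>t. mixed_partial n 0 (psi2 m g1 g2 h1) x t) \<longlongrightarrow> half_line_deriv n g2 x) (at_right 0)) \<and>
         (\<forall>l. \<forall>t>0. ((\<lambda>x. mixed_partial 0 l (psi1 m g1 g2 h1) x t) \<longlongrightarrow> half_line_deriv l h1 t) (at_right 0))"
proof -
  let ?\<psi>1 = "psi1 m g1 g2 h1" and ?\<psi>2 = "psi2 m g1 g2 h1"
  let ?\<kappa> = "kernel_dsin m" and ?\<mu> = "kernel_mix m (- \<i> * of_real m)" and ?\<nu> = "kernel_mix m (\<i> * of_real m)"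
  note g = assms(2,3) and h = assms(4)
  have sg: "smooth_on {0..} g1" "smooth_on {0..} g2" using g unfolding schwartz_half_line_def by auto
  note cg = smooth_on_imp_continuous_on[OF sg(1)] smooth_on_imp_continuous_on[OF sg(2)]
  note ch = smooth_on_imp_continuous_on[OF h]
  note sk = smooth_on_kernels(3,4)
  note ck = smooth_on_imp_continuous_on[OF smooth_on_kernels(3)] smooth_on_imp_continuous_on[OF smooth_on_kernels(4)]
  define R1 where "R1 x t = - right_propagator (1/2) (- 1/2) ?\<kappa> g2 x t + right_propagator (1/2) (1/2) ?\<mu> g1 x t" for x t
  define R2 where "R2 x t = - right_propagator (1/2) (- 1/2) ?\<kappa> g1 x t + right_propagator (1/2) (1/2) ?\<nu> g2 x t" for x t
  define L1 where "L1 x t = - left_propagator (1/2) ?\<kappa> g2 x t + left_propagator (1/2) ?\<kappa> g2 (- x) t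
      + left_propagator (1/2) ?\<mu> g1 x t - left_propagator (1/2) ?\<mu> g1 (- x) t
      - 2 * left_boundary_propagator (- 1/2) ?\<kappa> h1 x t" for x t
  define L2 where "L2 x t = - left_propagator (1/2) ?\<kappa> g1 x t - left_propagator (1/2) ?\<kappa> g1 (- x) t
      + left_propagator (1/2) ?\<nu> g2 x t + left_propagator (1/2) ?\<nu> g2 (- x) t
      + 2 * left_boundary_propagator (1/2) ?\<nu> h1 x t" for x t
  have R1: "?\<psi>1 x t = R1 x t" and R2: "?\<psi>2 x t = R2 x t" if "0 < t" "t < x" for x t
  proof -
    have "\<not> x < t" "x > 0" "x \<noteq> t" using that by auto
    then show "?\<psi>1 x t = R1 x t" "?\<psi>2 x t = R2 x t"
      using that by (simp_all add: psi1_closed_form[OF g h] psi2_closed_form[OF g h] R1_def R2_def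
          half_line_propagator_right boundary_propagator_def)
  qed
  have L1: "?\<psi>1 x t = L1 x t" and L2: "?\<psi>2 x t = L2 x t" if "0 < x" "x < t" for x t
  proof -
    have a: "\<bar>x\<bar> < t" "\<bar>- x\<bar> < t" "t > 0" "x \<noteq> t" using that by auto
    show "?\<psi>1 x t = L1 x t"
      unfolding psi1_closed_form[OF g h that(1) a(3,4)] L1_def
        half_line_propagator_left[OF a(1) cg(1) ck(2)] half_line_propagator_left[OF a(2) cg(1) ck(2)]
        half_line_propagator_left[OF a(1) cg(2) ck(1)] half_line_propagator_left[OF a(2) cg(2) ck(1)]
        boundary_propagator_left[OF that(2) ch ck(1)] ..
    show "?\<psi>2 x t = L2 x t"
      unfolding psi2_closed_form[OF g h that(1) a(3,4)] L2_def
        half_line_propagator_left[OF a(1) cg(2) ck(2)] half_line_propagator_left[OF a(2) cg(2) ck(2)]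
        half_line_propagator_left[OF a(1) cg(1) ck(1)] half_line_propagator_left[OF a(2) cg(1) ck(1)]
        boundary_propagator_left[OF that(2) ch ck(2)] ..
  qed
  have sR: "smooth_on {p. \<bar>snd p\<bar> < fst p} (\<lambda>p. R1 (fst p) (snd p))" "smooth_on {p. \<bar>snd p\<bar> < fst p} (\<lambda>p. R2 (fst p) (snd p))"
    unfolding R1_def R2_def
    by (intro smooth_on_add smooth_on_uminus smooth_on_right_propagator sg sk)+
  have sL: "smooth_on {p. \<bar>fst p\<bar> < snd p} (\<lambda>p. L1 (fst p) (snd p))" "smooth_on {p. \<bar>fst p\<bar> < snd p} (\<lambda>p. L2 (fst p) (snd p))"
    unfolding L1_def L2_def
    by (intro smooth_on_add smooth_on_diff smooth_on_uminus smooth_on_mult smooth_on_const smooth_on_left_propagator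
        smooth_on_left_boundary_propagator sg sk h)+
  (* For t = 0 the two masses act at the same point and the kernel integral has the factor t. *)
  have v: "R1 x 0 = g1 x" "R2 x 0 = g2 x" for x
    by (simp_all add: R1_def R2_def right_propagator_def)
  (* For x = 0 the direct and the reflected terms cancel; the density of the derivative symbol is
     odd in its first argument and hence vanishes there. *)
  have w: "L1 0 t = h1 t" for t
    by (simp add: L1_def left_boundary_propagator_def kernel_dsin_def)
  note b1 = boundary_values_t0[where \<psi> = ?\<psi>1, OF sR(1) R1] and b2 = boundary_values_t0[where \<psi> = ?\<psi>2, OF sR(2) R2]
    and b3 = boundary_values_x0[where \<psi> = ?\<psi>1, OF sL(1) L1] and b4 = boundary_values_x0[where \<psi> = ?\<psi>2, OF sL(2) L2]
  show ?thesis
    using b1(1,2) b2(1,2) b3(1,2) b4(1,2) b1(3)[OF _ _ v(1)] b2(3)[OF _ _ v(2)] b3(3)[OF _ _ w] by auto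
qed

end
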